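(* Let $d\in\mathbb{N}$, $\beta\ge 1$, $\ell$ the largest integer strictly smaller than $\beta$, $L_0,\dots,L_\ell,L_\beta>0$, $C_{\mathsf{noise}},C_{\mathsf{cvr}}>0$. There is a constant $C>0$ large enough, depending only on $d,n_{\mathsf{max}},\beta,L_0,\dots,L_\ell,L_\beta,C_{\mathsf{noise}},C_{\mathsf{cvr}}$, with the following property. Consider the ODE observation model described in the context, satisfying (Noise), (Cover) and (EquidistantTime) with time step $\Delta t>0$. Assume $\Delta t\le C^{-1}$ and $n\,\Delta t^2\ge C$. Then, for all $x_0\in[0,1]^d$, $$C\inf_{\hat f}\sup_{f^\star\in\mathcal{F}_{d,\beta}}\mathbf{E}_{f^\star}\big[\|\hat f(x_0)-f^\star(x_0)\|_2^2\big]\ge n^{-\frac{2\beta}{2(\beta+1)+d}},$$ and $$C\inf_{\hat f}\sup_{f^\star\in\mathcal{F}_{d,\beta}}\mathbf{E}_{f^\star}\Big[\sup_{x\in[0,1]^d}\|\hat f(x)-f^\star(x)\|_2^2\Big]\ge \Big(\frac{n}{\log n}\Big)^{-\frac{2\beta}{2(\beta+1)+d}},$$ $$C\inf_{\hat f}\sup_{f^\star\in\mathcal{F}_{d,\beta}}\mathbf{E}_{f^\star}\Big[\big\|\,\|\hat f-f^\star\|_2\,\big\|_{L^2([0,1]^d)}^2\Big]\ge n^{-\frac{2\beta}{2(\beta+1)+d}},$$ where the infima range over all estimators $\hat f$ of $f^\star$ based on the observations $(Y_{j,i})$.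
   Context: Smoothness class: $\mathcal{F}_{d,\beta}$ is the set of functions $f=(f_1,\dots,f_d):\mathbb{R}^d\to\mathbb{R}^d$ such that each component $f_j$ is $\ell$ times differentiable, $\sup_x\|D^kf_j(x)\|_{\mathsf{op}}\le L_k$ for $k=0,\dots,\ell$, and $\|D^\ell f_j(x)-D^\ell f_j(\tilde x)\|_{\mathsf{op}}\le L_\beta\|x-\tilde x\|_2^{\beta-\ell}$ for all $x,\tilde x\in\mathbb{R}^d$. Here $D^k f_j(x)$ is the $k$-th derivative as a symmetric $k$-linear form and $\|A\|_{\mathsf{op}}=\sup\{|A(v_1,\dots,v_k)|:\|v_i\|_2=1\}$; $\|\cdot\|_2$ is the Euclidean norm. Flow: for Lipschitz $f:\mathbb{R}^d\to\mathbb{R}^d$ and $x\in\mathbb{R}^d$, $t\mapsto U(f,x,t)$, $t\in\mathbb{R}$, is the solution of $\dot u(t)=f(u(t))$, $u(0)=x$. Observation model: $m\in\mathbb{N}$ trajectories; $n_1,\dots,n_m\in\mathbb{N}$ observations per trajectory, $n_{\mathsf{max}}=\max_j n_j$, total number of observations $n=\sum_jn_j$; durations $T_1,\dots,T_m>0$; known observation times $0=t_{j,0}\le t_{j,1}\le\dots\le t_{j,n_j}=T_j$; known initial conditions $x_1,\dots,x_m\in\mathbb{R}^d$. One observes $$Y_{j,i}=U(f^\star,x_j,t_{j,i})+\varepsilon_{j,i},\qquad j\in\{1,\dots,m\},\ i\in\{1,\dots,n_j\},$$ with $f^\star\in\mathcal{F}_{d,\beta}$ unknown and $\varepsilon_{j,i}$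 i.i.d. centered $\mathbb{R}^d$-valued with distribution $P^\varepsilon$. $\mathbf{E}_{f^\star}$ is the corresponding expectation. (Noise): for all $v_1,v_2\in\mathbb{R}^d$, $\mathrm{KL}(v_1+P^\varepsilon,v_2+P^\varepsilon)\le C_{\mathsf{noise}}\|v_1-v_2\|_2^2$, where $\mathrm{KL}$ is the Kullback–Leibler divergence and $v+P$ is the distribution $P$ shifted by $v$. (Cover): for all $z\in[0,1]^d$ and $r>0$, $\frac1m\#\{j\in\{1,\dots,m\}:\|x_j-z\|_2<r\}\le\max(\frac1m,C_{\mathsf{cvr}}r^d)$. (EquidistantTime): $t_{j,i+1}-t_{j,i}=\Delta t$ for all $j\in\{1,\dots,m\}$ and $i\in\{0,\dots,n_j-1\}$, i.e. $t_{j,i}=i\Delta t$. *)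

theory Defs
  imports "HOL-Probability.Probability"
begin

definition ell :: "real \<Rightarrow> nat" where
  "ell \<beta> = (GREATEST l. real l < \<beta>)"

text \<open>
  The list [v1, ..., vk] encodes the arguments of the k-th derivative at the point x,
  seen as a k-linear form: the value is D^k g(x)(v1, ..., vk).
\<close>
primrec iter_deriv :: "('a::real_normed_vector \<Rightarrow> real) \<Rightarrow> 'a list \<Rightarrow> 'a \<Rightarrow> real" where
  "iter_deriv g [] = g"
| "iter_deriv g (v # vs) = (\<lambda>x. frechet_derivative (iter_deriv g vs) (at x) v)"

text \<open>
  In finite dimension, a map into the k-linear forms is Frechet differentiable iff its
  evaluation at each fixed tuple of vectors is.
\<close>
definition times_differentiable :: "nat \<Rightarrow> ('a::euclidean_space \<Rightarrow> real) \<Rightarrow> bool" where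
  "times_differentiable l g \<longleftrightarrow>
     (\<forall>vs x. length vs < l \<longrightarrow> iter_deriv g vs differentiable (at x))"

text \<open>Valued in the extended reals, so that the supremum always exists.\<close>
definition form_opnorm :: "nat \<Rightarrow> ('a::real_normed_vector list \<Rightarrow> real) \<Rightarrow> ennreal" where
  "form_opnorm k A =
     (SUP vs\<in>{vs. length vs = k \<and> (\<forall>v\<in>set vs. norm v = 1)}. ennreal \<bar>A vs\<bar>)"

definition smooth_class ::
  "real \<Rightarrow> (nat \<Rightarrow> real) \<Rightarrow> real \<Rightarrow> (real ^ 'd \<Rightarrow> real ^ 'd) set" where
  "smooth_class \<beta> L L\<beta> = {f. \<forall>j.
     (let g = (\<lambda>x. f x $ j) in
        times_differentiable (ell \<beta>) g \<and>
        (\<forall>k\<le>ell \<beta>. (SUP x. form_opnorm k (\<lambda>vs. iter_deriv g vs x)) \<le> ennreal (L k)) \<and>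
        (\<forall>x x'. form_opnorm (ell \<beta>) (\<lambda>vs. iter_deriv g vs x - iter_deriv g vs x')
                  \<le> ennreal (L\<beta> * norm (x - x') powr (\<beta> - real (ell \<beta>)))))}"

definition flow :: "('a::real_normed_vector \<Rightarrow> 'a) \<Rightarrow> 'a \<Rightarrow> real \<Rightarrow> 'a" where
  "flow f x = (THE u. u 0 = x \<and> (\<forall>t. (u has_vector_derivative f (u t)) (at t)))"

definition centered_noise :: "(real ^ 'd) measure \<Rightarrow> bool" where
  "centered_noise P \<longleftrightarrow> prob_space P \<and> sets P = sets borel \<and>
     integrable P (\<lambda>e. e) \<and> (\<integral>e. e \<partial>P) = 0"

text \<open>
  The real-valued \<^const>\<open>KL_divergence\<close> takes the measures in reverse order, and it is
  meaningful only if P is absolutely continuous with respect to Q and the log-likelihood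
  ratio is P-integrable. In all other cases KL(P, Q) is infinite: the negative part of the
  log-likelihood ratio of two probability measures is always P-integrable.
\<close>
definition kl_div :: "'a measure \<Rightarrow> 'a measure \<Rightarrow> ereal" where
  "kl_div P Q =
     (if absolutely_continuous Q P \<and> integrable P (entropy_density (exp 1) Q P)
      then ereal (KL_divergence (exp 1) Q P) else \<infinity>)"

definition shift :: "real ^ 'd \<Rightarrow> (real ^ 'd) measure \<Rightarrow> (real ^ 'd) measure" where
  "shift v P = distr P borel (\<lambda>e. v + e)"

definition noise_condition :: "real \<Rightarrow> (real ^ 'd) measure \<Rightarrow> bool" where
  "noise_condition Cnoise P \<longleftrightarrow>
     (\<forall>v1 v2. kl_div (shift v1 P) (shift v2 P) \<le> ereal (Cnoise * (norm (v1 - v2))\<^sup>2))"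

definition unit_cube :: "(real ^ 'd) set" where
  "unit_cube = {z. \<forall>i. 0 \<le> z $ i \<and> z $ i \<le> 1}"

definition observation_times ::
  "nat \<Rightarrow> (nat \<Rightarrow> nat) \<Rightarrow> (nat \<Rightarrow> real) \<Rightarrow> (nat \<Rightarrow> nat \<Rightarrow> real) \<Rightarrow> bool" where
  "observation_times m n T t \<longleftrightarrow>
     (\<forall>j\<in>{1..m}. T j > 0 \<and> t j 0 = 0 \<and> t j (n j) = T j \<and> (\<forall>i<n j. t j i \<le> t j (Suc i)))"

definition equidistant_time ::
  "nat \<Rightarrow> (nat \<Rightarrow> nat) \<Rightarrow> (nat \<Rightarrow> nat \<Rightarrow> real) \<Rightarrow> real \<Rightarrow> bool" where
  "equidistant_time m n t \<Delta>t \<longleftrightarrow> (\<forall>j\<in>{1..m}. \<forall>i<n j. t j (Suc i) - t j i = \<Delta>t)"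

definition cover :: "real \<Rightarrow> nat \<Rightarrow> (nat \<Rightarrow> real ^ 'd) \<Rightarrow> bool" where
  "cover Ccvr m x \<longleftrightarrow>
     (\<forall>z\<in>unit_cube. \<forall>r>0.
        real (card {j\<in>{1..m}. norm (x j - z) < r}) / real m
          \<le> max (1 / real m) (Ccvr * r ^ CARD('d)))"

definition obs_index :: "nat \<Rightarrow> (nat \<Rightarrow> nat) \<Rightarrow> (nat \<times> nat) set" where
  "obs_index m n = (SIGMA j:{1..m}. {1..n j})"

definition obs_space :: "nat \<Rightarrow> (nat \<Rightarrow> nat) \<Rightarrow> (nat \<times> nat \<Rightarrow> real ^ 'd) measure" where
  "obs_space m n = (\<Pi>\<^sub>M ji\<in>obs_index m n. borel)"

text \<open>
  The joint law of the observations Y(j,i) = U(f, x(j), t(j,i)) + e(j,i), where the e(j,i)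
  are the coordinates of the product space, hence i.i.d. with law P.
\<close>
definition obs_law ::
  "nat \<Rightarrow> (nat \<Rightarrow> nat) \<Rightarrow> (nat \<Rightarrow> nat \<Rightarrow> real) \<Rightarrow> (nat \<Rightarrow> real ^ 'd) \<Rightarrow> (real ^ 'd) measure
    \<Rightarrow> (real ^ 'd \<Rightarrow> real ^ 'd) \<Rightarrow> (nat \<times> nat \<Rightarrow> real ^ 'd) measure" where
  "obs_law m n t x P f =
     distr (\<Pi>\<^sub>M ji\<in>obs_index m n. P) (obs_space m n)
       (\<lambda>e. \<lambda>(j, i)\<in>obs_index m n. flow f (x j) (t j i) + e (j, i))"

text \<open>
  An estimator maps the data to a vector field; its value at each point is a measurable
  function of the data. For the integrated loss the vector field must also be measurable in
  its argument, jointly with the data. The supremum of the pointwise losses need not be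
  Borel measurable in the data under either requirement; \<^const>\<open>nn_integral\<close> of such a
  function is its lower integral, the smallest possible reading of the expectation, which
  makes a lower bound on the risk strongest.
\<close>
definition estimators ::
  "nat \<Rightarrow> (nat \<Rightarrow> nat) \<Rightarrow> ((nat \<times> nat \<Rightarrow> real ^ 'd) \<Rightarrow> real ^ 'd \<Rightarrow> real ^ 'd) set" where
  "estimators m n = {fh. \<forall>z. (\<lambda>y. fh y z) \<in> borel_measurable (obs_space m n)}"

definition joint_estimators ::
  "nat \<Rightarrow> (nat \<Rightarrow> nat) \<Rightarrow> ((nat \<times> nat \<Rightarrow> real ^ 'd) \<Rightarrow> real ^ 'd \<Rightarrow> real ^ 'd) set" where
  "joint_estimators m n =
     {fh. (\<lambda>(y, z). fh y z) \<in> borel_measurable (obs_space m n \<Otimes>\<^sub>M borel)}"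

definition minimax_risk ::
  "('a \<Rightarrow> 'b) set \<Rightarrow> 'b set \<Rightarrow> ('b \<Rightarrow> 'a measure) \<Rightarrow> ('b \<Rightarrow> 'b \<Rightarrow> ennreal) \<Rightarrow> ennreal"
  where "minimax_risk E F law loss = (INF fh\<in>E. SUP f\<in>F. \<integral>\<^sup>+y. loss (fh y) f \<partial>law f)"

end

theory Submission
  imports Defs
begin

text \<open>
  The lower bounds come from drifts that differ from a constant drift \<^term>\<open>v\<close> along one coordinate
  axis only inside small cubes, and whose trajectories forget that they have crossed such a cube.

  Let \<open>\<Psi>(x) = x + \<phi>(x) e\<close>, where \<open>e\<close> is a coordinate direction and \<open>\<phi>\<close> is a sum of bumps of width
  \<open>h\<close> and height of order \<open>h powr (\<beta> + 1)\<close>, supported in disjoint cubes. The field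
  \<open>f = v / (1 + \<partial>\<phi>) e\<close> is the pull-back of the constant field \<open>v e\<close> under \<open>\<Psi>\<close>. Hence its flow is
  \<open>x \<mapsto> \<Psi>\<^sup>-\<^sup>1(\<Psi>(x) + t v e)\<close>. This is explicit, and it has two consequences. Adding or removing the bump in
  one cube moves a trajectory by at most a multiple of \<open>h powr (\<beta> + 1)\<close>, and at time \<open>t\<close> it moves it only
  if the starting point \<open>x\<close> or the drifted point \<open>x + t v e\<close> lies near that cube
  (\<open>flow_conjugate\<close>, \<open>flow_field_insert\<close>). On the other hand \<open>f\<close> changes inside the cube by a multiple of
  \<open>h powr \<beta>\<close>, and with a small amplitude it belongs to the smoothness class (\<open>field_in_smooth_class\<close>). A plain
  bump, without the conjugation, would leave a lasting delay on every trajectory that crosses it, which is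
  too much information when the time step is much larger than \<open>h\<close>.

  The covering condition, applied around the cube and around its translates by \<open>- i \<Delta>t v e\<close>, bounds the
  number of observations that feel one cube by a multiple of \<open>N h ^ d\<close>. The direction of the drift is
  chosen such that these translates stay inside the unit cube, where the condition applies. The noise
  condition then bounds the Kullback-Leibler divergence between the two observation laws by a small
  multiple of \<open>N h powr (2 (\<beta> + 1) + d)\<close> (\<open>kl_close_field\<close>).

  With \<open>N h powr (2 (\<beta> + 1) + d) = 1\<close>, a two-point test gives the bound at a fixed point, and
  Assouad's argument over all subsets of a grid of about \<open>h powr (- d)\<close> cubes gives the bound for the
  integrated loss. With \<open>N h powr (2 (\<beta> + 1) + d) = ln N\<close>, the divergence is still small compared to the
  logarithm of the number of cubes, so the data cannot locate a single bump, which gives the bound for the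
  uniform loss. In all three cases the squared loss is of order \<open>h powr (2 \<beta>)\<close>.
\<close>

section \<open>Likelihood ratios of noisy observations\<close>

text \<open>
  The only consequence of a divergence bound \<open>KL(P, Q) \<le> K\<close> that is needed: an event that is likely under
  \<open>P\<close> is not too unlikely under \<open>Q\<close>. The parameter \<open>\<tau>\<close> is left free, because two hypotheses and many hypotheses
  call for different thresholds on the log-likelihood ratio.
\<close>
definition kl_close :: "real \<Rightarrow> 'a measure \<Rightarrow> 'a measure \<Rightarrow> bool" where
  "kl_close K P Q \<longleftrightarrow>
     (\<forall>A\<in>sets P. \<forall>\<tau>>0. measure P A \<le> exp \<tau> * measure Q A + (K + 1) / \<tau>)"

lemma kl_close_mono: "kl_close K P Q \<Longrightarrow> K \<le> K' \<Longrightarrow> kl_close K' P Q"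
  unfolding kl_close_def by (smt (verit, ccfv_SIG) divide_right_mono)

text \<open>
  On the event where the density \<open>D\<close> is at most \<open>exp \<tau>\<close>, the measure \<open>P\<close> is at most \<open>exp \<tau>\<close> times \<open>Q\<close>. The
  complement is estimated by Markov's inequality for \<open>ln D + 1 / D\<close>, which is nonnegative because of
  \<open>ln y \<le> y - 1\<close>, and whose mean is at most \<open>K + 1\<close> because \<open>1 / D\<close> has mean at most 1 under \<open>P\<close>.
\<close>
lemma kl_close_density:
  fixes D L :: "'a \<Rightarrow> real"
  assumes Q: "prob_space Q" and P: "prob_space P" and PD: "P = density Q (\<lambda>x. ennreal (D x))"
    and D[measurable]: "D \<in> borel_measurable Q" and D0: "\<And>x. D x \<ge> 0"
    and L: "integrable P L" and LD: "\<And>x. x \<in> space Q \<Longrightarrow> D x > 0 \<Longrightarrow> L x = ln (D x)"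
    and K: "(\<integral>x. L x \<partial>P) \<le> K"
  shows "kl_close K P Q"
  unfolding kl_close_def
proof (intro ballI allI impI)
  interpret Q: prob_space Q by fact
  interpret P: prob_space P by fact
  fix A and \<tau> :: real assume A: "A \<in> sets P" and \<tau>: "\<tau> > 0"
  have sP: "sets P = sets Q" "space P = space Q" by (auto simp: PD)
  have DP[measurable]: "D \<in> borel_measurable P" using D by (simp add: PD)
  have AQ[measurable]: "A \<in> sets Q" using A sP by simp
  have LP[measurable]: "L \<in> borel_measurable P" using L by auto
  have pos: "AE x in P. D x > 0"
    unfolding PD by (subst AE_density) auto
  have inv_le: "(\<integral>\<^sup>+x. ennreal (1 / D x) \<partial>P) \<le> 1"
  proof -
    have "(\<integral>\<^sup>+x. ennreal (1 / D x) \<partial>P) = (\<integral>\<^sup>+x. ennreal (D x) * ennreal (1 / D x) \<partial>Q)"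
      unfolding PD by (subst nn_integral_density) auto
    also have "\<dots> \<le> (\<integral>\<^sup>+x. 1 \<partial>Q)"
      by (intro nn_integral_mono) (auto simp: D0 simp flip: ennreal_mult)
    finally show ?thesis by (simp add: Q.emeasure_space_1)
  qed
  have inv_int: "integrable P (\<lambda>x. 1 / D x)"
    using inv_le by (intro integrableI_nonneg) (auto simp: D0 less_top[symmetric] top_unique)
  have inv_int_le: "(\<integral>x. 1 / D x \<partial>P) \<le> 1"
    using inv_le by (subst integral_eq_nn_integral) (auto simp: D0 intro: enn2real_leI)
  let ?G = "\<lambda>x. L x + 1 / D x"
  have Gint: "integrable P ?G" using L inv_int by auto
  have G0: "AE x in P. ?G x \<ge> 0"
    using pos AE_space
  proof eventually_elim
    case (elim x)
    have "ln (1 / D x) \<le> 1 / D x - 1" using elim by (intro ln_le_minus_one) auto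
    then show ?case using elim LD[of x] sP by (simp add: ln_div)
  qed
  have big: "measure P {x\<in>space P. D x > exp \<tau>} \<le> (K + 1) / \<tau>"
  proof -
    have "measure P {x\<in>space P. D x > exp \<tau>} \<le> measure P {x\<in>space P. ?G x \<ge> \<tau>}"
    proof (intro P.finite_measure_mono)
      show "{x \<in> space P. exp \<tau> < D x} \<subseteq> {x \<in> space P. \<tau> \<le> ?G x}"
      proof safe
        fix x assume x: "x \<in> space P" "exp \<tau> < D x"
        then have "D x > 0" using less_trans[OF exp_gt_zero] by blast
        then have "\<tau> < L x" using x LD[of x] sP by (simp add: ln_ge_iff less_le ) (metis exp_ln less_eq_real_def linorder_not_less exp_less_cancel_iff)
        then show "\<tau> \<le> ?G x" using \<open>D x > 0\<close> by (smt (verit) divide_nonneg_pos)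
      qed
    qed auto
    also have "\<dots> \<le> (\<integral>x. ?G x \<partial>P) / \<tau>"
      using integral_Markov_inequality_measure[OF Gint, of "{}" \<tau>] G0 \<tau> by auto
    also have "(\<integral>x. ?G x \<partial>P) \<le> K + 1"
      using K inv_int_le L inv_int by simp
    finally show ?thesis using \<tau> by (simp add: divide_right_mono)
  qed
  let ?B = "A \<inter> {x\<in>space P. D x \<le> exp \<tau>}"
  have small: "measure P ?B \<le> exp \<tau> * measure Q A"
  proof -
    have "emeasure P ?B = (\<integral>\<^sup>+x. ennreal (D x) * indicator ?B x \<partial>Q)"
      unfolding PD by (subst emeasure_density) (auto)
    also have "\<dots> \<le> (\<integral>\<^sup>+x. ennreal (exp \<tau>) * indicator A x \<partial>Q)"
      by (intro nn_integral_mono) (auto split: split_indicator intro: ennreal_leI)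
    also have "\<dots> = ennreal (exp \<tau>) * emeasure Q A"
      by (subst nn_integral_cmult) auto
    finally have "ennreal (measure P ?B) \<le> ennreal (exp \<tau> * measure Q A)"
      by (simp add: P.emeasure_eq_measure Q.emeasure_eq_measure ennreal_mult)
    then show ?thesis by (simp add: ennreal_le_iff)
  qed
  have "A \<subseteq> space P" using A by (rule sets.sets_into_space)
  then have "A \<subseteq> ?B \<union> {x\<in>space P. D x > exp \<tau>}" by auto
  then have "measure P A \<le> measure P (?B \<union> {x\<in>space P. D x > exp \<tau>})"
    using A by (intro P.finite_measure_mono) auto
  also have "\<dots> \<le> measure P ?B + measure P {x\<in>space P. D x > exp \<tau>}"
    using A by (intro measure_Un_le) auto
  finally show "measure P A \<le> exp \<tau> * measure Q A + (K + 1) / \<tau>"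
    using small big by simp
qed

text \<open>
  For product measures the likelihood ratio is the product of the marginal ratios, so the expected
  log-likelihood ratios add up.
\<close>
lemma kl_close_PiM:
  fixes P Q :: "'i \<Rightarrow> 'a measure" and k :: "'i \<Rightarrow> real"
  assumes I: "finite I"
    and P: "\<And>i. i \<in> I \<Longrightarrow> prob_space (P i)" and Q: "\<And>i. i \<in> I \<Longrightarrow> prob_space (Q i)"
    and kl: "\<And>i. i \<in> I \<Longrightarrow> kl_div (P i) (Q i) \<le> ereal (k i)"
    and s: "\<And>i. i \<in> I \<Longrightarrow> sets (P i) = sets (Q i)"
  shows "kl_close (\<Sum>i\<in>I. k i) (PiM I P) (PiM I Q)"
proof -
  define d where "d i = enn2real \<circ> RN_deriv (Q i) (P i)" for i
  have ac: "absolutely_continuous (Q i) (P i)" and int: "integrable (P i) (entropy_density (exp 1) (Q i) (P i))"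
    and KL: "(\<integral>x. entropy_density (exp 1) (Q i) (P i) x \<partial>P i) \<le> k i" if "i \<in> I" for i
    using kl[OF that] by (auto simp: kl_div_def KL_divergence_def split: if_splits)
  have ed: "entropy_density (exp 1) (Q i) (P i) = (\<lambda>x. ln (d i x))" for i
    by (auto simp: entropy_density_def d_def log_def)
  have dm[measurable]: "d i \<in> borel_measurable (Q i)" for i unfolding d_def comp_def by measurable
  have dP: "P i = density (Q i) (\<lambda>x. ennreal (d i x))" if i: "i \<in> I" for i
  proof -
    interpret Q: prob_space "Q i" using Q i by simp
    interpret P: prob_space "P i" using P i by simp
    have "AE x in Q i. RN_deriv (Q i) (P i) x \<noteq> \<infinity>"
      using ac[OF i] s[OF i] P.sigma_finite_measure_axioms by (intro Q.RN_deriv_finite) auto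
    then have "density (Q i) (RN_deriv (Q i) (P i)) = density (Q i) (\<lambda>x. ennreal (d i x))"
      by (intro density_cong) (auto simp: d_def less_top)
    then show ?thesis using Q.density_RN_deriv[OF ac[OF i] s[OF i]] by simp
  qed
  \<comment> \<open>Outside of \<open>I\<close> any probability measure will do; it makes all factors probability measures.\<close>
  define P' where "P' i = (if i \<in> I then P i else return (count_space UNIV) undefined)" for i
  define Q' where "Q' i = (if i \<in> I then Q i else return (count_space UNIV) undefined)" for i
  have PQ': "PiM I P = PiM I P'" "PiM I Q = PiM I Q'"
    by (auto simp: P'_def Q'_def intro!: PiM_cong)
  have pP: "prob_space (P' i)" and pQ: "prob_space (Q' i)" for i
    using P Q by (auto simp: P'_def Q'_def intro!: prob_space_return)
  interpret P': product_prob_space P' by (simp add: product_prob_spaceI pP)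
  interpret Q': product_prob_space Q' by (simp add: product_prob_spaceI pQ)
  let ?D = "\<lambda>x. \<Prod>i\<in>I. d i (x i)"
  have Dm[measurable]: "?D \<in> borel_measurable (PiM I Q)"
    by measurable
  show ?thesis
  proof (rule kl_close_density[where D = ?D and L = "\<lambda>x. \<Sum>i\<in>I. ln (d i (x i))"])
    show "prob_space (PiM I Q)" "prob_space (PiM I P)"
      unfolding PQ' by (auto intro!: prob_space_PiM pP pQ)
    show "?D \<in> borel_measurable (PiM I Q)" by measurable
    show "?D x \<ge> 0" for x by (auto intro!: prod_nonneg simp: d_def)
    show "(\<Sum>i\<in>I. ln (d i (x i))) = ln (?D x)" if "?D x > 0" for x
    proof -
      have "d i (x i) \<noteq> 0" if "i \<in> I" for i
      proof
        assume "d i (x i) = 0"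
        then have "?D x = 0" using I that by (intro prod_zero) auto
        with \<open>?D x > 0\<close> show False by simp
      qed
      moreover have "d i (x i) \<ge> 0" for i by (simp add: d_def)
      ultimately have "d i (x i) > 0" if "i \<in> I" for i
        using that by (simp add: less_le)
      then show ?thesis using I by (subst ln_prod) (auto simp: less_imp_neq[THEN not_sym])
    qed
    have comp: "integrable (PiM I P) (\<lambda>x. ln (d i (x i)))"
        "(\<integral>x. ln (d i (x i)) \<partial>PiM I P) = (\<integral>x. ln (d i x) \<partial>P i)" if i: "i \<in> I" for i
    proof -
      have dist: "distr (PiM I P) (P i) (\<lambda>x. x i) = P i" by (rule distr_PiM_component) (use P i in auto)
      have m: "(\<lambda>x. x i) \<in> measurable (PiM I P) (P i)" using i by simp
      have "integrable (distr (PiM I P) (P i) (\<lambda>x. x i)) (\<lambda>x. ln (d i x))"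
        unfolding dist using int[OF i] by (simp add: ed)
      then show "integrable (PiM I P) (\<lambda>x. ln (d i (x i)))"
        by (rule integrable_distr[OF m])
      have lm: "(\<lambda>x. ln (d i x)) \<in> borel_measurable (P i)" using int[OF i] by (auto simp: ed)
      show "(\<integral>x. ln (d i (x i)) \<partial>PiM I P) = (\<integral>x. ln (d i x) \<partial>P i)"
        using integral_distr[OF m lm] dist by simp
    qed
    show "integrable (PiM I P) (\<lambda>x. \<Sum>i\<in>I. ln (d i (x i)))"
      using comp by auto
    have "(\<integral>x. (\<Sum>i\<in>I. ln (d i (x i))) \<partial>PiM I P) = (\<Sum>i\<in>I. \<integral>x. ln (d i x) \<partial>P i)"
      using comp by (simp add: Bochner_Integration.integral_sum)
    also have "\<dots> \<le> (\<Sum>i\<in>I. k i)" using KL by (intro sum_mono) (auto simp: ed)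
    finally show "(\<integral>x. (\<Sum>i\<in>I. ln (d i (x i))) \<partial>PiM I P) \<le> (\<Sum>i\<in>I. k i)" .
    show "PiM I P = density (PiM I Q) (\<lambda>x. ennreal (?D x))"
      unfolding PQ'
    proof (rule P'.PiM_eqI[symmetric, OF I])
      show "sets (density (PiM I Q') (\<lambda>x. ennreal (?D x))) = sets (PiM I P')"
        by (auto simp: P'_def Q'_def s intro!: sets_PiM_cong)
      fix A assume A: "\<And>i. i \<in> I \<Longrightarrow> A i \<in> sets (P' i)"
      have AQ: "A i \<in> sets (Q i)" if "i \<in> I" for i using A[OF that] s[OF that] that by (simp add: P'_def)
      then have AP: "Pi\<^sub>E I A \<in> sets (PiM I Q')" using I by (intro sets_PiM_I_finite) (auto simp: Q'_def)
      have "emeasure (density (PiM I Q') (\<lambda>x. ennreal (?D x))) (Pi\<^sub>E I A)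
         = (\<integral>\<^sup>+x. ennreal (?D x) * indicator (Pi\<^sub>E I A) x \<partial>PiM I Q')"
        using AP Dm unfolding PQ' by (subst emeasure_density) auto
      also have "\<dots> = (\<integral>\<^sup>+x. (\<Prod>i\<in>I. ennreal (d i (x i)) * indicator (A i) (x i)) \<partial>PiM I Q')"
      proof (intro nn_integral_cong)
        fix x assume "x \<in> space (PiM I Q')"
        then have "x \<in> extensional I" by (auto simp: space_PiM PiE_def)
        then have "indicator (Pi\<^sub>E I A) x = (\<Prod>i\<in>I. indicator (A i) (x i) :: ennreal)"
          using I by (auto simp: indicator_def PiE_def Pi_def)
        then show "ennreal (?D x) * indicator (Pi\<^sub>E I A) x = (\<Prod>i\<in>I. ennreal (d i (x i)) * indicator (A i) (x i))"
          by (simp add: prod.distrib prod_ennreal d_def)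
      qed
      also have "\<dots> = (\<Prod>i\<in>I. \<integral>\<^sup>+x. ennreal (d i x) * indicator (A i) x \<partial>Q' i)"
        using I AQ by (subst Q'.product_nn_integral_prod) (auto simp: Q'_def)
      also have "\<dots> = (\<Prod>i\<in>I. emeasure (P' i) (A i))"
      proof (intro prod.cong refl)
        fix i assume i: "i \<in> I"
        show "(\<integral>\<^sup>+x. ennreal (d i x) * indicator (A i) x \<partial>Q' i) = emeasure (P' i) (A i)"
          using i AQ[OF i] by (simp add: P'_def Q'_def) (subst dP, auto simp: emeasure_density)
      qed
      finally show "emeasure (density (PiM I Q') (\<lambda>x. ennreal (?D x))) (Pi\<^sub>E I A) = (\<Prod>i\<in>I. emeasure (P' i) (A i))" .
    qed
  qed
qed

lemma sets_shift [simp]: "sets (shift v P) = sets borel"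
  by (simp add: shift_def)

lemma prob_space_shift:
  assumes "prob_space P" and s: "sets P = sets borel"
  shows "prob_space (shift v P)"
  unfolding shift_def
proof (rule prob_space.prob_space_distr[OF assms(1)])
  show "(\<lambda>e. v + e) \<in> measurable P borel"
    unfolding measurable_cong_sets[OF s refl] by simp
qed

lemma finite_obs_index: "finite (obs_index m n)"
  by (auto simp: obs_index_def)

lemma sets_obs_law [simp]: "sets (obs_law m n t x P f) = sets (obs_space m n)"
  "space (obs_law m n t x P f) = space (obs_space m n)"
  by (auto simp: obs_law_def)

text \<open>
  Translating independent noise coordinate by coordinate preserves independence.
\<close>
lemma obs_law_eq_PiM:
  fixes P :: "(real ^ 'd) measure"
  assumes P: "prob_space P" and s: "sets P = sets borel"
  shows "obs_law m n t x P f = (\<Pi>\<^sub>M ji\<in>obs_index m n. shift (flow f (x (fst ji)) (t (fst ji) (snd ji))) P)"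
proof -
  let ?I = "obs_index m n"
  let ?v = "\<lambda>ji. flow f (x (fst ji)) (t (fst ji) (snd ji))"
  let ?h = "\<lambda>e. \<lambda>ji\<in>?I. ?v ji + e ji :: real ^ 'd"
  interpret S: product_prob_space "\<lambda>ji. shift (?v ji) P"
    by (simp add: product_prob_spaceI prob_space_shift P s)
  interpret P: product_prob_space "\<lambda>ji. P"
    by (simp add: product_prob_spaceI P)
  have eqh: "(\<lambda>e. \<lambda>(j, i)\<in>?I. flow f (x j) (t j i) + e (j, i)) = ?h"
    by (auto simp: fun_eq_iff restrict_def split: prod.splits)
  have hm: "?h \<in> measurable (PiM ?I (\<lambda>_. P)) (PiM ?I (\<lambda>_. borel))"
  proof (rule measurable_restrict)
    fix i assume "i \<in> ?I"
    then have [measurable]: "(\<lambda>e. e i) \<in> measurable (PiM ?I (\<lambda>_. P)) borel"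
      by (subst measurable_cong_sets[OF refl s[symmetric]]) simp
    show "(\<lambda>e. ?v i + e i) \<in> borel_measurable (PiM ?I (\<lambda>_. P))" by measurable
  qed
  show ?thesis
    unfolding obs_law_def obs_space_def eqh
  proof (rule S.PiM_eqI[OF finite_obs_index])
    show "sets (distr (PiM ?I (\<lambda>_. P)) (PiM ?I (\<lambda>_. borel)) ?h) = sets (PiM ?I (\<lambda>ji. shift (?v ji) P))"
      by (auto simp: shift_def intro!: sets_PiM_cong)
    fix A assume "\<And>i. i \<in> ?I \<Longrightarrow> A i \<in> sets (shift (?v i) P)"
    then have A: "A i \<in> sets borel" if "i \<in> ?I" for i using that by (auto simp: shift_def)
    have AP: "Pi\<^sub>E ?I A \<in> sets (PiM ?I (\<lambda>_. borel))" using A by (intro sets_PiM_I_finite finite_obs_index) auto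
    have pre: "(\<lambda>e. v + e) -` B \<in> sets P" if "B \<in> sets borel" for B and v :: "real ^ 'd"
      using measurable_sets[of "\<lambda>e. v + e" borel borel B] that s by simp
    have spP: "space P = UNIV" using sets_eq_imp_space_eq[OF s] by simp
    have "emeasure (distr (PiM ?I (\<lambda>_. P)) (PiM ?I (\<lambda>_. borel)) ?h) (Pi\<^sub>E ?I A)
       = emeasure (PiM ?I (\<lambda>_. P)) (?h -` Pi\<^sub>E ?I A \<inter> space (PiM ?I (\<lambda>_. P)))"
      by (rule emeasure_distr[OF hm AP])
    also have "?h -` Pi\<^sub>E ?I A \<inter> space (PiM ?I (\<lambda>_. P)) = Pi\<^sub>E ?I (\<lambda>i. (\<lambda>e. ?v i + e) -` A i)"
      by (auto simp: space_PiM spP PiE_def Pi_def)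
    also have "emeasure (PiM ?I (\<lambda>_. P)) \<dots> = (\<Prod>i\<in>?I. emeasure P ((\<lambda>e. ?v i + e) -` A i))"
      by (rule P.emeasure_PiM[OF finite_obs_index]) (use A pre in auto)
    also have "\<dots> = (\<Prod>i\<in>?I. emeasure (shift (?v i) P) (A i))"
    proof (intro prod.cong refl)
      fix i assume i: "i \<in> ?I"
      have "(\<lambda>e. ?v i + e) \<in> measurable P borel" unfolding measurable_cong_sets[OF s refl] by simp
      then show "emeasure P ((\<lambda>e. ?v i + e) -` A i) = emeasure (shift (?v i) P) (A i)"
        unfolding shift_def by (subst emeasure_distr) (use A[OF i] spP in auto)
    qed
    finally show "emeasure (distr (PiM ?I (\<lambda>_. P)) (PiM ?I (\<lambda>_. borel)) ?h) (Pi\<^sub>E ?I A)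
      = (\<Prod>i\<in>?I. emeasure (shift (?v i) P) (A i))" .
  qed
qed

lemma prob_space_obs_law:
  "prob_space P \<Longrightarrow> sets P = sets borel \<Longrightarrow> prob_space (obs_law m n t x P f)"
  by (simp add: obs_law_eq_PiM prob_space_PiM prob_space_shift)

text \<open>
  The noise condition turns the divergence between two observation laws into the sum of squared distances
  between the two families of observed positions.
\<close>
lemma kl_close_obs_law:
  fixes P :: "(real ^ 'd) measure"
  assumes P: "centered_noise P" and noise: "noise_condition C P"
    and K: "(\<Sum>ji\<in>obs_index m n. C * (norm (flow f (x (fst ji)) (t (fst ji) (snd ji))
              - flow f' (x (fst ji)) (t (fst ji) (snd ji))))\<^sup>2) \<le> K"
  shows "kl_close K (obs_law m n t x P f) (obs_law m n t x P f')"
proof -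
  have P': "prob_space P" "sets P = sets borel" using P by (auto simp: centered_noise_def)
  show ?thesis
    unfolding obs_law_eq_PiM[OF P']
    by (rule kl_close_mono[OF kl_close_PiM K], rule finite_obs_index)
       (use noise P' in \<open>auto simp: noise_condition_def intro!: prob_space_shift\<close>)
qed

section \<open>Uniformly smooth families of functions\<close>

text \<open>
  The directions form part of the family, so that one induction over the order treats all mixed derivatives
  at once. The radius \<open>R\<close> is kept as a parameter: the operator norm only needs \<open>R = 1\<close>, while
  differentiability in arbitrary directions needs every \<open>R\<close>.
\<close>
definition directional_derivs :: "real \<Rightarrow> ('a::real_normed_vector \<Rightarrow> real) set \<Rightarrow> ('a \<Rightarrow> real) set" where
  "directional_derivs R F = {\<lambda>x. frechet_derivative g (at x) v | g v. g \<in> F \<and> norm v \<le> R}"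

lemma directional_derivsI:
  "g \<in> F \<Longrightarrow> norm v \<le> R \<Longrightarrow> (\<lambda>x. frechet_derivative g (at x) v) \<in> directional_derivs R F"
  by (auto simp: directional_derivs_def)

lemma directional_derivs_subsetI:
  "(\<And>g v. g \<in> F \<Longrightarrow> norm v \<le> R \<Longrightarrow> (\<lambda>x. frechet_derivative g (at x) v) \<in> G) \<Longrightarrow> directional_derivs R F \<subseteq> G"
  by (auto simp: directional_derivs_def)

lemma abs_mult_le: "\<bar>a\<bar> \<le> B \<Longrightarrow> \<bar>b\<bar> \<le> B' \<Longrightarrow> \<bar>a * b\<bar> \<le> \<bar>B\<bar> * \<bar>B'\<bar>" for a b B B' :: real
  unfolding abs_mult by (rule mult_mono) auto

lemma mult_setI: "f \<in> F \<Longrightarrow> g \<in> G \<Longrightarrow> (\<lambda>x. f x * g x) \<in> {\<lambda>x. f x * g x | f g. f \<in> F \<and> g \<in> G}"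
  by blast

lemma add_setI: "f \<in> F \<Longrightarrow> g \<in> G \<Longrightarrow> (\<lambda>x. f x + g x) \<in> {\<lambda>x. f x + g x | f g. f \<in> F \<and> g \<in> G}"
  by blast

text \<open>
  All members of the family have derivatives up to order \<open>n\<close> that are bounded by one common constant, in
  directions of norm at most \<open>R\<close>. Stating this for families instead of single functions makes the bounds
  uniform in the amplitude of a bump.
\<close>
primrec unif_smooth :: "real \<Rightarrow> nat \<Rightarrow> ('a::real_normed_vector \<Rightarrow> real) set \<Rightarrow> bool" where
  "unif_smooth R 0 F \<longleftrightarrow> (\<exists>B. \<forall>g\<in>F. \<forall>x. \<bar>g x\<bar> \<le> B)"
| "unif_smooth R (Suc n) F \<longleftrightarrow> (\<exists>B. \<forall>g\<in>F. \<forall>x. \<bar>g x\<bar> \<le> B) \<and>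
     (\<forall>g\<in>F. \<forall>x. g differentiable (at x)) \<and>
     unif_smooth R n (directional_derivs R F)"

lemma unif_smooth_mono: "unif_smooth R n F \<Longrightarrow> G \<subseteq> F \<Longrightarrow> unif_smooth R n G"
proof (induction n arbitrary: F G)
  case 0 then show ?case by (auto; blast)
next
  case (Suc n)
  have "directional_derivs R G \<subseteq> directional_derivs R F"
    using Suc.prems(2) by (auto simp: directional_derivs_def)
  then have "unif_smooth R n (directional_derivs R G)"
    using Suc.IH Suc.prems(1) by auto
  then show ?case using Suc.prems by (simp, blast)
qed

lemma unif_smooth_bounded: "unif_smooth R n F \<Longrightarrow> \<exists>B. \<forall>g\<in>F. \<forall>x. \<bar>g x\<bar> \<le> B"
  by (cases n) auto

lemma unif_smooth_weaken: "unif_smooth R (Suc n) F \<Longrightarrow> unif_smooth R n F"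
proof (induction n arbitrary: F)
  case (Suc n)
  from Suc.prems have "unif_smooth R (Suc n) (directional_derivs R F)"
    unfolding unif_smooth.simps(2)[of R "Suc n" F] by blast
  from Suc.IH[OF this] Suc.prems show ?case
    unfolding unif_smooth.simps(2)[of R _ F] by blast
qed simp

lemma unif_smooth_const: "unif_smooth R n {\<lambda>_::'a::real_normed_vector. c | c. \<bar>c\<bar> \<le> B}"
proof (induction n arbitrary: B)
  case 0
  show ?case by (simp, rule exI[of _ B]) auto
next
  case (Suc n)
  have "unif_smooth R n (directional_derivs R {\<lambda>_::'a. c | c. \<bar>c\<bar> \<le> B})"
    by (rule unif_smooth_mono[OF Suc.IH[of 0]], rule directional_derivs_subsetI) auto
  moreover have "\<exists>B'. \<forall>g\<in>{\<lambda>_::'a. c | c. \<bar>c\<bar> \<le> B}. \<forall>x. \<bar>g x\<bar> \<le> B'"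
    by (rule exI[of _ B]) auto
  ultimately show ?case by auto
qed

lemma unif_smooth_add:
  "unif_smooth R n F \<Longrightarrow> unif_smooth R n G \<Longrightarrow> unif_smooth R n {\<lambda>x. f x + g x | f g. f \<in> F \<and> g \<in> G}"
proof (induction n arbitrary: F G)
  case 0
  then obtain B B' where "\<forall>g\<in>F. \<forall>x. \<bar>g x\<bar> \<le> B" "\<forall>g\<in>G. \<forall>x. \<bar>g x\<bar> \<le> B'" by auto
  then show ?case by (auto intro!: exI[of _ "B + B'"] order.trans[OF abs_triangle_ineq] add_mono)
next
  case (Suc n)
  obtain B B' where B: "\<forall>g\<in>F. \<forall>x. \<bar>g x\<bar> \<le> B" "\<forall>g\<in>G. \<forall>x. \<bar>g x\<bar> \<le> B'" using Suc.prems by auto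
  have D: "frechet_derivative (\<lambda>x. f x + g x) (at x) v = frechet_derivative f (at x) v + frechet_derivative g (at x) v"
    if "f \<in> F" "g \<in> G" for f g x v
  proof -
    have "f differentiable (at x)" "g differentiable (at x)" using that Suc.prems by auto
    then have "((\<lambda>x. f x + g x) has_derivative (\<lambda>v. frechet_derivative f (at x) v + frechet_derivative g (at x) v)) (at x)"
      by (intro has_derivative_add) (auto simp: frechet_derivative_works)
    from frechet_derivative_at[OF this] show ?thesis by metis
  qed
  have d: "unif_smooth R n (directional_derivs R F)" "unif_smooth R n (directional_derivs R G)"
    using Suc.prems by simp_all
  have "unif_smooth R n (directional_derivs R {\<lambda>x. f x + g x | f g. f \<in> F \<and> g \<in> G})"
  proof (rule unif_smooth_mono[OF Suc.IH[OF d]], rule directional_derivs_subsetI, safe)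
    fix f g v assume "f \<in> F" "g \<in> G" "norm (v::'a) \<le> R"
    then show "\<exists>fa ga. (\<lambda>x. frechet_derivative (\<lambda>x. f x + g x) (at x) v) = (\<lambda>x. fa x + ga x) \<and>
         fa \<in> directional_derivs R F \<and> ga \<in> directional_derivs R G"
      by (intro exI[of _ "\<lambda>x. frechet_derivative f (at x) v"] exI[of _ "\<lambda>x. frechet_derivative g (at x) v"])
         (auto simp: D directional_derivsI)
  qed
  moreover have "\<exists>B. \<forall>h\<in>{\<lambda>x. f x + g x | f g. f \<in> F \<and> g \<in> G}. \<forall>x. \<bar>h x\<bar> \<le> B"
    using B by (auto intro!: exI[of _ "B + B'"] order.trans[OF abs_triangle_ineq] add_mono)
  ultimately show ?case using Suc.prems by (auto intro!: differentiable_add)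
qed

text \<open>
  By the product rule the directional derivatives of products are sums of products in which one factor has
  been differentiated; these families have one order of smoothness less.
\<close>
lemma unif_smooth_mult:
  "unif_smooth R n F \<Longrightarrow> unif_smooth R n G \<Longrightarrow> unif_smooth R n {\<lambda>x. f x * g x | f g. f \<in> F \<and> g \<in> G}"
proof (induction n arbitrary: F G)
  case 0
  then obtain B B' where "\<forall>g\<in>F. \<forall>x. \<bar>g x\<bar> \<le> B" "\<forall>g\<in>G. \<forall>x. \<bar>g x\<bar> \<le> B'" by auto
  then show ?case by (auto intro!: exI[of _ "\<bar>B\<bar> * \<bar>B'\<bar>"] abs_mult_le)
next
  case (Suc n)
  obtain B B' where B: "\<forall>g\<in>F. \<forall>x. \<bar>g x\<bar> \<le> B" "\<forall>g\<in>G. \<forall>x. \<bar>g x\<bar> \<le> B'" using Suc.prems by auto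
  let ?D = "directional_derivs R"
  have D: "frechet_derivative (\<lambda>x. f x * g x) (at x) v = f x * frechet_derivative g (at x) v + frechet_derivative f (at x) v * g x"
    if "f \<in> F" "g \<in> G" for f g x v
  proof -
    have "f differentiable (at x)" "g differentiable (at x)" using that Suc.prems by auto
    then have "((\<lambda>x. f x * g x) has_derivative (\<lambda>v. f x * frechet_derivative g (at x) v + frechet_derivative f (at x) v * g x)) (at x)"
      by (intro has_derivative_mult) (auto simp: frechet_derivative_works)
    from frechet_derivative_at[OF this] show ?thesis by metis
  qed
  have w: "unif_smooth R n F" "unif_smooth R n G" using Suc.prems unif_smooth_weaken by blast+
  have d: "unif_smooth R n (?D F)" "unif_smooth R n (?D G)" using Suc.prems by simp_all
  have "unif_smooth R n (?D {\<lambda>x. f x * g x | f g. f \<in> F \<and> g \<in> G})"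
  proof (rule unif_smooth_mono[OF unif_smooth_add[OF Suc.IH[OF w(1) d(2)] Suc.IH[OF d(1) w(2)]]], rule directional_derivs_subsetI, safe)
    fix f g v assume fg: "f \<in> F" "g \<in> G" and v: "norm (v::'a) \<le> R"
    show "\<exists>fa ga. (\<lambda>x. frechet_derivative (\<lambda>x. f x * g x) (at x) v) = (\<lambda>x. fa x + ga x) \<and>
         fa \<in> {\<lambda>x. f x * g x |f g. f \<in> F \<and> g \<in> ?D G} \<and> ga \<in> {\<lambda>x. f x * g x |f g. f \<in> ?D F \<and> g \<in> G}"
      by (rule exI[of _ "\<lambda>x. f x * frechet_derivative g (at x) v"],
          rule exI[of _ "\<lambda>x. frechet_derivative f (at x) v * g x"])
         (use fg v directional_derivsI in \<open>fastforce simp: D\<close>)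
  qed
  moreover have "\<exists>B. \<forall>h\<in>{\<lambda>x. f x * g x | f g. f \<in> F \<and> g \<in> G}. \<forall>x. \<bar>h x\<bar> \<le> B"
    using B by (auto intro!: exI[of _ "\<bar>B\<bar> * \<bar>B'\<bar>"] abs_mult_le)
  ultimately show ?case using Suc.prems by (auto intro!: differentiable_mult)
qed

text \<open>
  The derivative of \<open>1 / f\<close> is \<open>- f' * (1 / f) * (1 / f)\<close>, which only involves the reciprocal family itself at a
  lower order.
\<close>
lemma unif_smooth_inverse:
  "unif_smooth R n F \<Longrightarrow> \<delta> > 0 \<Longrightarrow> (\<And>f x. f \<in> F \<Longrightarrow> f x \<ge> \<delta>) \<Longrightarrow> unif_smooth R n {\<lambda>x. inverse (f x) | f. f \<in> F}"
proof (induction n)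
  case 0
  then show ?case by (auto intro!: exI[of _ "inverse \<delta>"] le_imp_inverse_le simp: abs_of_pos)
     (smt (verit) le_imp_inverse_le)
next
  case (Suc n)
  let ?D = "directional_derivs R"
  let ?I = "{\<lambda>x. inverse (f x) | f. f \<in> F}"
  have nz: "f x \<noteq> 0" if "f \<in> F" for f x using Suc.prems(2) Suc.prems(3)[OF that, of x] by linarith
  have D: "frechet_derivative (\<lambda>x. inverse (f x)) (at x) v = (-1) * (frechet_derivative f (at x) v * (inverse (f x) * inverse (f x)))"
    if "f \<in> F" for f x v
  proof -
    have "f differentiable (at x)" using that Suc.prems by auto
    then have "((\<lambda>x. inverse (f x)) has_derivative (\<lambda>v. - (inverse (f x) * frechet_derivative f (at x) v * inverse (f x)))) (at x)"
      using nz[OF that] by (intro derivative_eq_intros | simp add: frechet_derivative_works)+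
    from frechet_derivative_at[OF this] show ?thesis by (simp add: mult_ac) metis
  qed
  have d: "unif_smooth R n (?D F)" using Suc.prems by simp
  have i: "unif_smooth R n ?I" using Suc unif_smooth_weaken by blast
  have "unif_smooth R n (?D ?I)"
  proof (rule unif_smooth_mono[OF unif_smooth_mult[OF unif_smooth_const[of R n 1] unif_smooth_mult[OF d unif_smooth_mult[OF i i]]]],
      rule directional_derivs_subsetI)
    fix g v assume "g \<in> ?I" and v: "norm (v::'a) \<le> R"
    then obtain f where f: "f \<in> F" and g: "g = (\<lambda>x. inverse (f x))" by blast
    have fI: "(\<lambda>x. inverse (f x)) \<in> ?I" using f by blast
    show "(\<lambda>x. frechet_derivative g (at x) v) \<in> {\<lambda>x. fa x * g x |fa g. fa \<in> {\<lambda>_. c |c. \<bar>c\<bar> \<le> 1} \<and>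
            g \<in> {\<lambda>x. f x * g x |f g. f \<in> ?D F \<and> g \<in> {\<lambda>x. f x * g x |f g. f \<in> ?I \<and> g \<in> ?I}}}"
      unfolding g D[OF f]
      by (rule mult_setI[OF _ mult_setI[OF directional_derivsI[OF f v] mult_setI[OF fI fI]]]) auto
  qed
  moreover have "\<exists>B. \<forall>h\<in>?I. \<forall>x. \<bar>h x\<bar> \<le> B" using unif_smooth_bounded[OF i] .
  ultimately show ?case using Suc.prems nz by (auto intro!: differentiable_inverse)
qed

lemma iter_deriv_append: "iter_deriv g (vs @ [v]) = iter_deriv (\<lambda>x. frechet_derivative g (at x) v) vs"
  by (induction vs) auto

text \<open>
  This is what the inductive notion says about the iterated derivatives that define the smoothness class.
  The head of the list of directions is differentiated last, so the induction peels off its last element.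
\<close>
lemma unif_smooth_iter_deriv:
  assumes "unif_smooth R n F"
  shows "\<exists>B. \<forall>g\<in>F. \<forall>vs. length vs \<le> n \<longrightarrow> (\<forall>v\<in>set vs. norm v \<le> R) \<longrightarrow>
     (\<forall>x. \<bar>iter_deriv g vs x\<bar> \<le> B \<and> (length vs < n \<longrightarrow> iter_deriv g vs differentiable (at x)))"
  using assms
proof (induction n arbitrary: F)
  case 0 then show ?case by auto
next
  case (Suc n)
  let ?D = "directional_derivs R F"
  have "unif_smooth R n ?D" using Suc.prems by simp
  from Suc.IH[OF this] obtain B where B: "\<And>g vs x. g \<in> ?D \<Longrightarrow> length vs \<le> n \<Longrightarrow> \<forall>v\<in>set vs. norm v \<le> R \<Longrightarrow>
     \<bar>iter_deriv g vs x\<bar> \<le> B \<and> (length vs < n \<longrightarrow> iter_deriv g vs differentiable (at x))" by blast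
  from Suc.prems obtain B' where B': "\<And>g x. g \<in> F \<Longrightarrow> \<bar>g x\<bar> \<le> B'" by auto
  show ?case
  proof (rule exI[of _ "max B B'"], intro ballI allI impI)
    fix g and vs :: "'a list" and x assume g: "g \<in> F" and vs: "length vs \<le> Suc n" "\<forall>v\<in>set vs. norm v \<le> R"
    show "\<bar>iter_deriv g vs x\<bar> \<le> max B B' \<and> (length vs < Suc n \<longrightarrow> iter_deriv g vs differentiable (at x))"
    proof (cases vs rule: rev_cases)
      case Nil
      then show ?thesis using B'[OF g, of x] g Suc.prems by auto
    next
      case (snoc ws w)
      have "(\<lambda>x. frechet_derivative g (at x) w) \<in> ?D" using g vs snoc by (auto intro: directional_derivsI)
      from B[OF this, of ws x] vs show ?thesis unfolding snoc iter_deriv_append by auto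
    qed
  qed
qed

section \<open>The bump and its slope\<close>

text \<open>
  The powers of \<open>s\<close> are included because they appear under differentiation: derivatives of \<open>bump1 r q\<close> are
  combinations of functions of the same form with smaller \<open>q\<close>. A larger \<open>q\<close> means more smoothness at the
  end points \<open>-1\<close> and \<open>1\<close>.
\<close>
definition bump1 :: "nat \<Rightarrow> nat \<Rightarrow> real \<Rightarrow> real" where
  "bump1 r q s = s ^ r * max 0 (1 - s\<^sup>2) ^ q"

lemma DERIV_max_power:
  "((\<lambda>s::real. max 0 s ^ Suc (Suc q)) has_real_derivative real (Suc (Suc q)) * max 0 s ^ Suc q) (at s)"
proof (cases "s = 0")
  case False
  show ?thesis
  proof (cases "s > 0")
    case True
    have "((\<lambda>s::real. s ^ Suc (Suc q)) has_real_derivative real (Suc (Suc q)) * s ^ Suc q) (at s)"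
      using DERIV_pow[of "Suc (Suc q)" s] by simp
    then show ?thesis
      by (rule DERIV_cong_ev[THEN iffD1, rotated 3, OF _ refl])
         (use True eventually_nhds_in_open[of "{0<..}" s] in \<open>auto elim!: eventually_mono\<close>)
  next
    case False': False
    have "((\<lambda>s::real. 0) has_real_derivative 0) (at s)" by simp
    then have "((\<lambda>s::real. max 0 s ^ Suc (Suc q)) has_real_derivative 0) (at s)"
      by (rule DERIV_cong_ev[THEN iffD1, rotated 3, OF _ refl])
         (use False False' eventually_nhds_in_open[of "{..<0}" s] in \<open>auto elim!: eventually_mono\<close>)
    moreover have "max 0 s = 0" using False' by simp
    ultimately show ?thesis by simp
  qed
next
  case True
  have "((\<lambda>h::real. max 0 h ^ Suc (Suc q) / h) \<longlongrightarrow> 0) (at 0)"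
  proof (rule tendsto_rabs_zero_cancel, rule tendsto_sandwich[of "\<lambda>_. 0" _ _ "\<lambda>h. \<bar>h\<bar> ^ Suc q"])
    show "((\<lambda>h::real. \<bar>h\<bar> ^ Suc q) \<longlongrightarrow> 0) (at 0)"
      by (auto intro!: tendsto_eq_intros)
    show "\<forall>\<^sub>F h::real in at 0. \<bar>max 0 h ^ Suc (Suc q) / h\<bar> \<le> \<bar>h\<bar> ^ Suc q"
      by (intro always_eventually allI) (auto simp: max_def abs_mult power_abs mult_nonpos_nonneg)
  qed auto
  then show ?thesis using True by (simp add: DERIV_def)
qed

lemma bump1_bound: "q \<ge> 1 \<Longrightarrow> \<bar>bump1 r q s\<bar> \<le> 1"
proof (cases "\<bar>s\<bar> \<le> 1")
  case True
  then have "\<bar>s ^ r\<bar> \<le> 1" by (simp add: power_abs power_le_one)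
  moreover have "\<bar>max 0 (1 - s\<^sup>2) ^ q\<bar> \<le> 1" by (simp add: power_abs power_le_one)
  ultimately show ?thesis unfolding bump1_def using abs_mult_le[of "s^r" 1 _ 1] by simp
next
  case False
  then have "1 - s\<^sup>2 \<le> 0" using abs_le_square_iff[of 1 s] by simp
  then show "q \<ge> 1 \<Longrightarrow> ?thesis" by (simp add: bump1_def max_absorb1 power_0_left)
qed

lemma bump1_eq_0: "\<bar>s\<bar> \<ge> 1 \<Longrightarrow> q \<ge> 1 \<Longrightarrow> bump1 r q s = 0"
proof -
  assume "\<bar>s\<bar> \<ge> 1" "q \<ge> 1"
  then have "s\<^sup>2 \<ge> 1" by (metis one_le_power power2_abs)
  then show ?thesis using \<open>q \<ge> 1\<close> by (simp add: bump1_def max_absorb1)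
qed

lemma DERIV_bump1:
  assumes "q \<ge> 2"
  shows "(bump1 r q has_real_derivative (real r * bump1 (r - 1) q s - 2 * real q * bump1 (r + 1) (q - 1) s)) (at s)"
proof -
  obtain p where q: "q = Suc (Suc p)" using assms by (metis add_2_eq_Suc le_Suc_ex)
  have "((\<lambda>s. max 0 (1 - s\<^sup>2) ^ q) has_real_derivative (real q * max 0 (1 - s\<^sup>2) ^ (q - 1)) * (- (2 * s))) (at s)"
    unfolding q by (rule DERIV_chain2[OF DERIV_max_power, THEN DERIV_cong]) (auto intro!: derivative_eq_intros)
  moreover have "((\<lambda>s. s ^ r) has_real_derivative real r * s ^ (r - 1)) (at s)"
    by (auto intro!: derivative_eq_intros)
  ultimately have "((\<lambda>s. s ^ r * max 0 (1 - s\<^sup>2) ^ q) has_real_derivative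
     (real r * s ^ (r - 1)) * max 0 (1 - s\<^sup>2) ^ q + (real q * max 0 (1 - s\<^sup>2) ^ (q - 1)) * (- (2 * s)) * s ^ r) (at s)"
    by (intro DERIV_mult)
  then show ?thesis unfolding bump1_def[abs_def] by (rule DERIV_cong) (simp add: algebra_simps)
qed

lemma has_derivative_bump1_nth:
  fixes x :: "real ^ 'd"
  assumes "q \<ge> 2"
  shows "((\<lambda>u. bump1 r q (u $ i)) has_derivative
    (\<lambda>v. v $ i * (real r * bump1 (r - 1) q (x $ i) - 2 * real q * bump1 (r + 1) (q - 1) (x $ i)))) (at x)"
  by (rule DERIV_compose_FDERIV[OF DERIV_bump1[OF assms]]) (rule bounded_linear_imp_has_derivative, rule bounded_linear_vec_nth)

lemma unif_smooth_bump1: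
  fixes i :: "'d::finite"
  assumes "q > n"
  shows "unif_smooth R n {\<lambda>u::real ^ 'd. bump1 r q (u $ i)}"
  using assms
proof (induction n arbitrary: r q)
  case 0
  then show ?case using bump1_bound by (auto intro!: exI[of _ 1])
next
  case (Suc n)
  then have q: "q \<ge> 2" by simp
  let ?b = "\<lambda>r q. {\<lambda>u::real ^ 'd. bump1 r q (u $ i)}"
  let ?c = "\<lambda>B. {\<lambda>_::real ^ 'd. c | c. \<bar>c\<bar> \<le> B}"
  have D: "(\<lambda>x. frechet_derivative (\<lambda>u. bump1 r q (u $ i)) (at x) v) =
     (\<lambda>x. v $ i * (real r * bump1 (r - 1) q (x $ i) + (- 2 * real q) * bump1 (r + 1) (q - 1) (x $ i)))" for v
    using frechet_derivative_at[OF has_derivative_bump1_nth[OF q, of r i]]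
    by (auto simp: fun_eq_iff fun_eq_iff[of "frechet_derivative _ _"])
  have "unif_smooth R n (directional_derivs R (?b r q))"
  proof (rule unif_smooth_mono[OF unif_smooth_mult[OF unif_smooth_const[of R n R]
          unif_smooth_add[OF unif_smooth_mult[OF unif_smooth_const[of R n "real r"] Suc.IH[of q "r - 1"]]
             unif_smooth_mult[OF unif_smooth_const[of R n "2 * real q"] Suc.IH[of "q - 1" "r + 1"]]]]])
    show "directional_derivs R (?b r q) \<subseteq> {\<lambda>x. f x * g x |f g. f \<in> ?c R \<and>
        g \<in> {\<lambda>x. f x + g x |f g. f \<in> {\<lambda>x. f x * g x |f g. f \<in> ?c (real r) \<and> g \<in> ?b (r - 1) q} \<and>
              g \<in> {\<lambda>x. f x * g x |f g. f \<in> ?c (2 * real q) \<and> g \<in> ?b (r + 1) (q - 1)}}}"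
    proof (rule directional_derivs_subsetI)
      fix g and v :: "real ^ 'd" assume g: "g \<in> ?b r q" and v: "norm v \<le> R"
      then have gD: "(\<lambda>x. frechet_derivative g (at x) v) =
     (\<lambda>x. v $ i * (real r * bump1 (r - 1) q (x $ i) + (- 2 * real q) * bump1 (r + 1) (q - 1) (x $ i)))"
        using D by simp
      have vi: "\<bar>v $ i\<bar> \<le> R" using v component_le_norm_cart[of v i] by simp
      show "(\<lambda>x. frechet_derivative g (at x) v) \<in> {\<lambda>x. f x * g x |f g. f \<in> ?c R \<and>
        g \<in> {\<lambda>x. f x + g x |f g. f \<in> {\<lambda>x. f x * g x |f g. f \<in> ?c (real r) \<and> g \<in> ?b (r - 1) q} \<and>
              g \<in> {\<lambda>x. f x * g x |f g. f \<in> ?c (2 * real q) \<and> g \<in> ?b (r + 1) (q - 1)}}}"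
        unfolding gD
        by (intro mult_setI add_setI) (use vi in auto)
    qed
  qed (use Suc.prems in auto)
  moreover have "(\<lambda>u. bump1 r q (u $ i)) differentiable (at x)" for x :: "real ^ 'd"
    using has_derivative_bump1_nth[OF q] by (rule differentiableI)
  moreover have "\<exists>B. \<forall>g\<in>?b r q. \<forall>x. \<bar>g x\<bar> \<le> B"
    using bump1_bound[of q r] q by (auto intro!: exI[of _ 1])
  ultimately show ?case by simp
qed

lemma unif_smooth_prod:
  assumes "finite J" "\<And>i. i \<in> J \<Longrightarrow> unif_smooth R n {f i}"
  shows "unif_smooth R n {\<lambda>x::'a::real_normed_vector. \<Prod>i\<in>J. f i x :: real}"
  using assms
proof (induction J rule: finite_induct)
  case empty
  show ?case by (rule unif_smooth_mono[OF unif_smooth_const[of R n 1]]) auto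
next
  case (insert i J)
  show ?case
    by (rule unif_smooth_mono[OF unif_smooth_mult[of R n "{f i}" "{\<lambda>x. \<Prod>i\<in>J. f i x}"]])
       (use insert in auto)
qed

text \<open>
  The factor \<open>u $ i0\<close> hidden in \<open>bump1 1 q\<close> makes the bump odd along the axis \<open>i0\<close>, so that its slope in that
  direction does not vanish at the centre.
\<close>
definition bump :: "'d::finite \<Rightarrow> nat \<Rightarrow> real ^ 'd \<Rightarrow> real" where
  "bump i0 q u = bump1 1 q (u $ i0) * (\<Prod>i\<in>UNIV - {i0}. bump1 0 q (u $ i))"

text \<open>
  The partial derivative of \<^const>\<open>bump\<close> along the axis \<open>i0\<close>.
\<close>
definition slope :: "'d::finite \<Rightarrow> nat \<Rightarrow> real ^ 'd \<Rightarrow> real" where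
  "slope i0 q u = (bump1 0 q (u $ i0) - 2 * real q * bump1 2 (q - 1) (u $ i0)) *
     (\<Prod>i\<in>UNIV - {i0}. bump1 0 q (u $ i))"

lemma slope_0: "q \<ge> 2 \<Longrightarrow> slope i0 q 0 = 1"
  by (simp add: slope_def bump1_def)

lemma prod_bump1_bound: "q \<ge> 1 \<Longrightarrow> \<bar>\<Prod>i\<in>J. bump1 0 q (u $ i)\<bar> \<le> 1"
  unfolding abs_prod by (rule prod_le_1) (auto intro: bump1_bound)

lemma bump_bound: "q \<ge> 1 \<Longrightarrow> \<bar>bump i0 q u\<bar> \<le> 1"
  unfolding bump_def
  using abs_mult_le[OF bump1_bound[of q 1 "u $ i0"] prod_bump1_bound[of q u "UNIV - {i0}"]] by simp

lemma slope_bound: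
  assumes "q \<ge> 2" shows "\<bar>slope i0 q u\<bar> \<le> 1 + 2 * real q"
proof -
  have "\<bar>2 * real q * bump1 2 (q - 1) (u $ i0)\<bar> \<le> \<bar>2 * real q\<bar> * \<bar>1\<bar>"
    using assms by (intro abs_mult_le bump1_bound) auto
  then have "\<bar>bump1 0 q (u $ i0) - 2 * real q * bump1 2 (q - 1) (u $ i0)\<bar> \<le> 1 + 2 * real q"
    using bump1_bound[of q 0 "u $ i0"] assms by simp
  from abs_mult_le[OF this prod_bump1_bound[of q u "UNIV - {i0}"]] show ?thesis
    unfolding slope_def using assms by simp
qed

lemma bump_slope_eq_0:
  assumes q: "q \<ge> 2" and u: "\<bar>u $ i\<bar> \<ge> 1"
  shows "bump i0 q u = 0" "slope i0 q u = 0"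
proof -
  have "i \<noteq> i0 \<Longrightarrow> (\<Prod>i\<in>UNIV - {i0}. bump1 0 q (u $ i)) = 0"
    using u q by (intro prod_zero) (auto intro!: bexI[of _ i] bump1_eq_0)
  then show "bump i0 q u = 0" "slope i0 q u = 0"
    using u q by (cases "i = i0"; auto simp: bump_def slope_def bump1_eq_0)+
qed

lemma DERIV_bump:
  assumes q: "q \<ge> 2"
  shows "((\<lambda>s. bump i0 q (u + s *\<^sub>R axis i0 1)) has_real_derivative slope i0 q (u + s *\<^sub>R axis i0 1)) (at s)"
proof -
  have [simp]: "(u + s *\<^sub>R axis i0 1) $ i = (if i = i0 then u $ i0 + s else u $ i)" for s i
    by (auto simp: axis_def)
  let ?P = "\<Prod>i\<in>UNIV - {i0}. bump1 0 q (u $ i)"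
  have P: "(\<Prod>i\<in>UNIV - {i0}. bump1 0 q ((u + s *\<^sub>R axis i0 1) $ i)) = ?P" for s
    by (intro prod.cong) (auto simp: axis_def)
  have "((\<lambda>s. bump1 1 q (u $ i0 + s)) has_real_derivative
      (bump1 0 q (u $ i0 + s) - 2 * real q * bump1 2 (q - 1) (u $ i0 + s)) * 1) (at s)"
    by (rule DERIV_chain2[where f = "bump1 1 q"])
       (use DERIV_bump1[OF q, of 1 "u $ i0 + s"] in \<open>auto intro!: derivative_eq_intros simp: numeral_2_eq_2\<close>)
  then show ?thesis
    unfolding bump_def slope_def P by (auto intro!: DERIV_cmult_right)
qed

text \<open>
  One order is lost because the bump has been differentiated once.
\<close>
lemma unif_smooth_slope:
  assumes "q > Suc n"
  shows "unif_smooth R n {slope i0 q}"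
proof -
  note p = unif_smooth_prod[of "UNIV - {i0}" R n "\<lambda>i u. bump1 0 q (u $ i)", OF _ unif_smooth_bump1]
  note a = unif_smooth_add[OF unif_smooth_bump1[of n q R 0 i0]
     unif_smooth_mult[OF unif_smooth_const[of R n "2 * real q"] unif_smooth_bump1[of n "q - 1" R 2 i0]]]
  show ?thesis
  proof (rule unif_smooth_mono[OF unif_smooth_mult[OF a p]])
    have eq: "slope i0 q = (\<lambda>u. (bump1 0 q (u $ i0) + (- 2 * real q) * bump1 2 (q - 1) (u $ i0)) *
     (\<Prod>i\<in>UNIV - {i0}. bump1 0 q (u $ i)))" by (auto simp: slope_def fun_eq_iff)
    show "{slope i0 q} \<subseteq> {\<lambda>x. f x * g x | f g.
       f \<in> {\<lambda>x. f x + g x |f g. f \<in> {\<lambda>u. bump1 0 q (u $ i0)} \<and>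
              g \<in> {\<lambda>x. f x * g x |f g. f \<in> {\<lambda>_. c |c. \<bar>c\<bar> \<le> 2 * real q} \<and> g \<in> {\<lambda>u. bump1 2 (q - 1) (u $ i0)}}} \<and>
       g \<in> {\<lambda>x. \<Prod>i\<in>UNIV - {i0}. bump1 0 q (x $ i)}}"
      unfolding eq insert_subset by (intro conjI mult_setI add_setI empty_subsetI) auto
  qed (use assms in auto)
qed

text \<open>
  The shape of one bump of the drift: \<open>1 / (1 + a * slope) = 1 - a * profile\<close>. The amplitude \<open>a\<close> also occurs
  inside, but only as a bounded parameter.
\<close>
definition profile :: "'d::finite \<Rightarrow> nat \<Rightarrow> real \<Rightarrow> real ^ 'd \<Rightarrow> real" where
  "profile i0 q a u = slope i0 q u * inverse (1 + a * slope i0 q u)"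

lemma slope_small:
  assumes "q \<ge> 2" "0 \<le> a" "a * (1 + 2 * real q) \<le> 1/2"
  shows "\<bar>a * slope i0 q u\<bar> \<le> 1/2"
proof -
  have "\<bar>a * slope i0 q u\<bar> \<le> a * (1 + 2 * real q)"
    unfolding abs_mult using assms slope_bound[of q i0 u] by (intro mult_mono) auto
  with assms(3) show ?thesis by simp
qed

text \<open>
  The upper bound on the amplitudes keeps the denominator above \<open>1/2\<close>, which makes the closure under
  reciprocals applicable uniformly.
\<close>
lemma unif_smooth_profile:
  assumes q: "q > Suc n" and a0: "a0 * (1 + 2 * real q) \<le> 1/2"
  shows "unif_smooth R n {profile i0 q a | a. 0 \<le> a \<and> a \<le> a0}"
proof -
  let ?s = "{slope i0 q}"
  let ?F = "{\<lambda>x. f x + g x | f g. f \<in> {\<lambda>_::real^'a. c | c. \<bar>c\<bar> \<le> 1} \<and>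
     g \<in> {\<lambda>x. f x * g x | f g. f \<in> {\<lambda>_::real^'a. c | c. \<bar>c\<bar> \<le> a0} \<and> g \<in> ?s}}"
  let ?G = "{\<lambda>x. 1 + a * slope i0 q x | a. 0 \<le> a \<and> a \<le> a0}"
  have s: "unif_smooth R n ?s" by (rule unif_smooth_slope[OF q])
  have "unif_smooth R n ?F"
    by (intro unif_smooth_add unif_smooth_mult unif_smooth_const s)
  then have "unif_smooth R n ?G"
  proof (rule unif_smooth_mono, safe)
    fix a assume a: "0 \<le> a" "a \<le> a0"
    have "(\<lambda>x. 1 + a * slope i0 q x) \<in> ?F"
      by (rule add_setI[of "\<lambda>_. 1" _ "\<lambda>x. a * slope i0 q x"], force, rule mult_setI[of "\<lambda>_. a"]) (use a in auto)
    then show "\<exists>f g. (\<lambda>x. 1 + a * slope i0 q x) = (\<lambda>x. f x + g x) \<and> f \<in> {\<lambda>_::real^'a. c | c. \<bar>c\<bar> \<le> 1} \<and>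
     g \<in> {\<lambda>x. f x * g x | f g. f \<in> {\<lambda>_::real^'a. c | c. \<bar>c\<bar> \<le> a0} \<and> g \<in> ?s}" by blast
  qed
  then have "unif_smooth R n {\<lambda>x. inverse (f x) | f. f \<in> ?G}"
  proof (rule unif_smooth_inverse[of _ _ _ "1/2"])
    fix f x assume "f \<in> ?G"
    then obtain a where a: "0 \<le> a" "a \<le> a0" and f: "f = (\<lambda>x. 1 + a * slope i0 q x)" by blast
    have "a * (1 + 2 * real q) \<le> 1/2" using a a0 by (smt (verit) mult_right_mono of_nat_0_le_iff)
    with slope_small[of q a i0 x] a q show "f x \<ge> 1/2" unfolding f by auto
  qed simp
  from unif_smooth_mult[OF s this] show ?thesis
  proof (rule unif_smooth_mono, safe)
    fix a assume a: "0 \<le> a" "a \<le> a0"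
    have "(\<lambda>x. slope i0 q x * inverse (1 + a * slope i0 q x)) \<in> {\<lambda>x. f x * g x | f g. f \<in> ?s \<and> g \<in> {\<lambda>x. inverse (f x) | f. f \<in> ?G}}"
      by (rule mult_setI) (use a in auto)
    then show "\<exists>f g. profile i0 q a = (\<lambda>x. f x * g x) \<and> f \<in> ?s \<and> g \<in> {\<lambda>x. inverse (f x) | f. f \<in> ?G}"
      unfolding profile_def[abs_def] by blast
  qed
qed

section \<open>Drifts conjugate to a constant drift\<close>

text \<open>
  If \<open>g\<close> is the derivative of \<open>\<phi>\<close> along \<open>e\<close>, then \<open>x + \<phi>(x) e\<close> moves with constant speed \<open>v\<close> along every
  solution. On the line through \<open>x\<close> this map is strictly increasing and onto because \<open>g\<close> is at least
  \<open>-1/2\<close> and \<open>\<phi>\<close> is bounded. So the position at time \<open>t\<close> is the unique solution \<open>p\<close> of one scalar equation,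
  and the existence and uniqueness of the flow follow without a general theorem on differential equations.
\<close>
lemma flow_conjugate:
  fixes \<phi> g :: "real ^ 'd \<Rightarrow> real" and i0 :: "'d::finite"
  defines "e \<equiv> axis i0 (1::real) :: real ^ 'd"
  assumes der: "\<And>x s. ((\<lambda>s. \<phi> (x + s *\<^sub>R e)) has_real_derivative g (x + s *\<^sub>R e)) (at s)"
    and g: "\<And>x. \<bar>g x\<bar> \<le> 1/2" and B: "\<And>x. \<bar>\<phi> x\<bar> \<le> B"
  obtains p where "flow (\<lambda>x. axis i0 (v / (1 + g x))) x t = x + p *\<^sub>R e"
    "p + \<phi> (x + p *\<^sub>R e) = \<phi> x + t * v"
    "\<And>p'. p' + \<phi> (x + p' *\<^sub>R e) = \<phi> x + t * v \<Longrightarrow> p' = p"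
proof -
  let ?f = "\<lambda>x. axis i0 (v / (1 + g x)) :: real ^ 'd"
  define H where "H s = s + \<phi> (x + s *\<^sub>R e)" for s
  have dH: "(H has_real_derivative 1 + g (x + s *\<^sub>R e)) (at s)" for s
    unfolding H_def[abs_def] by (intro DERIV_add DERIV_ident der)
  have gpos: "1 + g y \<ge> 1/2" for y using g[of y] by linarith
  have contH: "isCont H s" for s using dH DERIV_isCont by blast
  have incr: "(s' - s) / 2 \<le> H s' - H s" if "s \<le> s'" for s s'
  proof (cases "s = s'")
    case False
    then have "s < s'" using that by simp
    from MVT2[OF this dH] obtain z where "H s' - H s = (s' - s) * (1 + g (x + z *\<^sub>R e))" by blast
    moreover have "(s' - s) * (1/2) \<le> (s' - s) * (1 + g (x + z *\<^sub>R e))"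
      using that gpos by (intro mult_left_mono) auto
    ultimately show ?thesis by simp
  qed simp
  have expand: "\<bar>s - s'\<bar> \<le> 2 * \<bar>H s - H s'\<bar>" for s s'
    using incr[of s s'] incr[of s' s] by (cases "s \<le> s'") auto
  have surj: "\<exists>s. H s = y" for y
  proof -
    have "H (y - B) \<le> y" "y \<le> H (y + B)" unfolding H_def using B[of "x + (y - B) *\<^sub>R e"] B[of "x + (y + B) *\<^sub>R e"] by linarith+
    moreover have "y - B \<le> y + B" using B[of x] by linarith
    ultimately show ?thesis using IVT[of H "y - B" y "y + B"] contH by blast
  qed
  \<comment> \<open>The inverse of \<open>H\<close>, which exists by the intermediate value theorem and is 2-Lipschitz by \<open>expand\<close>.\<close>
  define k where "k y = (SOME s. H s = y)" for y
  have Hk: "H (k y) = y" for y unfolding k_def using surj by (rule someI_ex)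
  have kH: "k (H s) = s" for s using expand[of "k (H s)" s] Hk by simp
  have contk: "isCont k y" for y
  proof -
    have "\<bar>k a - k b\<bar> \<le> 2 * \<bar>a - b\<bar>" for a b using expand[of "k a" "k b"] Hk by simp
    then have "2-lipschitz_on UNIV k" by (intro lipschitz_onI) (auto simp: dist_real_def)
    then show ?thesis using lipschitz_on_continuous_on continuous_on_eq_continuous_at by blast
  qed
  have dk: "(k has_real_derivative inverse (1 + g (x + k y *\<^sub>R e))) (at y)" for y
  proof (rule DERIV_inverse_function[where a = "y - 1" and b = "y + 1" and f = H])
    show "1 + g (x + k y *\<^sub>R e) \<noteq> 0" using gpos[of "x + k y *\<^sub>R e"] by linarith
  qed (use dH Hk contk in auto)
  let ?u = "\<lambda>t. x + k (\<phi> x + t * v) *\<^sub>R e"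
  have "flow ?f x = ?u"
    unfolding flow_def
  proof (rule the_equality)
    have "k (\<phi> x) = 0" using kH[of 0] by (simp add: H_def)
    moreover have "(?u has_vector_derivative ?f (?u t)) (at t)" for t
    proof -
      have "((\<lambda>t. k (\<phi> x + t * v)) has_real_derivative inverse (1 + g (?u t)) * v) (at t)"
        by (rule DERIV_chain2[OF dk]) (auto intro!: derivative_eq_intros)
      then have "(?u has_vector_derivative (inverse (1 + g (?u t)) * v) *\<^sub>R e) (at t)"
        by (auto intro!: derivative_eq_intros has_vector_derivative_scaleR simp: has_real_derivative_iff_has_vector_derivative)
      moreover have "(inverse (1 + g (?u t)) * v) *\<^sub>R e = ?f (?u t)"
        by (simp add: e_def vec_eq_iff axis_def divide_inverse mult.commute)
      ultimately show ?thesis by simp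
    qed
    ultimately show "?u 0 = x \<and> (\<forall>t. (?u has_vector_derivative ?f (?u t)) (at t))" by simp
  next
    fix w assume w: "w 0 = x \<and> (\<forall>t. (w has_vector_derivative ?f (w t)) (at t))"
    have comp: "((\<lambda>t. w t $ j) has_real_derivative ?f (w t) $ j) (at t)" for j t
      using bounded_linear.has_vector_derivative[OF bounded_linear_vec_nth, of w "?f (w t)" "at t" j] w
      by (simp add: has_real_derivative_iff_has_vector_derivative)
    define r where "r t = w t $ i0 - x $ i0" for t
    have "w t $ j = x $ j" if "j \<noteq> i0" for j t
    proof -
      have "\<forall>t. ((\<lambda>t. w t $ j) has_real_derivative 0) (at t)" using comp[of j] that by (simp add: axis_def)
      from DERIV_isconst_all[OF this, of t 0] w show ?thesis by simp
    qed
    then have wr: "w t = x + r t *\<^sub>R e" for t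
      by (auto simp: vec_eq_iff r_def e_def axis_def)
    have dr: "(r has_real_derivative v / (1 + g (w t))) (at t)" for t
      using comp[of i0 t] unfolding r_def[abs_def] by (auto intro!: derivative_eq_intros)
    \<comment> \<open>Along any solution \<open>H\<close> grows with constant speed \<open>v\<close>, which is the uniqueness of the flow.\<close>
    have "((\<lambda>t. H (r t) - t * v) has_real_derivative 0) (at t)" for t
    proof -
      have "((\<lambda>t. H (r t)) has_real_derivative (1 + g (x + r t *\<^sub>R e)) * (v / (1 + g (w t)))) (at t)"
        by (rule DERIV_chain2[OF dH dr])
      moreover have "(1 + g (x + r t *\<^sub>R e)) * (v / (1 + g (w t))) = v"
        using gpos[of "w t"] by (simp add: wr[symmetric])
      ultimately have "((\<lambda>t. H (r t)) has_real_derivative v) (at t)" by simp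
      then show ?thesis by (auto intro!: derivative_eq_intros)
    qed
    then have "H (r t) - t * v = H (r 0) - 0 * v" for t
      using DERIV_isconst_all[of "\<lambda>t. H (r t) - t * v" t 0] by blast
    moreover have "H (r 0) = \<phi> x" using w by (simp add: H_def r_def)
    ultimately have "H (r t) = \<phi> x + t * v" for t by (simp add: algebra_simps)
    then have "r t = k (\<phi> x + t * v)" for t using kH by metis
    then show "w = ?u" using wr by auto
  qed
  moreover have "k (\<phi> x + t * v) + \<phi> (x + k (\<phi> x + t * v) *\<^sub>R e) = \<phi> x + t * v"
    using Hk[of "\<phi> x + t * v"] unfolding H_def .
  moreover have "p' = k (\<phi> x + t * v)" if "p' + \<phi> (x + p' *\<^sub>R e) = \<phi> x + t * v" for p'
    using kH[of p'] that unfolding H_def by simp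
  ultimately show ?thesis using that by metis
qed

section \<open>Tilted drifts with separated bumps\<close>

text \<open>
  The closed cubes of half side \<open>h\<close> around the points of the set are pairwise disjoint.
\<close>
definition separated :: "real \<Rightarrow> (real ^ 'd) set \<Rightarrow> bool" where
  "separated h S \<longleftrightarrow> (\<forall>z\<in>S. \<forall>w\<in>S. z \<noteq> w \<longrightarrow> (\<exists>i. 2 * h < \<bar>z $ i - w $ i\<bar>))"

lemma separated_subset: "separated h S \<Longrightarrow> T \<subseteq> S \<Longrightarrow> separated h T"
  unfolding separated_def by blast

lemma separated_active:
  assumes sep: "separated h S" and h: "h > 0" and z: "z0 \<in> S" "z \<in> S" "z \<noteq> z0"
    and act: "\<And>i. \<bar>((1/h) *\<^sub>R (x - z0)) $ i\<bar> \<le> 1"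
  shows "\<exists>i. \<bar>((1/h) *\<^sub>R (x - z)) $ i\<bar> > 1"
proof -
  obtain i where i: "2 * h < \<bar>z $ i - z0 $ i\<bar>" using sep z unfolding separated_def by blast
  have "\<bar>x $ i - z0 $ i\<bar> \<le> h" using act[of i] h by (simp add: abs_mult field_simps)
  then have "\<bar>x $ i - z $ i\<bar> > h" using i by linarith
  then show ?thesis using h by (intro exI[of _ i]) (simp add: abs_mult field_simps)
qed

lemma separated_single:
  assumes "separated h S" "h > 0" "S \<noteq> {}"
  obtains z0 where "z0 \<in> S" "\<And>z. z \<in> S \<Longrightarrow> z \<noteq> z0 \<Longrightarrow> \<exists>i. \<bar>((1/h) *\<^sub>R (x - z)) $ i\<bar> > 1"
proof (cases "\<exists>z0\<in>S. \<forall>i. \<bar>((1/h) *\<^sub>R (x - z0)) $ i\<bar> \<le> 1")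
  case True
  then show ?thesis using that separated_active[OF assms(1,2)] by blast
next
  case False
  then show ?thesis using that assms(3) by (meson not_le_imp_less equals0I)
qed

text \<open>
  A sum of rescaled functions supported in the closed cubes reduces to the term of the only cube that can
  contain the point.
\<close>
lemma sum_single:
  fixes \<phi> :: "real ^ 'd \<Rightarrow> real"
  assumes "finite S" "z0 \<in> S" "\<And>z. z \<in> S \<Longrightarrow> z \<noteq> z0 \<Longrightarrow> \<exists>i. \<bar>((1/h) *\<^sub>R (x - z)) $ i\<bar> > 1"
    and "\<And>u i. \<bar>u $ i\<bar> > 1 \<Longrightarrow> \<phi> u = 0"
  shows "(\<Sum>z\<in>S. \<phi> ((1/h) *\<^sub>R (x - z))) = \<phi> ((1/h) *\<^sub>R (x - z0))"
proof -
  have "(\<Sum>z\<in>S - {z0}. \<phi> ((1/h) *\<^sub>R (x - z))) = 0"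
    using assms(3,4) by (intro sum.neutral) blast
  then show ?thesis using assms(1,2) by (simp add: sum.remove[of S z0])
qed

lemma separated_sum_bound:
  fixes \<phi> :: "real ^ 'd \<Rightarrow> real"
  assumes "finite S" "separated h S" "h > 0" "\<And>u i. \<bar>u $ i\<bar> > 1 \<Longrightarrow> \<phi> u = 0" "\<And>u. \<bar>\<phi> u\<bar> \<le> B"
  shows "\<bar>\<Sum>z\<in>S. \<phi> ((1/h) *\<^sub>R (x - z))\<bar> \<le> B"
proof (cases "S = {}")
  case True
  then show ?thesis using assms(5)[of 0] by simp
next
  case False
  from separated_single[OF assms(2,3) False, of x] obtain z0 where
    "z0 \<in> S" "\<And>z. z \<in> S \<Longrightarrow> z \<noteq> z0 \<Longrightarrow> \<exists>i. \<bar>((1/h) *\<^sub>R (x - z)) $ i\<bar> > 1" by blast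
  then show ?thesis using sum_single[OF assms(1), of z0 h x \<phi>] assms(4,5) by simp
qed

text \<open>
  The displacement \<open>\<phi>\<close> of the conjugation. The factor \<open>h\<close> makes its slope have size \<open>a\<close>.
\<close>
definition phase :: "'d::finite \<Rightarrow> nat \<Rightarrow> real \<Rightarrow> real \<Rightarrow> (real ^ 'd) set \<Rightarrow> real ^ 'd \<Rightarrow> real" where
  "phase i0 q a h S x = (\<Sum>z\<in>S. a * h * bump i0 q ((1/h) *\<^sub>R (x - z)))"

text \<open>
  The derivative of \<^const>\<open>phase\<close> along the axis \<open>i0\<close>.
\<close>
definition tilt :: "'d::finite \<Rightarrow> nat \<Rightarrow> real \<Rightarrow> real \<Rightarrow> (real ^ 'd) set \<Rightarrow> real ^ 'd \<Rightarrow> real" where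
  "tilt i0 q a h S x = (\<Sum>z\<in>S. a * slope i0 q ((1/h) *\<^sub>R (x - z)))"

text \<open>
  The drift conjugate to the constant drift \<open>v\<close> along the axis \<open>i0\<close>.
\<close>
definition tilted_field :: "'d::finite \<Rightarrow> nat \<Rightarrow> real \<Rightarrow> real \<Rightarrow> real \<Rightarrow> (real ^ 'd) set \<Rightarrow> real ^ 'd \<Rightarrow> real ^ 'd" where
  "tilted_field i0 q v a h S x = axis i0 (v / (1 + tilt i0 q a h S x))"

lemma DERIV_phase:
  assumes q: "q \<ge> 2" and h: "h > 0"
  shows "((\<lambda>s. phase i0 q a h S (x + s *\<^sub>R axis i0 1)) has_real_derivative tilt i0 q a h S (x + s *\<^sub>R axis i0 1)) (at s)"
proof -
  have "((\<lambda>s. bump i0 q ((1/h) *\<^sub>R (x + s *\<^sub>R axis i0 1 - z))) has_real_derivative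
      slope i0 q ((1/h) *\<^sub>R (x + s *\<^sub>R axis i0 1 - z)) * (1/h)) (at s)" for z
  proof -
    have eq: "(1/h) *\<^sub>R (x + s *\<^sub>R axis i0 1 - z) = (1/h) *\<^sub>R (x - z) + (s / h) *\<^sub>R axis i0 1" for s
      by (simp add: vec_eq_iff field_simps)
    show ?thesis unfolding eq
      by (rule DERIV_chain2[OF DERIV_bump[OF q]]) (use h in \<open>auto intro!: derivative_eq_intros\<close>)
  qed
  from DERIV_cmult[OF this, of "a * h"] show ?thesis
    unfolding phase_def tilt_def using h by (intro DERIV_sum) (simp add: mult_ac)
qed

context
  fixes i0 :: "'d::finite" and q :: nat and a h :: real and S :: "(real ^ 'd) set"
  assumes q: "q \<ge> 2" and a: "0 \<le> a" "a * (1 + 2 * real q) \<le> 1/2" and h: "h > 0"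
    and S: "finite S" "separated h S"
begin

lemma bump_slope_outside: "\<bar>u $ i\<bar> > 1 \<Longrightarrow> bump i0 q u = 0" "\<bar>u $ i\<bar> > 1 \<Longrightarrow> slope i0 q u = 0"
  using bump_slope_eq_0[OF q, of u i i0] by simp_all

lemma phase_bound: "\<bar>phase i0 q a h S x\<bar> \<le> a * h"
  unfolding phase_def
proof (rule separated_sum_bound[OF S h])
  show "\<bar>a * h * bump i0 q u\<bar> \<le> a * h" for u
    using abs_mult_le[of "a * h" "a * h" "bump i0 q u" 1] bump_bound[of q i0 u] a h q by simp
qed (auto dest!: bump_slope_outside(1))

lemma tilt_bound: "\<bar>tilt i0 q a h S x\<bar> \<le> 1/2"
  unfolding tilt_def
  by (rule separated_sum_bound[OF S h])
     (use slope_small[OF q a] in \<open>auto dest!: bump_slope_outside(2)\<close>)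

lemma profile_eq_0: "\<bar>u $ i\<bar> \<ge> 1 \<Longrightarrow> profile i0 q a u = 0"
  using bump_slope_eq_0(2)[OF q, of u i i0] by (simp add: profile_def)

text \<open>
  Since at most one bump is active at a point, the reciprocal of one plus a sum is itself a sum over the
  bumps. This linearises the dependence on the set of bumps and reduces all derivatives to those of a single
  profile.
\<close>
lemma field_nth:
  "tilted_field i0 q v a h S x $ i0 = v + (\<Sum>z\<in>S. - (v * a) * profile i0 q a ((1/h) *\<^sub>R (x - z)))"
proof (cases "S = {}")
  case True
  then show ?thesis by (simp add: tilted_field_def tilt_def)
next
  case False
  from separated_single[OF S(2) h False, of x] obtain z0 where
    z0: "z0 \<in> S" "\<And>z. z \<in> S \<Longrightarrow> z \<noteq> z0 \<Longrightarrow> \<exists>i. \<bar>((1/h) *\<^sub>R (x - z)) $ i\<bar> > 1" by blast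
  let ?s = "slope i0 q ((1/h) *\<^sub>R (x - z0))"
  have t: "tilt i0 q a h S x = a * ?s"
    unfolding tilt_def by (rule sum_single[OF S(1) z0, of "\<lambda>u. a * slope i0 q u"]) (auto dest!: bump_slope_outside(2))
  have p: "(\<Sum>z\<in>S. - (v * a) * profile i0 q a ((1/h) *\<^sub>R (x - z))) = - (v * a) * profile i0 q a ((1/h) *\<^sub>R (x - z0))"
    by (rule sum_single[OF S(1) z0, of "\<lambda>u. - (v * a) * profile i0 q a u"]) (auto dest!: profile_eq_0[OF less_imp_le])
  have "1 + a * ?s \<noteq> 0" using slope_small[OF q a, of i0 "(1/h) *\<^sub>R (x - z0)"] by linarith
  then show ?thesis unfolding tilted_field_def t p by (simp add: profile_def field_simps)
qed

end

text \<open>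
  Each derivative of a rescaled function costs a factor \<open>1 / h\<close>; the constant survives only at order zero.
\<close>
lemma iter_deriv_rescaled_sum:
  fixes g :: "real ^ 'd::finite \<Rightarrow> real"
  assumes S: "finite S" and g: "\<And>vs x. length vs < n \<Longrightarrow> iter_deriv g vs differentiable (at x)"
  shows "length vs \<le> n \<Longrightarrow> iter_deriv (\<lambda>x. c + (\<Sum>z\<in>S. k * g ((1/h) *\<^sub>R (x - z)))) vs =
     (\<lambda>x. (if vs = [] then c else 0) + (\<Sum>z\<in>S. k * (1/h) ^ length vs * iter_deriv g vs ((1/h) *\<^sub>R (x - z))))"
    "length vs < n \<Longrightarrow> iter_deriv (\<lambda>x. c + (\<Sum>z\<in>S. k * g ((1/h) *\<^sub>R (x - z)))) vs differentiable (at x)"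
proof -
  let ?F = "\<lambda>x. c + (\<Sum>z\<in>S. k * g ((1/h) *\<^sub>R (x - z)))"
  have D: "((\<lambda>x. C + (\<Sum>z\<in>S. K * iter_deriv g vs ((1/h) *\<^sub>R (x - z)))) has_derivative
      (\<lambda>v. \<Sum>z\<in>S. K * (1/h) * frechet_derivative (iter_deriv g vs) (at ((1/h) *\<^sub>R (x - z))) v)) (at x)"
    if vs: "length vs < n" for C K vs x
  proof -
    have d: "(iter_deriv g vs has_derivative frechet_derivative (iter_deriv g vs) (at y)) (at y)" for y
      using g[OF vs] by (simp add: frechet_derivative_works)
    have lin: "frechet_derivative (iter_deriv g vs) (at y) (r *\<^sub>R v) = r * frechet_derivative (iter_deriv g vs) (at y) v" for y r v
      using linear_frechet_derivative[OF g[OF vs], of y] by (simp add: linear_cmul)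
    have "((\<lambda>x. iter_deriv g vs ((1/h) *\<^sub>R (x - z))) has_derivative
        (\<lambda>v. frechet_derivative (iter_deriv g vs) (at ((1/h) *\<^sub>R (x - z))) ((1/h) *\<^sub>R v))) (at x)" for z
      by (rule has_derivative_compose[OF _ d]) (auto intro!: derivative_eq_intros)
    then have "((\<lambda>x. C + (\<Sum>z\<in>S. K * iter_deriv g vs ((1/h) *\<^sub>R (x - z)))) has_derivative
      (\<lambda>v. 0 + (\<Sum>z\<in>S. K * (frechet_derivative (iter_deriv g vs) (at ((1/h) *\<^sub>R (x - z))) ((1/h) *\<^sub>R v))))) (at x)"
      by (intro has_derivative_add has_derivative_const has_derivative_sum has_derivative_mult_right)
    then show ?thesis by (simp add: lin mult_ac)
  qed
  have eq: "iter_deriv ?F vs =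
     (\<lambda>x. (if vs = [] then c else 0) + (\<Sum>z\<in>S. k * (1/h) ^ length vs * iter_deriv g vs ((1/h) *\<^sub>R (x - z))))"
    if "length vs \<le> n" for vs
    using that
  proof (induction vs)
    case (Cons v vs)
    then have vs: "length vs < n" by simp
    have "iter_deriv ?F (v # vs) x = (\<Sum>z\<in>S. k * (1/h) ^ length (v # vs) * iter_deriv g (v # vs) ((1/h) *\<^sub>R (x - z)))" for x
      unfolding iter_deriv.simps Cons.IH[OF less_imp_le[OF vs]] frechet_derivative_at[OF D[OF vs], symmetric]
      by (simp add: mult_ac)
    then show ?case by auto
  qed simp
  show "length vs \<le> n \<Longrightarrow> iter_deriv ?F vs =
     (\<lambda>x. (if vs = [] then c else 0) + (\<Sum>z\<in>S. k * (1/h) ^ length vs * iter_deriv g vs ((1/h) *\<^sub>R (x - z))))"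
    by (rule eq)
  show "length vs < n \<Longrightarrow> iter_deriv ?F vs differentiable (at x)"
    unfolding eq[OF less_imp_le] using D by (rule differentiableI)
qed

lemma iter_deriv_vanish:
  assumes "open U" "\<And>x. x \<in> U \<Longrightarrow> g x = 0"
  shows "x \<in> U \<Longrightarrow> iter_deriv g vs x = 0"
proof (induction vs arbitrary: x)
  case Nil
  then show ?case using assms(2) by simp
next
  case (Cons v vs)
  have "((\<lambda>_. 0) has_derivative (\<lambda>_. 0)) (at x)" by simp
  then have "(iter_deriv g vs has_derivative (\<lambda>_. 0)) (at x)"
    by (rule has_derivative_transform_within_open[OF _ assms(1) Cons.prems]) (use Cons.IH in auto)
  then show ?case using frechet_derivative_at by (metis iter_deriv.simps(2))
qed

lemma open_nth_gt: "open {u :: real ^ 'd. \<bar>u $ i\<bar> > 1}"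
  by (intro open_Collect_less continuous_intros)

lemma ell_bounds:
  assumes "\<beta> \<ge> 1"
  shows "real (ell \<beta>) < \<beta>" "\<beta> \<le> real (ell \<beta>) + 1"
proof -
  have b: "\<forall>l. real l < \<beta> \<longrightarrow> l \<le> nat \<lceil>\<beta>\<rceil>" using assms by (auto simp: le_nat_iff) linarith
  have 0: "real 0 < \<beta>" using assms by simp
  show "real (ell \<beta>) < \<beta>" unfolding ell_def by (rule GreatestI_nat[where P = "\<lambda>l. real l < \<beta>", OF 0 b[rule_format]])
  have "real (Suc (ell \<beta>)) < \<beta> \<Longrightarrow> Suc (ell \<beta>) \<le> ell \<beta>"
    unfolding ell_def by (rule Greatest_le_nat[where P = "\<lambda>l. real l < \<beta>", OF _ b[rule_format]])
  then show "\<beta> \<le> real (ell \<beta>) + 1" by fastforce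
qed

lemma min_one_le_powr: "0 \<le> s \<Longrightarrow> 0 \<le> \<gamma> \<Longrightarrow> \<gamma> \<le> 1 \<Longrightarrow> s \<le> 1 \<Longrightarrow> s \<le> s powr \<gamma>" for s \<gamma> :: real
  using powr_mono'[of \<gamma> 1 s] by (cases "s = 0") auto

text \<open>
  Below the length scale \<open>h\<close> the Lipschitz bound is the better one, above it the sup bound. Both are dominated
  by the power \<open>\<gamma>\<close> of the rescaled distance.
\<close>
lemma holder_interpolation:
  fixes f :: "'a::real_normed_vector \<Rightarrow> real"
  assumes f: "\<And>x. \<bar>f x\<bar> \<le> A" and L: "\<And>x y. \<bar>f x - f y\<bar> \<le> A / h * norm (x - y)"
    and h: "h > 0" and \<gamma>: "0 < \<gamma>" "\<gamma> \<le> 1"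
  shows "\<bar>f x - f y\<bar> \<le> 2 * A * (norm (x - y) / h) powr \<gamma>"
proof (cases "norm (x - y) / h \<le> 1")
  case True
  have A: "A \<ge> 0" using f[of x] by linarith
  have "\<bar>f x - f y\<bar> \<le> A * (norm (x - y) / h)" using L[of x y] by simp
  also have "\<dots> \<le> A * (norm (x - y) / h) powr \<gamma>"
    using A h \<gamma> True by (intro mult_left_mono min_one_le_powr) auto
  also have "\<dots> \<le> 2 * A * (norm (x - y) / h) powr \<gamma>" using A by simp
  finally show ?thesis .
next
  case False
  have A: "A \<ge> 0" using f[of x] by linarith
  have "\<bar>f x - f y\<bar> \<le> 2 * A * 1" using f[of x] f[of y] by linarith
  also have "\<dots> \<le> 2 * A * (norm (x - y) / h) powr \<gamma>"
    using A False \<gamma> by (intro mult_left_mono ge_one_powr_ge_zero) auto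
  finally show ?thesis .
qed

lemma iter_deriv_zero: "iter_deriv (\<lambda>_. 0) vs = (\<lambda>_. 0)"
  by (induction vs) auto


text \<open>
  With amplitude \<open>c * h powr \<beta>\<close> the derivatives of order \<open>k\<close> have size \<open>c * h powr (\<beta> - k)\<close>, which is at most a
  multiple of \<open>c\<close> up to the order \<open>ell \<beta>\<close>. The next order gives the Hoelder condition by interpolation. This is
  why \<open>q\<close> exceeds \<open>ell \<beta>\<close> by three: one order for the slope, one for the Hoelder condition, and one for the
  boundedness of the last derivative. The drift \<open>v\<close> is half of \<open>L 0\<close> since the tilt can double it.
\<close>
lemma field_in_smooth_class:
  fixes L :: "nat \<Rightarrow> real" and i0 :: "'d::finite"
  assumes \<beta>: "\<beta> \<ge> 1" and L: "\<forall>k\<le>ell \<beta>. L k > 0" and L\<beta>: "L\<beta> > 0"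
    and q: "q = ell \<beta> + 3"
  obtains c0 where "0 < c0" "c0 \<le> 1" "c0 * (1 + 2 * real q) \<le> 1/2"
    "\<And>c h v S. 0 < c \<Longrightarrow> c \<le> c0 \<Longrightarrow> 0 < h \<Longrightarrow> h \<le> 1 \<Longrightarrow> finite S \<Longrightarrow> separated h S \<Longrightarrow> \<bar>v\<bar> = L 0 / 2 \<Longrightarrow>
       tilted_field i0 q v (c * h powr \<beta>) h S \<in> smooth_class \<beta> L L\<beta>"
proof -
  let ?l = "ell \<beta>"
  note ell = ell_bounds[OF \<beta>]
  \<comment> \<open>Up to this amplitude, \<open>slope_bound\<close> keeps the tilt below \<open>1/2\<close>.\<close>
  define a0 where "a0 = 1 / (2 * (1 + 2 * real q))"
  have a0: "a0 > 0" "a0 \<le> 1" "a0 * (1 + 2 * real q) \<le> 1/2" by (auto simp: a0_def field_simps)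
  let ?P = "{profile i0 q a | a. 0 \<le> a \<and> a \<le> a0}"
  have sm: "unif_smooth R (Suc ?l) ?P" for R
    by (rule unif_smooth_profile) (use q a0 in auto)
  from unif_smooth_iter_deriv[OF sm[of 1]] obtain B where B: "\<And>a vs x. 0 \<le> a \<Longrightarrow> a \<le> a0 \<Longrightarrow>
      length vs \<le> Suc ?l \<Longrightarrow> \<forall>v\<in>set vs. norm v \<le> 1 \<Longrightarrow> \<bar>iter_deriv (profile i0 q a) vs x\<bar> \<le> B"
    by blast
  have diff: "iter_deriv (profile i0 q a) vs differentiable (at x)" if "0 \<le> a" "a \<le> a0" "length vs < Suc ?l" for a vs x
  proof -
    \<comment> \<open>Any finite list of directions lies in some ball, and the family is smooth for every radius.\<close>
    have "\<forall>v\<in>set vs. norm v \<le> sum_list (map norm vs)"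
      by (auto intro!: member_le_sum_list)
    with unif_smooth_iter_deriv[OF sm[of "sum_list (map norm vs)"]] that show ?thesis
      by (metis (mono_tags, lifting) CollectI less_imp_le)
  qed
  have B0: "B \<ge> 0" using B[of 0 "[]" 0] a0 by (simp add: order.trans[OF abs_ge_zero])
  \<comment> \<open>The tightest of the finitely many constraints on the derivatives.\<close>
  define w where "w = Min (insert L\<beta> (L ` {..?l}))"
  have w: "w > 0" "w \<le> L\<beta>" "\<And>k. k \<le> ?l \<Longrightarrow> w \<le> L k"
    unfolding w_def using L L\<beta> by (auto simp: Min_gr_iff intro: min.coboundedI2)
  have L0: "L 0 > 0" using L by simp
  define c0 where "c0 = min a0 (w / (L 0 * (B + 1)))"
  have c0: "0 < c0" "c0 \<le> a0" "c0 * (L 0 * (B + 1)) \<le> w"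
  proof -
    have LB: "L 0 * (B + 1) > 0" using L0 B0 by simp
    show "0 < c0" "c0 \<le> a0" using a0 w LB by (auto simp: c0_def)
    have "c0 \<le> w / (L 0 * (B + 1))" by (simp add: c0_def)
    then show "c0 * (L 0 * (B + 1)) \<le> w" using LB by (simp add: pos_le_divide_eq)
  qed
  show ?thesis
  proof (rule that[of c0])
    show "0 < c0" "c0 \<le> 1" using c0 a0 by auto
    show "c0 * (1 + 2 * real q) \<le> 1/2" using c0 a0 by (smt (verit) mult_right_mono of_nat_0_le_iff)
    fix c h v :: real and S :: "(real ^ 'd) set"
    assume c: "0 < c" "c \<le> c0" and h: "0 < h" "h \<le> 1" and S: "finite S" "separated h S" and v: "\<bar>v\<bar> = L 0 / 2"
    define a where "a = c * h powr \<beta>"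
    have hb: "h powr \<beta> \<le> 1" using h \<beta> by (simp add: powr_le1)
    have a: "0 \<le> a" "a \<le> a0"
      using c c0 h hb unfolding a_def by (auto intro: order.trans[OF mult_left_le])
    have aq: "a * (1 + 2 * real q) \<le> 1/2" using a a0 by (smt (verit) mult_right_mono of_nat_0_le_iff)
    have q2: "q \<ge> 2" using q by simp
    let ?g = "profile i0 q a"
    define F where "F = (\<lambda>x. v + (\<Sum>z\<in>S. - (v * a) * ?g ((1/h) *\<^sub>R (x - z))))"
    have F: "(\<lambda>x. tilted_field i0 q v a h S x $ i0) = F"
      using field_nth[OF q2 a(1) aq h(1) S] by (auto simp: F_def)
    note it = iter_deriv_rescaled_sum[OF S(1) diff[OF a], where n = "Suc ?l" and c = v and k = "- (v * a)" and h = h, folded F_def]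
    define A where "A k = \<bar>v\<bar> * a * (1/h) ^ k * B" for k
    have bound: "\<bar>iter_deriv F vs x\<bar> \<le> A (length vs)"
      if vs: "vs \<noteq> []" "length vs \<le> Suc ?l" "\<forall>u\<in>set vs. norm u \<le> 1" for vs x
    proof -
      have "\<bar>\<Sum>z\<in>S. - (v * a) * (1/h) ^ length vs * iter_deriv ?g vs ((1/h) *\<^sub>R (x - z))\<bar> \<le> A (length vs)"
      proof (rule separated_sum_bound[OF S h(1)])
        fix u :: "real ^ 'd" and i assume "\<bar>u $ i\<bar> > 1"
        then show "- (v * a) * (1/h) ^ length vs * iter_deriv ?g vs u = 0"
          using iter_deriv_vanish[OF open_nth_gt[of i], of ?g u vs] profile_eq_0[OF q2 a(1) aq h(1) S less_imp_le] by auto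
      next
        fix u :: "real ^ 'd"
        have "\<bar>- (v * a) * (1/h) ^ length vs * iter_deriv ?g vs u\<bar> = \<bar>v\<bar> * a * (1/h) ^ length vs * \<bar>iter_deriv ?g vs u\<bar>"
          using a h by (simp add: abs_mult)
        also have "\<dots> \<le> A (length vs)"
          unfolding A_def using B[OF a vs(2,3), of u] a h by (intro mult_left_mono) auto
        finally show "\<bar>- (v * a) * (1/h) ^ length vs * iter_deriv ?g vs u\<bar> \<le> A (length vs)" .
      qed
      then show ?thesis using it(1)[where vs = vs] vs by simp
    qed
    have A0: "A k \<ge> 0" for k using a h B0 by (simp add: A_def)
    have pw: "(1/h) ^ k = h powr (- real k)" for k
      using h by (simp add: powr_minus powr_realpow power_one_over inverse_eq_divide)
    have Aeq: "A k = L 0 / 2 * B * c * h powr (\<beta> - real k)" for k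
      unfolding A_def pw a_def v using h by (simp add: powr_add[symmetric])
    have cw: "L 0 * B * c \<le> w"
    proof -
      have "L 0 * B * c \<le> L 0 * (B + 1) * c0" using L0 B0 c by (intro mult_mono) auto
      then show ?thesis using c0 by (simp add: mult_ac)
    qed
    have Aw: "A k \<le> w" if "k \<le> ?l" for k
    proof -
      have "h powr (\<beta> - real k) \<le> 1" using h ell that by (intro powr_le1) auto
      then have "A k \<le> L 0 / 2 * B * c * 1" unfolding Aeq using L0 B0 c by (intro mult_left_mono) auto
      also have "\<dots> \<le> L 0 * B * c" using L0 B0 c by simp
      finally show ?thesis using cw by simp
    qed
    have sup: "\<bar>F x\<bar> \<le> L 0" for x
    proof -
      have "\<bar>tilt i0 q a h S x\<bar> \<le> 1/2" by (rule tilt_bound[OF q2 a(1) aq h(1) S])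
      then have "1/2 \<le> 1 + tilt i0 q a h S x" by linarith
      then have "\<bar>v / (1 + tilt i0 q a h S x)\<bar> \<le> \<bar>v\<bar> / (1/2)"
        unfolding abs_divide by (intro divide_left_mono) auto
      then have "\<bar>tilted_field i0 q v a h S x $ i0\<bar> \<le> L 0" by (simp add: tilted_field_def v)
      then show ?thesis using fun_cong[OF F, of x] by simp
    qed
    have all: "\<bar>iter_deriv F vs x\<bar> \<le> L k" if "length vs = k" "k \<le> ?l" "\<forall>u\<in>set vs. norm u = 1" for vs x k
    proof (cases "vs = []")
      case True then show ?thesis using sup that by simp
    next
      case False then show ?thesis using bound[of vs x] Aw[of k] w(3)[of k] that by fastforce
    qed
    have hoelder: "\<bar>iter_deriv F vs x - iter_deriv F vs y\<bar> \<le> L\<beta> * norm (x - y) powr (\<beta> - real ?l)"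
      if vs: "length vs = ?l" "\<forall>u\<in>set vs. norm u = 1" for vs x y
    proof -
      let ?C = "if vs = [] then v else 0"
      let ?f = "\<lambda>x. iter_deriv F vs x - ?C"
      have f: "\<bar>?f x\<bar> \<le> A ?l" for x
      proof (cases "vs = []")
        case True
        have "\<bar>\<Sum>z\<in>S. - (v * a) * ?g ((1/h) *\<^sub>R (x - z))\<bar> \<le> A 0"
        proof (rule separated_sum_bound[OF S h(1)])
          fix u :: "real ^ 'd" and i assume "\<bar>u $ i\<bar> > 1"
          then show "- (v * a) * ?g u = 0"
            using profile_eq_0[OF q2 a(1) aq h(1) S less_imp_le] by auto
        next
          fix u :: "real ^ 'd"
          have "\<bar>- (v * a) * ?g u\<bar> = \<bar>v\<bar> * a * \<bar>?g u\<bar>" using a by (simp add: abs_mult)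
          also have "\<dots> \<le> A 0" unfolding A_def using B[OF a, of "[]" u] a by (auto intro!: mult_left_mono)
          finally show "\<bar>- (v * a) * ?g u\<bar> \<le> A 0" .
        qed
        then show ?thesis using True vs by (simp add: F_def)
      next
        case False
        then show ?thesis using bound[of vs x] vs by simp
      qed
      have lip: "\<bar>?f x - ?f y\<bar> \<le> A ?l / h * norm (x - y)" for x y
      proof -
        have d: "(iter_deriv F vs has_derivative frechet_derivative (iter_deriv F vs) (at x)) (at x)" for x
          using it(2)[where vs = vs and x = x] vs by (simp add: frechet_derivative_works)
        have "norm (iter_deriv F vs x - iter_deriv F vs y) \<le> A (Suc ?l) * norm (x - y)"
        proof (rule differentiable_bound[OF convex_UNIV])
          fix x show "(iter_deriv F vs has_derivative frechet_derivative (iter_deriv F vs) (at x)) (at x within UNIV)"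
            using d by simp
          interpret bounded_linear "frechet_derivative (iter_deriv F vs) (at x)"
            using d by (rule has_derivative_bounded_linear)
          show "onorm (frechet_derivative (iter_deriv F vs) (at x)) \<le> A (Suc ?l)"
          proof (rule onorm_le)
            fix u :: "real ^ 'd"
            show "norm (frechet_derivative (iter_deriv F vs) (at x) u) \<le> A (Suc ?l) * norm u"
            proof (cases "u = 0")
              case True show ?thesis unfolding True zero by simp
            next
              case False
              let ?e = "(1 / norm u) *\<^sub>R u"
              have "\<bar>iter_deriv F (?e # vs) x\<bar> \<le> A (length (?e # vs))"
                using vs False by (intro bound) auto
              then have "\<bar>(1 / norm u) * frechet_derivative (iter_deriv F vs) (at x) u\<bar> \<le> A (Suc ?l)"
                unfolding iter_deriv.simps scaleR real_scaleR_def using vs by (simp only: list.size add_0_right add_Suc_right)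
              then show ?thesis using False by (simp add: abs_mult field_simps)
            qed
          qed
        qed auto
        moreover have "A (Suc ?l) = A ?l / h" by (simp add: A_def)
        ultimately show ?thesis by simp
      qed
      have "\<bar>?f x - ?f y\<bar> \<le> 2 * A ?l * (norm (x - y) / h) powr (\<beta> - real ?l)"
        by (rule holder_interpolation[OF f lip h(1)]) (use ell in auto)
      also have "\<dots> = L 0 * B * c * norm (x - y) powr (\<beta> - real ?l)"
        unfolding Aeq using h by (simp add: powr_divide)
      also have "\<dots> \<le> L\<beta> * norm (x - y) powr (\<beta> - real ?l)"
        using cw w(2) by (intro mult_right_mono) auto
      finally show ?thesis by simp
    qed
    have "times_differentiable ?l F" unfolding times_differentiable_def using it(2) by auto
    then have main: "times_differentiable ?l F \<and>
        (\<forall>k\<le>?l. (SUP x. form_opnorm k (\<lambda>vs. iter_deriv F vs x)) \<le> ennreal (L k)) \<and>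
        (\<forall>x x'. form_opnorm ?l (\<lambda>vs. iter_deriv F vs x - iter_deriv F vs x')
                  \<le> ennreal (L\<beta> * norm (x - x') powr (\<beta> - real ?l)))"
      unfolding form_opnorm_def by (auto intro!: SUP_least ennreal_leI all hoelder)
    have zero: "times_differentiable ?l (\<lambda>_::real ^ 'd. 0) \<and>
        (\<forall>k\<le>?l. (SUP x::real ^ 'd. form_opnorm k (\<lambda>vs. iter_deriv (\<lambda>_. 0) vs x)) \<le> ennreal (L k)) \<and>
        (\<forall>x x'::real ^ 'd. form_opnorm ?l (\<lambda>vs. iter_deriv (\<lambda>_. 0) vs x - iter_deriv (\<lambda>_. 0) vs x')
                  \<le> ennreal (L\<beta> * norm (x - x') powr (\<beta> - real ?l)))"
      unfolding form_opnorm_def times_differentiable_def iter_deriv_zero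
      by (auto intro!: SUP_least)
    show "tilted_field i0 q v (c * h powr \<beta>) h S \<in> smooth_class \<beta> L L\<beta>"
      unfolding smooth_class_def mem_Collect_eq Let_def a_def[symmetric]
    proof
      fix j
      show "times_differentiable ?l (\<lambda>x. tilted_field i0 q v a h S x $ j) \<and>
        (\<forall>k\<le>?l. (SUP x. form_opnorm k (\<lambda>vs. iter_deriv (\<lambda>x. tilted_field i0 q v a h S x $ j) vs x)) \<le> ennreal (L k)) \<and>
        (\<forall>x x'. form_opnorm ?l (\<lambda>vs. iter_deriv (\<lambda>x. tilted_field i0 q v a h S x $ j) vs x
              - iter_deriv (\<lambda>x. tilted_field i0 q v a h S x $ j) vs x')
                  \<le> ennreal (L\<beta> * norm (x - x') powr (\<beta> - real ?l)))"
      proof (cases "j = i0")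
        case True
        show ?thesis unfolding True F by (rule main)
      next
        case False
        then have "(\<lambda>x. tilted_field i0 q v a h S x $ j) = (\<lambda>_. 0)" by (auto simp: tilted_field_def axis_def)
        then show ?thesis using zero by simp
      qed
    qed
  qed
qed

section \<open>Closeness of observation laws\<close>

lemma flow_field:
  assumes q: "q \<ge> 2" and a: "0 \<le> a" "a * (1 + 2 * real q) \<le> 1/2" and h: "h > 0"
    and S: "finite S" "separated h S"
  obtains p where "flow (tilted_field i0 q v a h S) x t = x + p *\<^sub>R axis i0 1"
    "p + phase i0 q a h S (x + p *\<^sub>R axis i0 1) = phase i0 q a h S x + t * v"
    "\<And>p'. p' + phase i0 q a h S (x + p' *\<^sub>R axis i0 1) = phase i0 q a h S x + t * v \<Longrightarrow> p' = p"
proof -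
  have f: "tilted_field i0 q v a h S = (\<lambda>x. axis i0 (v / (1 + tilt i0 q a h S x)))"
    by (simp add: tilted_field_def fun_eq_iff)
  show ?thesis
    by (rule flow_conjugate[OF DERIV_phase[OF q h] tilt_bound[OF q a h S] phase_bound[OF q a h S],
          where v = v and x = x and t = t]) (rule that[unfolded f])
qed

text \<open>
  Both flows are given by the scalar equation of the conjugation. If neither the start nor the drifted
  position is near the new cube, then the solution of the equation without the new bump avoids the cube (there
  the other bumps vanish, so the position would be the drifted one up to \<open>a * h\<close>). Hence it also solves the
  equation with the new bump.
\<close>
lemma flow_field_insert:
  assumes q: "q \<ge> 2" and a: "0 \<le> a" "a * (1 + 2 * real q) \<le> 1/2" and h: "h > 0"
    and S: "finite S" "separated h (insert z S)" "z \<notin> S"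
  shows flow_field_diff_le: "norm (flow (tilted_field i0 q v a h (insert z S)) x t - flow (tilted_field i0 q v a h S) x t) \<le> 4 * a * h"
    and flow_field_diff_eq_0: "(\<exists>i. 2 * h < \<bar>(x - z) $ i\<bar>) \<Longrightarrow>
      (\<exists>i. 2 * h < \<bar>(x - (z - (t * v) *\<^sub>R axis i0 1)) $ i\<bar>) \<Longrightarrow>
      flow (tilted_field i0 q v a h (insert z S)) x t = flow (tilted_field i0 q v a h S) x t"
proof -
  let ?e = "axis i0 1 :: real ^ 'a"
  let ?S' = "insert z S"
  have S': "finite ?S'" using S by simp
  have sep: "separated h S" using S(2) by (rule separated_subset) auto
  obtain p where p: "flow (tilted_field i0 q v a h S) x t = x + p *\<^sub>R ?e"
    "p + phase i0 q a h S (x + p *\<^sub>R ?e) = phase i0 q a h S x + t * v"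
    by (rule flow_field[OF q a h S(1) sep, of i0 v x t]) blast
  obtain p' where p': "flow (tilted_field i0 q v a h ?S') x t = x + p' *\<^sub>R ?e"
    "p' + phase i0 q a h ?S' (x + p' *\<^sub>R ?e) = phase i0 q a h ?S' x + t * v"
    "\<And>r. r + phase i0 q a h ?S' (x + r *\<^sub>R ?e) = phase i0 q a h ?S' x + t * v \<Longrightarrow> r = p'"
    by (rule flow_field[OF q a h S' S(2), of i0 v x t]) blast
  note bound = phase_bound[OF q a h S(1) sep, of i0] phase_bound[OF q a h S' S(2), of i0]
  have "\<bar>p' - p\<bar> \<le> 4 * a * h"
    using p(2) p'(2) bound[of x] bound(1)[of "x + p *\<^sub>R ?e"] bound(2)[of "x + p' *\<^sub>R ?e"] by linarith
  moreover have "flow (tilted_field i0 q v a h ?S') x t - flow (tilted_field i0 q v a h S) x t = (p' - p) *\<^sub>R ?e"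
    unfolding p(1) p'(1) by (simp add: algebra_simps)
  ultimately show "norm (flow (tilted_field i0 q v a h ?S') x t - flow (tilted_field i0 q v a h S) x t) \<le> 4 * a * h"
    by simp
  assume far: "\<exists>i. 2 * h < \<bar>(x - z) $ i\<bar>" "\<exists>i. 2 * h < \<bar>(x - (z - (t * v) *\<^sub>R ?e)) $ i\<bar>"
  have phase_eq: "phase i0 q a h ?S' y = phase i0 q a h S y" if off: "\<exists>i. h < \<bar>(y - z) $ i\<bar>" for y
  proof -
    obtain i where "h < \<bar>(y - z) $ i\<bar>" using off ..
    then have "\<bar>((1/h) *\<^sub>R (y - z)) $ i\<bar> \<ge> 1" using h by (simp add: abs_mult field_simps)
    from bump_slope_eq_0(1)[OF q this] show ?thesis using S by (simp add: phase_def)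
  qed
  have phase_0: "phase i0 q a h S y = 0" if near: "\<not> (\<exists>i. h < \<bar>(y - z) $ i\<bar>)" for y
    unfolding phase_def
  proof (rule sum.neutral, rule ballI)
    fix w assume w: "w \<in> S"
    have "\<bar>((1/h) *\<^sub>R (y - z)) $ i\<bar> \<le> 1" for i
      using near h by (auto simp: abs_mult field_simps not_less)
    from separated_active[OF S(2) h, of z w y] w S(3) this
    obtain i where "\<bar>((1/h) *\<^sub>R (y - w)) $ i\<bar> > 1" by blast
    from bump_slope_eq_0(1)[OF q less_imp_le[OF this]] show "a * h * bump i0 q ((1/h) *\<^sub>R (y - w)) = 0" by simp
  qed
  have ah: "a * h \<le> h"
  proof -
    have "a * 1 \<le> a * (1 + 2 * real q)" using a by (intro mult_left_mono) auto
    then have "a \<le> 1" using a by simp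
    then show ?thesis using h by (simp add: mult_le_cancel_right1)
  qed
  have "\<exists>i. h < \<bar>(x + p *\<^sub>R ?e - z) $ i\<bar>"
  proof (rule ccontr)
    assume near: "\<not> ?thesis"
    then have pe: "p = phase i0 q a h S x + t * v" using p(2) phase_0 by simp
    obtain i where i: "2 * h < \<bar>(x - (z - (t * v) *\<^sub>R ?e)) $ i\<bar>" using far(2) ..
    have "\<bar>(x + p *\<^sub>R ?e - z) $ i\<bar> \<le> h" using near by (meson not_le)
    moreover have "\<bar>(p - t * v) * ?e $ i\<bar> \<le> h"
      using order.trans[OF bound(1)[of x] ah] pe h by (auto simp: axis_def)
    ultimately show False using i by (simp add: algebra_simps) 
  qed
  then have "phase i0 q a h ?S' (x + p *\<^sub>R ?e) = phase i0 q a h S (x + p *\<^sub>R ?e)" by (rule phase_eq)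
  moreover have "\<exists>i. h < \<bar>(x - z) $ i\<bar>"
  proof -
    obtain i where "2 * h < \<bar>(x - z) $ i\<bar>" using far(1) ..
    then have "h < \<bar>(x - z) $ i\<bar>" using h by linarith
    then show ?thesis ..
  qed
  then have "phase i0 q a h ?S' x = phase i0 q a h S x" by (rule phase_eq)
  ultimately have "p = p'" using p(2) by (intro p'(3)) simp
  then show "flow (tilted_field i0 q v a h ?S') x t = flow (tilted_field i0 q v a h S) x t" using p(1) p'(1) by simp
qed

lemma norm_less_of_components:
  fixes y :: "real ^ 'd::finite"
  assumes "h > 0" "\<not> (\<exists>i. 2 * h < \<bar>y $ i\<bar>)"
  shows "norm y < 3 * real CARD('d) * h"
proof -
  have "norm y \<le> (\<Sum>i\<in>UNIV. \<bar>y $ i\<bar>)" by (rule norm_le_l1_cart)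
  also have "\<dots> \<le> (\<Sum>i\<in>(UNIV :: 'd set). 2 * h)" using assms by (intro sum_mono) (meson not_le)
  also have "\<dots> = real CARD('d) * (2 * h)" by simp
  also have "\<dots> < 3 * real CARD('d) * h" using assms(1) by simp
  finally show ?thesis .
qed

lemma cover_card:
  fixes x :: "nat \<Rightarrow> real ^ 'd::finite"
  assumes "cover C m x" "z \<in> unit_cube" "r > 0" "m \<ge> 1"
  shows "real (card {j\<in>{1..m}. norm (x j - z) < r}) \<le> max 1 (real m * (C * r ^ CARD('d)))"
proof -
  have "real (card {j\<in>{1..m}. norm (x j - z) < r}) / real m \<le> max (1 / real m) (C * r ^ CARD('d))"
    using assms unfolding cover_def by blast
  then have "real (card {j\<in>{1..m}. norm (x j - z) < r}) \<le> max (1 / real m) (C * r ^ CARD('d)) * real m"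
    using assms(4) by (simp add: pos_divide_le_eq)
  also have "\<dots> = max 1 (real m * (C * r ^ CARD('d)))"
    using assms(4) by (subst max_mult_distrib_right) (simp add: mult_ac)
  finally show ?thesis .
qed

lemma indicator_sum_eq: "finite I \<Longrightarrow> (\<Sum>i\<in>I. indicator B i) = real (card (I \<inter> B))"
  by (simp add: indicator_def sum.If_cases)

text \<open>
  An observation with index \<open>i\<close> is affected only if the trajectory starts near \<open>z\<close> or near \<open>z\<close> shifted back by
  the drift during \<open>i\<close> time steps. Each of these at most \<open>2 * nmax\<close> conditions holds for few trajectories by the
  covering condition, and an affected observation moves by at most \<open>4 * a * h\<close>.
\<close>
lemma kl_close_insert:
  fixes x :: "nat \<Rightarrow> real ^ 'd::finite" and P :: "(real ^ 'd) measure"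
  assumes q: "q \<ge> 2" and a: "0 \<le> a" "a * (1 + 2 * real q) \<le> 1/2" and h: "h > 0"
    and S: "finite S" "separated h (insert z S)" "z \<notin> S"
    and m: "m \<ge> 1" and n: "\<And>j. j \<in> {1..m} \<Longrightarrow> n j \<le> nmax"
    and t: "\<And>j i. j \<in> {1..m} \<Longrightarrow> i \<le> n j \<Longrightarrow> t j i = real i * \<Delta>"
    and P: "centered_noise P" "noise_condition C P" "C \<ge> 0" and cov: "cover Ccvr m x"
    and z: "z \<in> unit_cube" "\<And>i. i \<le> nmax \<Longrightarrow> z - (real i * \<Delta> * v) *\<^sub>R axis i0 1 \<in> unit_cube"
  shows "kl_close (C * (4 * a * h)\<^sup>2 * (2 * real nmax * max 1 (real m * (Ccvr * (3 * real CARD('d) * h) ^ CARD('d)))))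
    (obs_law m n t x P (tilted_field i0 q v a h (insert z S))) (obs_law m n t x P (tilted_field i0 q v a h S))"
proof (rule kl_close_obs_law[OF P(1,2)])
  let ?I = "obs_index m n"
  let ?r = "3 * real CARD('d) * h"
  let ?M = "max 1 (real m * (Ccvr * ?r ^ CARD('d)))"
  let ?c = "\<lambda>i. z - (real i * \<Delta> * v) *\<^sub>R axis i0 1"
  let ?N = "\<lambda>y. {j\<in>{1..m}. norm (x j - y) < ?r}"
  let ?d = "\<lambda>ji. norm (flow (tilted_field i0 q v a h (insert z S)) (x (fst ji)) (t (fst ji) (snd ji)) -
      flow (tilted_field i0 q v a h S) (x (fst ji)) (t (fst ji) (snd ji)))"
  let ?B = "(?N z \<times> {1..nmax}) \<union> (\<Union>i\<in>{1..nmax}. ?N (?c i) \<times> {i})"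
  have r: "?r > 0" using h by simp
  have finB: "finite ?B" by auto
  have zero: "?d ji = 0" if ji: "ji \<in> ?I" "ji \<notin> ?B" for ji
  proof -
    obtain j i where [simp]: "ji = (j, i)" by (cases ji)
    have j: "j \<in> {1..m}" and i: "i \<in> {1..n j}" using ji by (auto simp: obs_index_def)
    then have i': "i \<in> {1..nmax}" using n[OF j] by simp
    have "\<not> norm (x j - z) < ?r" using ji(2) j i' by auto
    then have 1: "\<exists>k. 2 * h < \<bar>(x j - z) $ k\<bar>" using norm_less_of_components[OF h, of "x j - z"] by blast
    have "\<not> norm (x j - ?c i) < ?r" using ji(2) j i' by auto
    then have 2: "\<exists>k. 2 * h < \<bar>(x j - ?c i) $ k\<bar>" using norm_less_of_components[OF h, of "x j - ?c i"] by blast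
    have "t j i = real i * \<Delta>" using t[OF j] i by simp
    then show ?thesis using flow_field_diff_eq_0[OF q a h S 1, of "t j i" v i0] 2 by simp
  qed
  have le: "C * (?d ji)\<^sup>2 \<le> C * (4 * a * h)\<^sup>2 * indicator ?B ji" if "ji \<in> ?I" for ji
  proof (cases "ji \<in> ?B")
    case True
    have "(?d ji)\<^sup>2 \<le> (4 * a * h)\<^sup>2"
      by (intro power_mono flow_field_diff_le[OF q a h S]) auto
    then show ?thesis using True P(3) by (simp add: mult_left_mono)
  next
    case False
    then show ?thesis using zero[OF that False] by simp
  qed
  have "card ?B \<le> card (?N z \<times> {1..nmax}) + card (\<Union>i\<in>{1..nmax}. ?N (?c i) \<times> {i})" by (rule card_Un_le)
  also have "card (\<Union>i\<in>{1..nmax}. ?N (?c i) \<times> {i}) \<le> (\<Sum>i\<in>{1..nmax}. card (?N (?c i) \<times> {i}))"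
    by (rule card_UN_le) simp
  finally have "real (card ?B) \<le> real (card (?N z)) * real nmax + (\<Sum>i\<in>{1..nmax}. real (card (?N (?c i))))"
    by (simp add: card_cartesian_product flip: of_nat_mult of_nat_sum of_nat_add)
  also have "\<dots> \<le> ?M * real nmax + (\<Sum>i\<in>{1..nmax}. ?M)"
    by (intro add_mono mult_right_mono sum_mono cover_card[OF cov _ r m] z) auto
  finally have card: "real (card ?B) \<le> 2 * real nmax * ?M" by (simp add: algebra_simps)
  have "(\<Sum>ji\<in>?I. C * (?d ji)\<^sup>2) \<le> (\<Sum>ji\<in>?I. C * (4 * a * h)\<^sup>2 * indicator ?B ji)"
    by (rule sum_mono[OF le])
  also have "\<dots> = C * (4 * a * h)\<^sup>2 * real (card (?I \<inter> ?B))"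
    by (simp only: sum_distrib_left[symmetric] indicator_sum_eq[OF finite_obs_index])
  also have "\<dots> \<le> C * (4 * a * h)\<^sup>2 * real (card ?B)"
    using P(3) finB by (intro mult_left_mono) (auto intro!: card_mono)
  also have "\<dots> \<le> C * (4 * a * h)\<^sup>2 * (2 * real nmax * ?M)"
    using P(3) card by (intro mult_left_mono) auto
  finally show "(\<Sum>ji\<in>?I. C * (?d ji)\<^sup>2) \<le> C * (4 * a * h)\<^sup>2 * (2 * real nmax * ?M)" .
qed

section \<open>Testing bounds\<close>

text \<open>
  Two laws that are close cannot be told apart: if the losses under the two hypotheses never are both
  small, then the sum of the risks is bounded below.
\<close>
lemma two_point_bound:
  fixes u w :: "'a \<Rightarrow> ennreal"
  assumes P: "prob_space P" and Q: "prob_space Q" and s: "sets P = sets Q" and cl: "kl_close 1 P Q"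
    and u[measurable]: "u \<in> borel_measurable P" and w[measurable]: "w \<in> borel_measurable Q"
    and c: "c \<ge> 0" and sum: "\<And>y. y \<in> space P \<Longrightarrow> ennreal c \<le> u y + w y"
  shows "ennreal (c * exp (- 8) / 4) \<le> (\<integral>\<^sup>+y. u y \<partial>P) + (\<integral>\<^sup>+y. w y \<partial>Q)"
proof -
  interpret P: prob_space P by fact
  interpret Q: prob_space Q by fact
  define A where "A = {y\<in>space Q. ennreal (c/2) \<le> w y}"
  have AQ[measurable]: "A \<in> sets Q" unfolding A_def by measurable
  have AP[measurable]: "A \<in> sets P" using s by simp
  have sp: "space P = space Q" using s by (rule sets_eq_imp_space_eq)
  have "measure P A \<le> exp 8 * measure Q A + (1 + 1) / 8"
    using cl AP unfolding kl_close_def by (metis zero_less_numeral)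
  then have "3/4 \<le> measure P (space P - A) + exp 8 * measure Q A"
    using P.prob_compl[OF AP] by simp
  also have "\<dots> \<le> exp 8 * (measure P (space P - A) + measure Q A)"
    using mult_right_mono[of 1 "exp 8 :: real" "measure P (space P - A)"] by (simp add: algebra_simps)
  finally have "exp (-8) * (3/4) \<le> exp (-8) * (exp 8 * (measure P (space P - A) + measure Q A))"
    by (intro mult_left_mono) auto
  moreover have "exp (-8) * (exp 8 * r) = r" for r :: real by (simp flip: mult.assoc exp_add)
  ultimately have mass: "exp (-8) / 2 \<le> measure P (space P - A) + measure Q A"
    using exp_gt_zero[of "-8 :: real"] by (simp only:)
  have "ennreal (c/2) * emeasure P (space P - A) = (\<integral>\<^sup>+y. ennreal (c/2) * indicator (space P - A) y \<partial>P)"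
    by (subst nn_integral_cmult_indicator) auto
  also have "\<dots> \<le> (\<integral>\<^sup>+y. u y \<partial>P)"
  proof (intro nn_integral_mono)
    fix y assume y: "y \<in> space P"
    have "ennreal (c/2) \<le> u y" if "y \<notin> A"
    proof (rule ccontr)
      assume "\<not> ennreal (c/2) \<le> u y"
      moreover have "w y < ennreal (c/2)" using that y sp by (auto simp: A_def)
      ultimately have "u y + w y < ennreal (c/2) + ennreal (c/2)" by (intro add_strict_mono) auto
      also have "\<dots> = ennreal c" using c by (simp flip: ennreal_plus)
      finally show False using sum[OF y] by simp
    qed
    then show "ennreal (c/2) * indicator (space P - A) y \<le> u y" by (auto split: split_indicator)
  qed
  finally have 1: "ennreal (c/2 * measure P (space P - A)) \<le> (\<integral>\<^sup>+y. u y \<partial>P)"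
    using c by (simp add: P.emeasure_eq_measure flip: ennreal_mult)
  have "ennreal (c/2) * emeasure Q A = (\<integral>\<^sup>+y. ennreal (c/2) * indicator A y \<partial>Q)"
    by (subst nn_integral_cmult_indicator) auto
  also have "\<dots> \<le> (\<integral>\<^sup>+y. w y \<partial>Q)"
    by (intro nn_integral_mono) (auto simp: A_def split: split_indicator)
  finally have 2: "ennreal (c/2 * measure Q A) \<le> (\<integral>\<^sup>+y. w y \<partial>Q)"
    using c by (simp add: Q.emeasure_eq_measure flip: ennreal_mult)
  have "c * exp (- 8) / 4 = c/2 * (exp (-8) / 2)" by simp
  also have "\<dots> \<le> c/2 * (measure P (space P - A) + measure Q A)" using mass c by (intro mult_left_mono) auto
  finally have "ennreal (c * exp (- 8) / 4) \<le> ennreal (c/2 * measure P (space P - A) + c/2 * measure Q A)"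
    by (intro ennreal_leI) (simp only: distrib_left)
  also have "\<dots> = ennreal (c/2 * measure P (space P - A)) + ennreal (c/2 * measure Q A)"
    using c by (intro ennreal_plus) auto
  also have "\<dots> \<le> (\<integral>\<^sup>+y. u y \<partial>P) + (\<integral>\<^sup>+y. w y \<partial>Q)" by (rule add_mono[OF 1 2])
  finally show ?thesis .
qed

text \<open>
  If every event \<open>B z\<close> had probability above \<open>1/2\<close> under its own law, then, with \<open>\<tau> = 4 * (K + 1)\<close>, each would
  carry at least \<open>exp (- \<tau>) / 4\<close> of the mass of \<open>Q\<close>. Disjoint events cannot do this for too many \<open>z\<close>.
\<close>
lemma many_hypotheses:
  assumes Z: "finite Z" and Q: "prob_space Q" and s: "\<And>z. z \<in> Z \<Longrightarrow> sets (P z) = sets Q"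
    and cl: "\<And>z. z \<in> Z \<Longrightarrow> kl_close K (P z) Q" and K: "K \<ge> 0"
    and B: "\<And>z. z \<in> Z \<Longrightarrow> B z \<in> sets Q" "disjoint_family_on B Z"
    and card: "real (card Z) \<ge> 4 * exp (4 * (K + 1))"
  shows "\<exists>z\<in>Z. measure (P z) (B z) \<le> 1/2"
proof (rule ccontr)
  interpret Q: prob_space Q by fact
  assume contra: "\<not> ?thesis"
  have "1/4 < exp (4 * (K + 1)) * measure Q (B z)" if z: "z \<in> Z" for z
  proof -
    have "measure (P z) (B z) \<le> exp (4 * (K + 1)) * measure Q (B z) + (K + 1) / (4 * (K + 1))"
      using cl[OF z] B(1)[OF z] s[OF z] K unfolding kl_close_def by auto
    moreover have "measure (P z) (B z) > 1/2" using contra z by force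
    moreover have "(K + 1) / (4 * (K + 1)) = 1/4" using K by (simp add: field_simps)
    ultimately show ?thesis by linarith
  qed
  moreover have "Z \<noteq> {}" using card by (auto simp: not_le)
  ultimately have "(\<Sum>z\<in>Z. 1/4) < (\<Sum>z\<in>Z. exp (4 * (K + 1)) * measure Q (B z))"
    using Z by (intro sum_strict_mono) auto
  also have "\<dots> = exp (4 * (K + 1)) * measure Q (\<Union>z\<in>Z. B z)"
    using Z B by (subst Q.finite_measure_finite_Union) (auto simp: sum_distrib_left)
  also have "\<dots> \<le> exp (4 * (K + 1)) * 1" by (intro mult_left_mono) auto
  finally show False using card by simp
qed

text \<open>
  Averaging over all subsets of \<open>Z\<close> and pairing \<open>S\<close> with \<open>insert z S\<close> separately for every \<open>z\<close>.
\<close>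
lemma assouad:
  fixes r :: "'z \<Rightarrow> 'z set \<Rightarrow> ennreal"
  assumes Z: "finite Z"
    and pair: "\<And>z S. z \<in> Z \<Longrightarrow> S \<subseteq> Z - {z} \<Longrightarrow> c \<le> r z S + r z (insert z S)"
    and X: "\<And>S. S \<subseteq> Z \<Longrightarrow> (\<Sum>z\<in>Z. r z S) \<le> X"
  shows "of_nat (card Z) * c \<le> 2 * X"
proof (cases "Z = {}")
  case False
  define N :: nat where "N = 2 ^ (card Z - 1)"
  have N2: "2 ^ card Z = 2 * N" using False Z unfolding N_def by (cases "card Z") auto
  have split: "(\<Sum>S\<in>Pow Z. f S) = (\<Sum>S\<in>Pow (Z - {z}). f S + f (insert z S))"
    if z: "z \<in> Z" for z and f :: "'z set \<Rightarrow> ennreal"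
  proof -
    have "Pow Z = Pow (Z - {z}) \<union> insert z ` Pow (Z - {z})"
      using z by (simp flip: Pow_insert add: insert_absorb)
    moreover have "Pow (Z - {z}) \<inter> insert z ` Pow (Z - {z}) = {}" by auto
    moreover have "inj_on (insert z) (Pow (Z - {z}))" by (auto simp: inj_on_def)
    ultimately show ?thesis using Z by (simp add: sum.union_disjoint sum.reindex sum.distrib)
  qed
  have "of_nat N * (of_nat (card Z) * c) = (\<Sum>z\<in>Z. \<Sum>S\<in>Pow (Z - {z}). c)"
    using Z by (simp add: card_Pow N_def mult_ac)
  also have "\<dots> \<le> (\<Sum>z\<in>Z. \<Sum>S\<in>Pow (Z - {z}). r z S + r z (insert z S))"
    by (intro sum_mono pair) auto
  also have "\<dots> = (\<Sum>z\<in>Z. \<Sum>S\<in>Pow Z. r z S)"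
    by (intro sum.cong refl split[symmetric])
  also have "\<dots> = (\<Sum>S\<in>Pow Z. \<Sum>z\<in>Z. r z S)" by (rule sum.swap)
  also have "\<dots> \<le> (\<Sum>S\<in>Pow Z. X)" by (intro sum_mono X) auto
  also have "\<dots> = of_nat N * (2 * X)" using Z N2 by (simp add: card_Pow mult_ac flip: of_nat_power)
  finally have "of_nat N * (of_nat (card Z) * c) \<le> of_nat N * (2 * X)" .
  moreover have "(of_nat N :: ennreal) \<noteq> 0" "(of_nat N :: ennreal) \<noteq> \<top>" by (simp add: N_def) simp
  ultimately show ?thesis using ennreal_mult_le_mult_iff[of "of_nat N"] by blast
qed simp

lemma minimax_riskI:
  assumes "\<And>fh X. fh \<in> E \<Longrightarrow> (\<And>f. f \<in> F \<Longrightarrow> (\<integral>\<^sup>+y. loss (fh y) f \<partial>law f) \<le> X) \<Longrightarrow> c \<le> X"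
  shows "c \<le> minimax_risk E F law loss"
  unfolding minimax_risk_def by (intro INF_greatest assms) (auto intro: SUP_upper2)

lemma sq_norm_triangle:
  fixes g f f' :: "'a::real_inner"
  shows "(norm (f' - f))\<^sup>2 / 2 \<le> (norm (g - f'))\<^sup>2 + (norm (g - f))\<^sup>2"
proof -
  have "norm (f' - f) \<le> norm (g - f') + norm (g - f)"
    using norm_triangle_ineq4[of "g - f" "g - f'"] by (simp add: add.commute)
  then have "(norm (f' - f))\<^sup>2 \<le> (norm (g - f') + norm (g - f))\<^sup>2" by (intro power_mono) auto
  also have "\<dots> \<le> 2 * ((norm (g - f'))\<^sup>2 + (norm (g - f))\<^sup>2)" 
    using zero_le_power2[of "norm (g - f') - norm (g - f)"] by (simp add: power2_eq_square algebra_simps)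
  finally show ?thesis by simp
qed

section \<open>Risk at a point and uniform risk\<close>

lemma norm_axis_real: "norm (axis i0 r :: real ^ 'd::finite) = \<bar>r\<bar>"
proof -
  have "axis i0 r = r *\<^sub>R (axis i0 1 :: real ^ 'd)" by (simp add: vec_eq_iff axis_def)
  then show ?thesis by simp
qed

text \<open>
  Inside the cube of \<open>z\<close> all other bumps vanish, so the two drifts are \<open>v / (1 + a s)\<close> and \<open>v\<close>.
\<close>
lemma field_gap:
  assumes q: "q \<ge> 2" and a: "0 \<le> a" "a * (1 + 2 * real q) \<le> 1/2" and h: "h > 0"
    and S: "finite S" "separated h (insert z S)" "z \<notin> S"
    and y: "\<And>i. \<bar>((1/h) *\<^sub>R (y - z)) $ i\<bar> \<le> 1" and s: "slope i0 q ((1/h) *\<^sub>R (y - z)) \<ge> 1/2"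
  shows "\<bar>v\<bar> * a / 4 \<le> norm (tilted_field i0 q v a h (insert z S) y - tilted_field i0 q v a h S y)"
proof -
  let ?s = "slope i0 q ((1/h) *\<^sub>R (y - z))"
  have 0: "tilt i0 q a h S y = 0"
    unfolding tilt_def
  proof (rule sum.neutral, rule ballI)
    fix w assume w: "w \<in> S"
    from separated_active[OF S(2) h, of z w y] w S(3) y
    obtain i where "\<bar>((1/h) *\<^sub>R (y - w)) $ i\<bar> > 1" by blast
    from bump_slope_eq_0(2)[OF q less_imp_le[OF this]] show "a * slope i0 q ((1/h) *\<^sub>R (y - w)) = 0" by simp
  qed
  have 1: "tilt i0 q a h (insert z S) y = a * ?s"
    using 0 S by (simp add: tilt_def)
  have as: "\<bar>a * ?s\<bar> \<le> 1/2" by (rule slope_small[OF q a])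
  have "tilted_field i0 q v a h (insert z S) y - tilted_field i0 q v a h S y = axis i0 (v / (1 + a * ?s) - v)"
    unfolding tilted_field_def 0 1 by (simp add: vec_eq_iff axis_def)
  also have "v / (1 + a * ?s) - v = - (v * (a * ?s / (1 + a * ?s)))"
    using as by (simp add: field_simps)
  finally have eq: "norm (tilted_field i0 q v a h (insert z S) y - tilted_field i0 q v a h S y) = \<bar>v\<bar> * (a * ?s / (1 + a * ?s))"
    using as a s by (simp add: abs_mult norm_axis_real)
  have "a / 4 \<le> a * ?s / (1 + a * ?s)"
  proof -
    have "a / 4 * (1 + a * ?s) \<le> a / 4 * 2" using as a by (intro mult_left_mono) auto
    also have "\<dots> \<le> a * ?s" using a s mult_left_mono[of "1/2" ?s a] by simp
    finally show ?thesis using as by (subst pos_le_divide_eq) auto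
  qed
  from mult_left_mono[OF this abs_ge_zero[of v]] show ?thesis unfolding eq by simp
qed

lemma field_gap_center:
  assumes q: "q \<ge> 2" and a: "0 \<le> a" "a * (1 + 2 * real q) \<le> 1/2" and h: "h > 0"
    and S: "finite S" "separated h (insert z S)" "z \<notin> S"
  shows "\<bar>v\<bar> * a / 4 \<le> norm (tilted_field i0 q v a h (insert z S) z - tilted_field i0 q v a h S z)"
  by (rule field_gap[OF assms]) (use slope_0[OF q, of i0] in auto)

lemma pointwise_risk_bound:
  fixes x0 :: "real ^ 'd::finite"
  assumes q: "q \<ge> 2" and a: "0 \<le> a" "a * (1 + 2 * real q) \<le> 1/2" and h: "h > 0"
    and F: "tilted_field i0 q v a h {} \<in> F" "tilted_field i0 q v a h {x0} \<in> F"
    and law: "\<And>f. prob_space (law f)" "\<And>f. sets (law f) = sets (obs_space m n)"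
    and close: "kl_close 1 (law (tilted_field i0 q v a h {x0})) (law (tilted_field i0 q v a h {}))"
  shows "ennreal ((v * a)\<^sup>2 * exp (- 8) / 256) \<le>
    minimax_risk (estimators m n) F law (\<lambda>g f. ennreal ((norm (g x0 - f x0))\<^sup>2))"
proof (rule minimax_riskI)
  fix fh :: "(nat \<times> nat \<Rightarrow> real ^ 'd) \<Rightarrow> real ^ 'd \<Rightarrow> real ^ 'd" and X
  let ?f0 = "tilted_field i0 q v a h {}" and ?f1 = "tilted_field i0 q v a h {x0}"
  let ?l = "\<lambda>f y. ennreal ((norm (fh y x0 - f x0))\<^sup>2)"
  assume "fh \<in> estimators m n"
  then have m: "(\<lambda>y. fh y x0) \<in> borel_measurable (obs_space m n)" by (auto simp: estimators_def)
  have [measurable]: "(\<lambda>y. fh y x0) \<in> borel_measurable (law f)" for f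
    using m by (simp only: measurable_cong_sets[OF law(2) refl])
  assume X: "\<And>f. f \<in> F \<Longrightarrow> (\<integral>\<^sup>+ y. ?l f y \<partial>law f) \<le> X"
  \<comment> \<open>By \<open>sq_norm_triangle\<close>, half of the squared gap is the least sum of the two losses.\<close>
  define c where "c = (\<bar>v\<bar> * a / 4)\<^sup>2 / 2"
  have c: "c \<ge> 0" by (simp add: c_def)
  have gap: "\<bar>v\<bar> * a / 4 \<le> norm (?f1 x0 - ?f0 x0)"
    using field_gap_center[OF q a h, of "{}" x0 v i0] by (simp add: separated_def)
  have "ennreal (c * exp (-8) / 4) \<le> (\<integral>\<^sup>+y. ?l ?f1 y \<partial>law ?f1) + (\<integral>\<^sup>+y. ?l ?f0 y \<partial>law ?f0)"
  proof (rule two_point_bound[OF law(1) law(1) _ close _ _ c])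
    fix y
    have "c \<le> (norm (?f1 x0 - ?f0 x0))\<^sup>2 / 2"
      unfolding c_def using gap a by (intro divide_right_mono power_mono) auto
    also have "\<dots> \<le> (norm (fh y x0 - ?f1 x0))\<^sup>2 + (norm (fh y x0 - ?f0 x0))\<^sup>2" by (rule sq_norm_triangle)
    finally show "ennreal c \<le> ?l ?f1 y + ?l ?f0 y" by (simp flip: ennreal_plus add: ennreal_leI)
  qed (use law(2) in auto)
  also have "\<dots> \<le> X + X" by (intro add_mono X F)
  finally have le: "ennreal (c * exp (-8) / 4) \<le> X + X" .
  have "(v * a)\<^sup>2 * exp (- 8) / 256 = c * exp (-8) / 4 / 2"
    by (simp add: c_def power_mult_distrib power_divide)
  then have "ennreal ((v * a)\<^sup>2 * exp (- 8) / 256) * 2 = ennreal (c * exp (-8) / 4)"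
    using c by (simp add: ennreal_mult_cancel_left flip: ennreal_mult ennreal_numeral)
  also have "\<dots> \<le> X * 2" using le by (simp add: mult_2_right)
  finally show "ennreal ((v * a)\<^sup>2 * exp (- 8) / 256) \<le> X"
    using ennreal_mult_le_mult_iff[of 2 "ennreal ((v * a)\<^sup>2 * exp (- 8) / 256)" X] by (simp add: mult.commute)
qed

text \<open>
  If the estimator is within \<open>\<delta> / 2\<close> of the field with the bump at \<open>z\<close> at all centres, it identifies \<open>z\<close>. These
  events are disjoint, and the loss is large outside of them. Restricting the supremum to the finitely many
  centres also removes the question of its measurability.
\<close>
lemma uniform_risk_bound:
  fixes Z :: "(real ^ 'd::finite) set"
  assumes q: "q \<ge> 2" and a: "0 \<le> a" "a * (1 + 2 * real q) \<le> 1/2" and h: "h > 0"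
    and Z: "finite Z" "separated h Z" "Z \<subseteq> unit_cube"
    and F: "\<And>z. z \<in> Z \<Longrightarrow> tilted_field i0 q v a h {z} \<in> F"
    and law: "\<And>f. prob_space (law f)" "\<And>f. sets (law f) = sets (obs_space m n)"
    and close: "\<And>z. z \<in> Z \<Longrightarrow> kl_close K (law (tilted_field i0 q v a h {z})) (law (tilted_field i0 q v a h {}))"
    and K: "K \<ge> 0" and card: "real (card Z) \<ge> 4 * exp (4 * (K + 1))"
  shows "ennreal ((v * a)\<^sup>2 / 128) \<le>
    minimax_risk (estimators m n) F law (\<lambda>g f. SUP z\<in>unit_cube. ennreal ((norm (g z - f z))\<^sup>2))"
proof (rule minimax_riskI)
  fix fh :: "(nat \<times> nat \<Rightarrow> real ^ 'd) \<Rightarrow> real ^ 'd \<Rightarrow> real ^ 'd" and X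
  let ?f = "\<lambda>z. tilted_field i0 q v a h {z}" and ?base = "tilted_field i0 q v a h {}"
  let ?l = "\<lambda>f y. SUP z\<in>unit_cube. ennreal ((norm (fh y z - f z))\<^sup>2)"
  assume "fh \<in> estimators m n"
  then have m[measurable]: "(\<lambda>y. fh y z) \<in> borel_measurable (obs_space m n)" for z by (auto simp: estimators_def)
  assume X: "\<And>f. f \<in> F \<Longrightarrow> (\<integral>\<^sup>+ y. ?l f y \<partial>law f) \<le> X"
  define \<delta> where "\<delta> = \<bar>v\<bar> * a / 4"
  have \<delta>0: "\<delta> \<ge> 0" using a by (simp add: \<delta>_def)
  define B where "B z = {y\<in>space (obs_space m n). \<forall>w\<in>Z. norm (fh y w - ?f z w) < \<delta> / 2}" for z
  have Bm: "B z \<in> sets (obs_space m n)" for z unfolding B_def using Z(1) by measurable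
  have other: "?f w z = ?base z" if zw: "z \<in> Z" "w \<in> Z" "z \<noteq> w" for z w
  proof -
    obtain i where "\<bar>((1/h) *\<^sub>R (z - w)) $ i\<bar> > 1"
      using separated_active[OF Z(2) h zw(1,2) zw(3)[symmetric], of z] by auto
    from bump_slope_eq_0(2)[OF q less_imp_le[OF this], of i0] show ?thesis by (simp add: tilted_field_def tilt_def)
  qed
  have disj: "disjoint_family_on B Z"
    unfolding disjoint_family_on_def
  proof (intro ballI impI)
    fix z w assume zw: "z \<in> Z" "w \<in> Z" "z \<noteq> w"
    show "B z \<inter> B w = {}"
    proof (rule ccontr)
      assume "B z \<inter> B w \<noteq> {}"
      then obtain y where "norm (fh y z - ?f z z) < \<delta> / 2" "norm (fh y z - ?f w z) < \<delta> / 2"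
        using zw by (auto simp: B_def)
      then have "norm (?f z z - ?f w z) < \<delta>"
        using norm_triangle_ineq4[of "fh y z - ?f w z" "fh y z - ?f z z"] by simp
      moreover have "\<delta> \<le> norm (?f z z - ?base z)"
        unfolding \<delta>_def using field_gap_center[OF q a h, of "{}" z v i0] by (simp add: separated_def)
      ultimately show False using other[OF zw] by simp
    qed
  qed
  obtain z where z: "z \<in> Z" "measure (law (?f z)) (B z) \<le> 1/2"
    using many_hypotheses[OF Z(1) law(1), of "\<lambda>z. law (?f z)" ?base K B] law(2) close K Bm disj card by blast
  interpret P: prob_space "law (?f z)" by (rule law(1))
  have Bz[measurable]: "B z \<in> sets (law (?f z))" using Bm law(2) by simp
  have sp: "space (law (?f z)) = space (obs_space m n)" using law(2) by (rule sets_eq_imp_space_eq)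
  have "(v * a)\<^sup>2 / 128 = (\<delta> / 2)\<^sup>2 * (1/2)" by (simp add: \<delta>_def power_mult_distrib power_divide)
  also have "\<dots> \<le> (\<delta> / 2)\<^sup>2 * measure (law (?f z)) (space (law (?f z)) - B z)"
    using z(2) P.prob_compl[OF Bz] by (intro mult_left_mono) auto
  finally have "ennreal ((v * a)\<^sup>2 / 128) \<le> ennreal ((\<delta> / 2)\<^sup>2) * emeasure (law (?f z)) (space (law (?f z)) - B z)"
    by (simp add: P.emeasure_eq_measure ennreal_leI flip: ennreal_mult)
  also have "\<dots> = (\<integral>\<^sup>+y. ennreal ((\<delta> / 2)\<^sup>2) * indicator (space (law (?f z)) - B z) y \<partial>law (?f z))"
    by (subst nn_integral_cmult_indicator) auto
  also have "\<dots> \<le> (\<integral>\<^sup>+ y. ?l (?f z) y \<partial>law (?f z))"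
  proof (intro nn_integral_mono)
    fix y assume y: "y \<in> space (law (?f z))"
    have "ennreal ((\<delta> / 2)\<^sup>2) \<le> ?l (?f z) y" if yB: "y \<notin> B z"
    proof -
      obtain w where w: "w \<in> Z" "\<delta> / 2 \<le> norm (fh y w - ?f z w)"
        using yB y sp unfolding B_def by (auto simp: not_less)
      then have "ennreal ((\<delta> / 2)\<^sup>2) \<le> ennreal ((norm (fh y w - ?f z w))\<^sup>2)"
        using \<delta>0 by (intro ennreal_leI power_mono) auto
      also have "\<dots> \<le> ?l (?f z) y" using w(1) Z(3) by (intro SUP_upper) auto
      finally show ?thesis .
    qed
    then show "ennreal ((\<delta> / 2)\<^sup>2) * indicator (space (law (?f z)) - B z) y \<le> ?l (?f z) y"
      by (auto split: split_indicator)
  qed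
  also have "\<dots> \<le> X" by (rule X[OF F[OF z(1)]])
  finally show "ennreal ((v * a)\<^sup>2 / 128) \<le> X" .
qed

lemma continuous_on_slope: "continuous_on UNIV (slope i0 q :: real ^ 'd::finite \<Rightarrow> real)"
  unfolding slope_def[abs_def] bump1_def by (intro continuous_intros)

lemma borel_measurable_field: "tilted_field i0 q v a h S \<in> borel_measurable borel"
proof -
  have [measurable]: "slope i0 q \<in> borel_measurable borel"
    by (intro borel_measurable_continuous_onI continuous_on_slope)
  have eq: "tilted_field i0 q v a h S = (\<lambda>x. (v / (1 + tilt i0 q a h S x)) *\<^sub>R axis i0 1)"
    by (auto simp: tilted_field_def fun_eq_iff vec_eq_iff axis_def)
  show ?thesis unfolding eq tilt_def by measurable
qed

text \<open>
  By continuity the slope stays near its value 1 at the centre; on this smaller cube the drifts differ by a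
  definite amount.
\<close>
lemma slope_ge_half:
  assumes "q \<ge> 2"
  obtains \<rho> where "0 < \<rho>" "\<rho> < 1" "\<And>u :: real ^ 'd::finite. (\<And>i. \<bar>u $ i\<bar> \<le> \<rho>) \<Longrightarrow> slope i0 q u \<ge> 1/2"
proof -
  have "isCont (slope i0 q) (0 :: real ^ 'd)"
    using continuous_on_slope[of i0 q] by (simp add: continuous_on_eq_continuous_at)
  then obtain e where e: "e > 0" "\<And>u :: real ^ 'd. norm u < e \<Longrightarrow> \<bar>slope i0 q u - 1\<bar> < 1/2"
    unfolding continuous_at_eps_delta using slope_0[OF assms, of i0]
    by (metis dist_0_norm dist_commute dist_real_def half_gt_zero_iff zero_less_one)
  define \<rho> where "\<rho> = min (1/2) (e / (2 * real CARD('d)))"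
  have "0 < \<rho>" "\<rho> < 1" using e by (auto simp: \<rho>_def)
  moreover have "slope i0 q u \<ge> 1/2" if u: "\<And>i. \<bar>u $ i\<bar> \<le> \<rho>" for u :: "real ^ 'd"
  proof -
    have "norm u \<le> (\<Sum>i\<in>UNIV. \<bar>u $ i\<bar>)" by (rule norm_le_l1_cart)
    also have "\<dots> \<le> (\<Sum>i\<in>(UNIV::'d set). e / (2 * real CARD('d)))"
      by (intro sum_mono order.trans[OF u]) (simp add: \<rho>_def)
    also have "\<dots> < e" using e by simp
    finally show ?thesis using e(2)[of u] by linarith
  qed
  ultimately show ?thesis using that by blast
qed

section \<open>Integrated risk, grids and sample sizes\<close>

lemma emeasure_cube:
  fixes z :: "real ^ 'd::finite"
  assumes "s \<ge> 0"
  shows "emeasure lborel {u. \<forall>i. \<bar>u $ i - z $ i\<bar> \<le> s} = ennreal ((2 * s) ^ CARD('d))"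
    and "{u. \<forall>i. \<bar>u $ i - z $ i\<bar> \<le> s} \<in> sets borel"
proof -
  let ?c = "\<chi> i. s :: real ^ 'd"
  have eq: "{u. \<forall>i. \<bar>u $ i - z $ i\<bar> \<le> s} = cbox (z - (\<chi> i. s)) (z + (\<chi> i. s))"
    by (auto simp: mem_box_cart abs_le_iff) (smt (verit))+
  have ip: "(z + (\<chi> i. s) - (z - (\<chi> i. s))) \<bullet> b = 2 * s"
    and le: "(z - (\<chi> i. s)) \<bullet> b \<le> (z + (\<chi> i. s)) \<bullet> b" if "b \<in> Basis" for b
    using that assms by (auto simp: Basis_vec_def inner_axis)
  have "emeasure lborel (cbox (z - (\<chi> i. s)) (z + (\<chi> i. s))) =
      ennreal (\<Prod>b\<in>Basis. (z + (\<chi> i. s) - (z - (\<chi> i. s))) \<bullet> b)"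
    by (rule emeasure_lborel_cbox[OF le])
  also have "(\<Prod>b\<in>Basis. (z + (\<chi> i. s) - (z - (\<chi> i. s))) \<bullet> b) = (\<Prod>b\<in>(Basis :: (real ^ 'd) set). 2 * s)"
    by (intro prod.cong refl ip)
  also have "\<dots> = (2 * s) ^ CARD('d)" by simp
  finally show "emeasure lborel {u. \<forall>i. \<bar>u $ i - z $ i\<bar> \<le> s} = ennreal ((2 * s) ^ CARD('d))"
    unfolding eq .
  show "{u. \<forall>i. \<bar>u $ i - z $ i\<bar> \<le> s} \<in> sets borel" unfolding eq by simp
qed

text \<open>
  The loss is at least the sum of its contributions from the cubes of half side \<open>\<rho> * h\<close>, and on every one of them
  the presence of the bump has to be tested; the contributions are combined by \<open>assouad\<close>.
\<close>
lemma integrated_risk_bound: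
  fixes Z :: "(real ^ 'd::finite) set"
  assumes q: "q \<ge> 2" and a: "0 \<le> a" "a * (1 + 2 * real q) \<le> 1/2" and h: "h > 0"
    and Z: "finite Z" "separated h Z"
    and \<rho>: "0 < \<rho>" "\<rho> < 1" "\<And>u :: real ^ 'd. (\<And>i. \<bar>u $ i\<bar> \<le> \<rho>) \<Longrightarrow> slope i0 q u \<ge> 1/2"
    and cubes: "\<And>z u. z \<in> Z \<Longrightarrow> (\<And>i. \<bar>u $ i - z $ i\<bar> \<le> \<rho> * h) \<Longrightarrow> u \<in> unit_cube"
    and F: "\<And>S. S \<subseteq> Z \<Longrightarrow> tilted_field i0 q v a h S \<in> F"
    and law: "\<And>f. prob_space (law f)" "\<And>f. sets (law f) = sets (obs_space m n)"
    and close: "\<And>z S. z \<in> Z \<Longrightarrow> S \<subseteq> Z - {z} \<Longrightarrow>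
      kl_close 1 (law (tilted_field i0 q v a h (insert z S))) (law (tilted_field i0 q v a h S))"
  shows "ennreal (real (card Z) * ((v * a)\<^sup>2 * (2 * (\<rho> * h)) ^ CARD('d) * exp (- 8) / 256)) \<le>
    minimax_risk (joint_estimators m n) F law (\<lambda>g f. \<integral>\<^sup>+z\<in>unit_cube. ennreal ((norm (g z - f z))\<^sup>2) \<partial>lborel)"
proof (rule minimax_riskI)
  fix fh :: "(nat \<times> nat \<Rightarrow> real ^ 'd) \<Rightarrow> real ^ 'd \<Rightarrow> real ^ 'd" and X
  let ?f = "tilted_field i0 q v a h"
  let ?O = "obs_space m n :: (nat \<times> nat \<Rightarrow> real ^ 'd) measure"
  define Q where "Q z = {u::real ^ 'd. \<forall>i. \<bar>u $ i - z $ i\<bar> \<le> \<rho> * h}" for z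
  have \<rho>h: "\<rho> * h \<ge> 0" using \<rho> h by simp
  have Qm[measurable]: "Q z \<in> sets borel" for z
    unfolding Q_def using emeasure_cube(2)[OF \<rho>h, of z] .
  have Qe: "emeasure lborel (Q z) = ennreal ((2 * (\<rho> * h)) ^ CARD('d))" for z
    unfolding Q_def by (rule emeasure_cube(1)[OF \<rho>h])
  let ?l = "\<lambda>S y u. ennreal ((norm (fh y u - ?f S u))\<^sup>2)"
  assume "fh \<in> joint_estimators m n"
  then have joint: "(\<lambda>(y, z). fh y z) \<in> borel_measurable (?O \<Otimes>\<^sub>M borel)" by (simp add: joint_estimators_def)
  have [measurable]: "?f S \<in> borel_measurable borel" for S by (rule borel_measurable_field)
  have sec[measurable]: "fh y \<in> borel_measurable borel" if "y \<in> space ?O" for y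
    using measurable_compose[OF measurable_Pair1'[OF that] joint] by simp
  have joint'[measurable]: "(\<lambda>p. fh (fst p) (snd p)) \<in> borel_measurable (?O \<Otimes>\<^sub>M borel)"
    using joint by (simp add: case_prod_beta')
  define cell_loss where "cell_loss z S y = (\<integral>\<^sup>+u. ?l S y u * indicator (Q z) u \<partial>lborel)" for z S y
  have cell_loss_meas: "cell_loss z S \<in> borel_measurable ?O" for z S
  proof -
    have "(\<lambda>p. ?l S (fst p) (snd p) * indicator (Q z) (snd p)) \<in> borel_measurable (?O \<Otimes>\<^sub>M borel)"
      by measurable
    then have "(\<lambda>(y, u). ?l S y u * indicator (Q z) u) \<in> borel_measurable (?O \<Otimes>\<^sub>M lborel)"
      by (simp only: case_prod_beta' measurable_cong_sets[OF sets_pair_measure_cong[OF refl sets_lborel] refl])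
    then show ?thesis unfolding cell_loss_def by (rule lborel.borel_measurable_nn_integral)
  qed
  have cell_loss_law: "cell_loss z S \<in> borel_measurable (law f)" for z S f
    using cell_loss_meas by (simp only: measurable_cong_sets[OF law(2) refl])
  assume X: "\<And>f. f \<in> F \<Longrightarrow>
    (\<integral>\<^sup>+ y. (\<integral>\<^sup>+z\<in>unit_cube. ennreal ((norm (fh y z - f z))\<^sup>2) \<partial>lborel) \<partial>law f) \<le> X"
  define c where "c = (\<bar>v\<bar> * a / 4)\<^sup>2 / 2 * (2 * (\<rho> * h)) ^ CARD('d)"
  have c: "c \<ge> 0" using \<rho>h by (simp add: c_def)
  have "of_nat (card Z) * ennreal (c * exp (-8) / 4) \<le> 2 * X"
  proof (rule assouad[where r = "\<lambda>z S. \<integral>\<^sup>+y. cell_loss z S y \<partial>law (?f S)", OF Z(1)])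
    fix z S assume z: "z \<in> Z" and S: "S \<subseteq> Z - {z}"
    have S': "finite S" "separated h (insert z S)" "z \<notin> S"
      using S Z z by (auto intro: finite_subset separated_subset)
    have "ennreal (c * exp (-8) / 4) \<le> (\<integral>\<^sup>+y. cell_loss z (insert z S) y \<partial>law (?f (insert z S))) + (\<integral>\<^sup>+y. cell_loss z S y \<partial>law (?f S))"
    proof (rule two_point_bound[OF law(1) law(1) _ close[OF z S] cell_loss_law cell_loss_law c])
      fix y assume "y \<in> space (law (?f (insert z S)))"
      then have y: "y \<in> space ?O" using sets_eq_imp_space_eq[OF law(2)] by simp
      note sec[OF y, measurable]
      have "ennreal c = ennreal ((\<bar>v\<bar> * a / 4)\<^sup>2 / 2) * emeasure lborel (Q z)"
        unfolding Qe c_def using \<rho>h by (intro ennreal_mult) auto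
      also have "\<dots> = (\<integral>\<^sup>+u. ennreal ((\<bar>v\<bar> * a / 4)\<^sup>2 / 2) * indicator (Q z) u \<partial>lborel)"
        by (subst nn_integral_cmult_indicator) auto
      also have "\<dots> \<le> (\<integral>\<^sup>+u. ?l (insert z S) y u * indicator (Q z) u + ?l S y u * indicator (Q z) u \<partial>lborel)"
      proof (intro nn_integral_mono)
        fix u
        have "ennreal ((\<bar>v\<bar> * a / 4)\<^sup>2 / 2) \<le> ?l (insert z S) y u + ?l S y u" if u: "u \<in> Q z"
        proof -
          have u': "\<bar>((1/h) *\<^sub>R (u - z)) $ i\<bar> \<le> \<rho>" for i
            using u h by (simp add: Q_def abs_mult field_simps)
          have "\<bar>v\<bar> * a / 4 \<le> norm (?f (insert z S) u - ?f S u)"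
            by (rule field_gap[OF q a h S']) (use order.trans[OF u' less_imp_le[OF \<rho>(2)]] \<rho>(3)[OF u'] in auto)
          then have "(\<bar>v\<bar> * a / 4)\<^sup>2 / 2 \<le> (norm (?f (insert z S) u - ?f S u))\<^sup>2 / 2"
            using a by (intro divide_right_mono power_mono) auto
          also have "\<dots> \<le> (norm (fh y u - ?f (insert z S) u))\<^sup>2 + (norm (fh y u - ?f S u))\<^sup>2" by (rule sq_norm_triangle)
          finally show ?thesis by (simp flip: ennreal_plus add: ennreal_leI)
        qed
        then show "ennreal ((\<bar>v\<bar> * a / 4)\<^sup>2 / 2) * indicator (Q z) u \<le> ?l (insert z S) y u * indicator (Q z) u + ?l S y u * indicator (Q z) u"
          by (auto split: split_indicator)
      qed
      also have "\<dots> = cell_loss z (insert z S) y + cell_loss z S y"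
        unfolding cell_loss_def by (rule nn_integral_add) (use y in measurable)
      finally show "ennreal c \<le> cell_loss z (insert z S) y + cell_loss z S y" .
    qed (use law(2) in simp)
    then show "ennreal (c * exp (-8) / 4) \<le> (\<integral>\<^sup>+y. cell_loss z S y \<partial>law (?f S)) + (\<integral>\<^sup>+y. cell_loss z (insert z S) y \<partial>law (?f (insert z S)))"
      by (simp add: add.commute)
  next
    fix S assume S: "S \<subseteq> Z"
    have "(\<Sum>z\<in>Z. \<integral>\<^sup>+y. cell_loss z S y \<partial>law (?f S)) = (\<integral>\<^sup>+y. (\<Sum>z\<in>Z. cell_loss z S y) \<partial>law (?f S))"
      by (rule nn_integral_sum[symmetric]) (rule cell_loss_law)
    also have "\<dots> \<le> (\<integral>\<^sup>+ y. (\<integral>\<^sup>+u\<in>unit_cube. ?l S y u \<partial>lborel) \<partial>law (?f S))"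
    proof (intro nn_integral_mono)
      fix y assume "y \<in> space (law (?f S))"
      then have y: "y \<in> space ?O" using sets_eq_imp_space_eq[OF law(2)] by simp
      note sec[OF y, measurable]
      have "(\<Sum>z\<in>Z. cell_loss z S y) = (\<integral>\<^sup>+u. (\<Sum>z\<in>Z. ?l S y u * indicator (Q z) u) \<partial>lborel)"
        unfolding cell_loss_def by (rule nn_integral_sum[symmetric]) (use y in measurable)
      also have "\<dots> \<le> (\<integral>\<^sup>+u. ?l S y u * indicator unit_cube u \<partial>lborel)"
      proof (intro nn_integral_mono)
        fix u
        show "(\<Sum>z\<in>Z. ?l S y u * indicator (Q z) u) \<le> ?l S y u * indicator unit_cube u"
        proof (cases "\<exists>z\<in>Z. u \<in> Q z")
          case False
          then show ?thesis by (simp add: indicator_def)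
        next
          case True
          then obtain z where z: "z \<in> Z" "u \<in> Q z" by blast
          have "u \<notin> Q w" if w: "w \<in> Z - {z}" for w
          proof
            assume uw: "u \<in> Q w"
            have "w \<in> Z" "z \<noteq> w" using w by auto
            with Z(2) z(1) obtain i where i: "2 * h < \<bar>z $ i - w $ i\<bar>" unfolding separated_def by blast
            have "\<bar>u $ i - z $ i\<bar> \<le> \<rho> * h" "\<bar>u $ i - w $ i\<bar> \<le> \<rho> * h" using z uw by (auto simp: Q_def)
            moreover have "\<rho> * h \<le> h" using \<rho> h by simp
            ultimately show False using i by linarith
          qed
          then have "(\<Sum>w\<in>Z. ?l S y u * indicator (Q w) u) = ?l S y u * indicator (Q z) u"
            by (subst sum.remove[OF Z(1) z(1)]) (auto intro!: sum.neutral)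
          also have "\<dots> \<le> ?l S y u * indicator unit_cube u"
            using cubes[OF z(1), of u] z(2) by (auto simp: Q_def split: split_indicator)
          finally show ?thesis .
        qed
      qed
      finally show "(\<Sum>z\<in>Z. cell_loss z S y) \<le> (\<integral>\<^sup>+u\<in>unit_cube. ?l S y u \<partial>lborel)" .
    qed
    also have "\<dots> \<le> X" by (rule X[OF F[OF S]])
    finally show "(\<Sum>z\<in>Z. \<integral>\<^sup>+y. cell_loss z S y \<partial>law (?f S)) \<le> X" .
  qed
  also have "of_nat (card Z) * ennreal (c * exp (-8) / 4) =
      2 * ennreal (real (card Z) * ((v * a)\<^sup>2 * (2 * (\<rho> * h)) ^ CARD('d) * exp (- 8) / 256))"
  proof -
    define D where "D = (v * a)\<^sup>2 * (2 * (\<rho> * h)) ^ CARD('d) * exp (- 8) / 256"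
    have D: "D \<ge> 0" using \<rho>h by (simp add: D_def)
    have "c * exp (-8) / 4 = 2 * D" by (simp add: c_def D_def power_mult_distrib power_divide)
    then have "of_nat (card Z) * ennreal (c * exp (-8) / 4) = ennreal (real (card Z) * (2 * D))"
      using D by (simp only: ennreal_of_nat_eq_real_of_nat) (subst ennreal_mult, auto)
    also have "real (card Z) * (2 * D) = 2 * (real (card Z) * D)" by simp
    also have "ennreal \<dots> = 2 * ennreal (real (card Z) * D)"
      using D by (subst ennreal_mult) auto
    finally show ?thesis unfolding D_def .
  qed
  finally show "ennreal (real (card Z) * ((v * a)\<^sup>2 * (2 * (\<rho> * h)) ^ CARD('d) * exp (- 8) / 256)) \<le> X"
    using ennreal_mult_le_mult_iff[of 2] by simp
qed

text \<open>
  Centres at distance \<open>4 * h\<close>, all of whose coordinates are at most \<open>1/2\<close>: a drift in a negative direction then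
  only shifts them within the unit cube when it is undone.
\<close>
lemma grid_exists:
  assumes h: "h > 0" "h \<le> 1/16"
  obtains Z :: "(real ^ 'd::finite) set" where "finite Z" "separated h Z"
    "real (card Z) \<ge> (1 / (16 * h)) ^ CARD('d)" "\<And>z i. z \<in> Z \<Longrightarrow> h \<le> z $ i \<and> z $ i \<le> 1/2"
proof -
  define K where "K = nat \<lfloor>1 / (8 * h)\<rfloor>"
  have K1: "real K \<le> 1 / (8 * h)" unfolding K_def using h by (simp add: of_nat_nat)
  have "real K \<ge> 1 / (8 * h) - 1" unfolding K_def using h by (simp add: of_nat_nat)
  moreover have "1 / (16 * h) \<ge> 1" using h by simp
  moreover have "1 / (8 * h) = 2 * (1 / (16 * h))" by simp
  ultimately have K2: "real K \<ge> 1 / (16 * h)" by linarith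
  define g :: "('d \<Rightarrow> nat) \<Rightarrow> real ^ 'd" where "g k = (\<chi> i. 4 * h * real (k i) + 2 * h)" for k
  define Z where "Z = g ` (UNIV \<rightarrow>\<^sub>E {..<K})"
  have inj: "inj_on g A" for A
    using h by (auto simp: inj_on_def g_def vec_eq_iff fun_eq_iff)
  show ?thesis
  proof (rule that[of Z])
    show "finite Z" by (simp add: Z_def finite_PiE)
    have "card Z = K ^ CARD('d)" unfolding Z_def by (simp add: card_image[OF inj] card_funcsetE)
    then show "real (card Z) \<ge> (1 / (16 * h)) ^ CARD('d)"
      using K2 h by (simp add: power_mono)
    show "separated h Z"
      unfolding separated_def
    proof (intro ballI impI)
      fix z w assume "z \<in> Z" "w \<in> Z" and ne: "z \<noteq> w"
      then obtain k l where z: "z = g k" and w: "w = g l" by (auto simp: Z_def)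
      with ne obtain i where i: "k i \<noteq> l i" by (metis ext)
      have "z $ i - w $ i = 4 * h * (real (k i) - real (l i))" by (simp add: z w g_def algebra_simps)
      moreover have "\<bar>real (k i) - real (l i)\<bar> \<ge> 1" using i by linarith
      ultimately have "\<bar>z $ i - w $ i\<bar> \<ge> 4 * h * 1"
        using h by (simp only: abs_mult) (intro mult_mono, auto)
      then show "\<exists>i. 2 * h < \<bar>z $ i - w $ i\<bar>" using h by (intro exI[of _ i]) linarith
    qed
    fix z i assume "z \<in> Z"
    then obtain k where z: "z = g k" and "k i < K" by (auto simp: Z_def PiE_def Pi_def)
    then have "real (k i) + 1 \<le> real K" by linarith
    then have "4 * h * (real (k i) + 1) \<le> 4 * h * (1 / (8 * h))" using K1 h by (intro mult_left_mono) auto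
    then have "4 * h * real (k i) + 4 * h \<le> 1/2" using h by (simp add: algebra_simps)
    then show "h \<le> z $ i \<and> z $ i \<le> 1/2" using h by (simp add: z g_def add_increasing)
  qed
qed

text \<open>
  The last bound compares the number of grid cubes with the divergence: the grid for the bandwidth
  \<open>(ln N / N) powr (1 / p)\<close> has roughly \<open>N powr (d / p)\<close> points up to logarithms, while the exponential is a constant
  times \<open>N powr (d / (4 * p))\<close>.
\<close>
lemma large_sample:
  fixes p :: real and d :: nat
  assumes p: "p > 0" and d: "d \<ge> 1" "real d < p"
  obtains N0 where "N0 \<ge> 1" "\<And>N. N \<ge> N0 \<Longrightarrow> ln N \<ge> 1"
    "\<And>N. N \<ge> N0 \<Longrightarrow> N powr (- (1 / p)) \<le> 1/16"
    "\<And>N. N \<ge> N0 \<Longrightarrow> (ln N / N) powr (1 / p) \<le> 1/16"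
    "\<And>N. N \<ge> N0 \<Longrightarrow> 4 * exp (4 * (real d / (16 * p) * ln N + 1)) \<le> (1 / (16 * (ln N / N) powr (1 / p))) ^ d"
proof -
  have 1: "\<forall>\<^sub>F N in at_top. ln N \<ge> (1::real)"
    using ln_at_top by (simp add: filterlim_at_top)
  have "((\<lambda>N::real. N powr (- (1 / p))) \<longlongrightarrow> 0) at_top"
    using p by (intro tendsto_neg_powr filterlim_ident) auto
  then have 2: "\<forall>\<^sub>F N::real in at_top. N powr (- (1 / p)) < 1/16" by (rule order_tendstoD) simp
  have "((\<lambda>N::real. (ln N / N) powr (1 / p)) \<longlongrightarrow> 0 powr (1 / p)) at_top"
    using p by (intro tendsto_powr' ln_x_over_x_tendsto_0)
      (auto intro: eventually_mono[OF eventually_ge_at_top[of "1::real"]])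
  then have "((\<lambda>N::real. (ln N / N) powr (1 / p)) \<longlongrightarrow> 0) at_top" by simp
  then have 3: "\<forall>\<^sub>F N::real in at_top. (ln N / N) powr (1 / p) < 1/16" by (rule order_tendstoD) simp
  define s where "s = real d / p"
  have s: "s > 0" using p d by (simp add: s_def)
  let ?B = "4 * exp 4 * 16 ^ d :: real"
  have 4: "\<forall>\<^sub>F N::real in at_top. N powr (s/4) \<ge> ?B"
    using eventually_ge_at_top[of "?B powr (4/s)"]
  proof eventually_elim
    case (elim N)
    then have "(?B powr (4/s)) powr (s/4) \<le> N powr (s/4)" using s by (intro powr_mono2) auto
    then show ?case using s by (simp add: powr_powr)
  qed
  from eventually_conj[OF 1 eventually_conj[OF 2 eventually_conj[OF 3 eventually_conj[OF 4 eventually_ge_at_top[of 256]]]]]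
  obtain N0 where N0: "\<And>N. N \<ge> N0 \<Longrightarrow> ln N \<ge> 1 \<and> N powr (- (1 / p)) < 1/16 \<and> (ln N / N) powr (1 / p) < 1/16 \<and>
      N powr (s/4) \<ge> 4 * exp 4 * 16 ^ d \<and> N \<ge> 256"
    unfolding eventually_at_top_linorder by blast
  show ?thesis
  proof (rule that[of "max 1 N0"])
    fix N assume "N \<ge> max 1 N0"
    then have N: "ln N \<ge> 1" "N powr (s/4) \<ge> 4 * exp 4 * 16 ^ d" "N \<ge> 256" using N0[of N] by auto
    have lnN: "ln N \<le> N powr (1/2)"
    proof -
      have "ln N \<le> N powr (1/4) / (1/4)" using N by (intro ln_powr_bound) auto
      also have "\<dots> = 4 * N powr (1/4)" by simp
      also have "\<dots> \<le> N powr (1/4) * N powr (1/4)"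
      proof (intro mult_right_mono)
        have "(4::real) = (4 powr 4) powr (1/4)" by (subst powr_powr) simp
        also have "\<dots> \<le> N powr (1/4)" using N by (intro powr_mono2) (auto simp: powr_numeral)
        finally show "4 \<le> N powr (1/4)" .
      qed simp
      also have "\<dots> = N powr (1/2)" by (simp flip: powr_add)
      finally show ?thesis .
    qed
    let ?h = "(ln N / N) powr (1 / p)"
    have hd: "?h ^ d = (ln N / N) powr s"
      using N by (simp add: s_def powr_powr flip: powr_realpow)
    also have "\<dots> \<le> (N powr (- (1/2))) powr s"
    proof (intro powr_mono2)
      have "ln N / N \<le> N powr (1/2) / N" using lnN N by (intro divide_right_mono) auto
      also have "\<dots> = N powr (1/2 - 1)" using N by (subst powr_diff) simp
      finally show "ln N / N \<le> N powr (- (1/2))" by simp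
    qed (use N s in auto)
    also have "\<dots> = N powr (- (s/2))" by (simp add: powr_powr)
    finally have h2: "?h ^ d \<le> N powr (- (s/2))" .
    have hpos: "?h > 0" using N by simp
    have "4 * exp (4 * (real d / (16 * p) * ln N + 1)) = 4 * exp 4 * N powr (s/4)"
      using N by (simp add: powr_def s_def distrib_left exp_add)
    also have "\<dots> * 16 ^ d \<le> N powr (s/4) * N powr (s/4)"
      using mult_right_mono[OF N(2), of "N powr (s/4)"] by (simp add: mult_ac)
    also have "\<dots> = N powr (s/2)" by (simp flip: powr_add)
    finally have "4 * exp (4 * (real d / (16 * p) * ln N + 1)) \<le> N powr (s/2) / 16 ^ d"
      by (simp add: pos_le_divide_eq)
    also have "\<dots> \<le> (1 / ?h ^ d) / 16 ^ d"
    proof (intro divide_right_mono)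
      have "1 / N powr (- (s/2)) \<le> 1 / ?h ^ d" using h2 hpos by (intro divide_left_mono) auto
      then show "N powr (s/2) \<le> 1 / ?h ^ d" by (simp add: powr_minus field_simps)
    qed simp
    also have "\<dots> = (1 / (16 * ?h)) ^ d" by (simp add: power_divide power_mult_distrib)
    finally show "4 * exp (4 * (real d / (16 * p) * ln N + 1)) \<le> (1 / (16 * ?h)) ^ d" .
  qed (use N0 in \<open>auto intro: less_imp_le\<close>)
qed

section \<open>The minimax lower bounds\<close>

text \<open>
  The lower bound on \<open>N * h ^ d\<close> ensures that the maximum in the covering condition, multiplied by \<open>m\<close>, is at
  most a multiple of \<open>N * h ^ d\<close>. One of the two factors \<open>c\<close> of the squared amplitude is used to absorb the constants, the other is
  bounded by 1.
\<close>
lemma kl_close_field: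
  fixes x :: "nat \<Rightarrow> real ^ 'd::finite" and P :: "(real ^ 'd) measure" and N :: nat
  assumes q: "q \<ge> 2" and c: "0 < c" "c * (1 + 2 * real q) \<le> 1/2" "c \<le> 1" and h: "0 < h" "h \<le> 1" and \<beta>: "\<beta> \<ge> 1"
    and Nh: "real N * h ^ CARD('d) \<ge> 1"
    and C1: "32 * Cnoise * real nmax * max 1 (Ccvr * (3 * real CARD('d)) ^ CARD('d)) * c \<le> \<epsilon>"
    and S: "finite S" "separated h (insert z S)" "z \<notin> S"
    and m: "m \<ge> 1" "m \<le> N" and n: "\<And>j. j \<in> {1..m} \<Longrightarrow> n j \<le> nmax"
    and t: "\<And>j i. j \<in> {1..m} \<Longrightarrow> i \<le> n j \<Longrightarrow> t j i = real i * \<Delta>"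
    and P: "centered_noise P" "noise_condition Cnoise P" "Cnoise > 0" and cov: "cover Ccvr m x" "Ccvr > 0"
    and z: "z \<in> unit_cube" "\<And>i. i \<le> nmax \<Longrightarrow> z - (real i * \<Delta> * v) *\<^sub>R axis i0 1 \<in> unit_cube"
  shows "kl_close (\<epsilon> * (real N * h powr (2 * (\<beta> + 1) + real CARD('d))))
    (obs_law m n t x P (tilted_field i0 q v (c * h powr \<beta>) h (insert z S)))
    (obs_law m n t x P (tilted_field i0 q v (c * h powr \<beta>) h S))"
proof -
  define a where "a = c * h powr \<beta>"
  let ?d = "CARD('d)"
  let ?M = "max 1 (Ccvr * (3 * real ?d) ^ ?d)"
  have "h powr \<beta> \<le> 1" using h \<beta> by (simp add: powr_le1)
  then have "a \<le> c" using c unfolding a_def by (simp add: mult_left_le)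
  then have "a * (1 + 2 * real q) \<le> c * (1 + 2 * real q)" by (intro mult_right_mono) auto
  then have a: "0 \<le> a" "a * (1 + 2 * real q) \<le> 1/2"
    using c by (simp add: a_def) (use c(2) \<open>a * (1 + 2 * real q) \<le> c * (1 + 2 * real q)\<close> in linarith)
  have "max 1 (real m * (Ccvr * (3 * real ?d * h) ^ ?d)) \<le> real N * h ^ ?d * ?M"
  proof (rule max.boundedI)
    have "1 * 1 \<le> real N * h ^ ?d * ?M" using Nh by (intro mult_mono) auto
    then show "1 \<le> real N * h ^ ?d * ?M" by simp
    have "real m * (Ccvr * (3 * real ?d * h) ^ ?d) = real m * h ^ ?d * (Ccvr * (3 * real ?d) ^ ?d)"
      by (simp add: power_mult_distrib)
    also have "\<dots> \<le> real N * h ^ ?d * ?M"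
      using m h cov(2) by (intro mult_mono mult_right_mono) auto
    finally show "real m * (Ccvr * (3 * real ?d * h) ^ ?d) \<le> real N * h ^ ?d * ?M" .
  qed
  then have "Cnoise * (4 * a * h)\<^sup>2 * (2 * real nmax * max 1 (real m * (Ccvr * (3 * real ?d * h) ^ ?d)))
     \<le> Cnoise * (4 * a * h)\<^sup>2 * (2 * real nmax * (real N * h ^ ?d * ?M))"
    using P(3) by (intro mult_left_mono) auto
  also have "\<dots> = (32 * Cnoise * real nmax * ?M * c) * (c * (real N * ((h powr \<beta>)\<^sup>2 * h\<^sup>2 * h ^ ?d)))"
    by (simp add: a_def power2_eq_square)
  also have "(h powr \<beta>)\<^sup>2 * h\<^sup>2 * h ^ ?d = h powr (2 * (\<beta> + 1) + real ?d)"
  proof -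
    have "(h powr \<beta>)\<^sup>2 = h powr (\<beta> + \<beta>)" by (simp only: powr_add power2_eq_square)
    moreover have "h\<^sup>2 = h powr real 2" "h ^ ?d = h powr real ?d" using h(1) by (simp_all only: powr_realpow)
    moreover have "\<beta> + \<beta> + real 2 + real ?d = 2 * (\<beta> + 1) + real ?d" by simp
    ultimately show ?thesis by (simp only: powr_add[symmetric])
  qed
  also have "(32 * Cnoise * real nmax * ?M * c) * (c * (real N * h powr (2 * (\<beta> + 1) + real ?d)))
     \<le> \<epsilon> * (1 * (real N * h powr (2 * (\<beta> + 1) + real ?d)))"
  proof (intro mult_mono C1)
    have "0 \<le> 32 * Cnoise * real nmax * ?M * c" using P(3) c by auto
    then show "0 \<le> \<epsilon>" using C1 by linarith
  qed (use c in auto)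
  finally have le: "Cnoise * (4 * a * h)\<^sup>2 * (2 * real nmax * max 1 (real m * (Ccvr * (3 * real ?d * h) ^ ?d)))
     \<le> \<epsilon> * (real N * h powr (2 * (\<beta> + 1) + real ?d))" by simp
  show ?thesis
    unfolding a_def[symmetric]
    by (rule kl_close_mono[OF kl_close_insert[OF q a h(1) S m(1) n t P(1,2) less_imp_le[OF P(3)] cov(1) z] le])
qed

lemma powr_reciprocal: "x > 0 \<Longrightarrow> y > 0 \<Longrightarrow> (y / x) powr s = (x / y) powr (- s)" for x y s :: real
  by (simp add: powr_def ln_div algebra_simps)

lemma bandwidth:
  fixes X p \<beta> :: real
  assumes "X > 0" "p > 0"
  shows "(X powr (1 / p)) powr p = X" "((X powr (1 / p)) powr \<beta>)\<^sup>2 = X powr (2 * \<beta> / p)"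
proof -
  show "(X powr (1 / p)) powr p = X" unfolding powr_powr using assms by simp
  show "((X powr (1 / p)) powr \<beta>)\<^sup>2 = X powr (2 * \<beta> / p)"
    unfolding powr_powr power2_eq_square powr_add[symmetric] by (rule arg_cong[where f = "(powr) X"]) simp
qed

theorem corollary3p13:
  fixes \<beta> L\<beta> Cnoise Ccvr :: real and L :: "nat \<Rightarrow> real" and nmax :: nat
  assumes "\<beta> \<ge> 1"
    and "\<forall>k\<le>ell \<beta>. L k > 0" and "L\<beta> > 0"
    and "Cnoise > 0" and "Ccvr > 0"
  shows "\<exists>C>0. \<forall>(m::nat) (n :: nat \<Rightarrow> nat) (T :: nat \<Rightarrow> real) (t :: nat \<Rightarrow> nat \<Rightarrow> real)
      (x :: nat \<Rightarrow> real ^ 'd::finite) (P :: (real ^ 'd) measure) (\<Delta>t::real) (N::nat).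
      m \<ge> 1 \<longrightarrow> (\<forall>j\<in>{1..m}. n j \<ge> 1) \<longrightarrow> nmax = Max (n ` {1..m}) \<longrightarrow> N = (\<Sum>j\<in>{1..m}. n j) \<longrightarrow>
      observation_times m n T t \<longrightarrow>
      centered_noise P \<longrightarrow>
      noise_condition Cnoise P \<longrightarrow>
      cover Ccvr m x \<longrightarrow>
      \<Delta>t > 0 \<longrightarrow> equidistant_time m n t \<Delta>t \<longrightarrow>
      \<Delta>t \<le> 1 / C \<longrightarrow> real N * \<Delta>t\<^sup>2 \<ge> C \<longrightarrow>
        (\<forall>x0\<in>unit_cube.
          ennreal C * minimax_risk (estimators m n) (smooth_class \<beta> L L\<beta>) (obs_law m n t x P)
              (\<lambda>g f. ennreal ((norm (g x0 - f x0))\<^sup>2))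
            \<ge> ennreal (real N powr (- (2 * \<beta> / (2 * (\<beta> + 1) + real CARD('d)))))) \<and>
        ennreal C * minimax_risk (estimators m n) (smooth_class \<beta> L L\<beta>) (obs_law m n t x P)
            (\<lambda>g f. SUP z\<in>unit_cube. ennreal ((norm (g z - f z))\<^sup>2))
          \<ge> ennreal ((real N / ln (real N)) powr (- (2 * \<beta> / (2 * (\<beta> + 1) + real CARD('d))))) \<and>
        ennreal C * minimax_risk (joint_estimators m n) (smooth_class \<beta> L L\<beta>) (obs_law m n t x P)
            (\<lambda>g f. \<integral>\<^sup>+z\<in>unit_cube. ennreal ((norm (g z - f z))\<^sup>2) \<partial>lborel)
          \<ge> ennreal (real N powr (- (2 * \<beta> / (2 * (\<beta> + 1) + real CARD('d)))))"
proof -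
  let ?d = "CARD('d)"
  define p where "p = 2 * (\<beta> + 1) + real ?d"
  define i0 :: 'd where "i0 = undefined"
  define q where "q = ell \<beta> + 3"
  have q: "q \<ge> 2" by (simp add: q_def)
  have d: "?d \<ge> 1" "real ?d < p" and p: "p > 0" using assms(1) by (auto simp: p_def Suc_le_eq)
  \<comment> \<open>Small enough that \<open>exp (4 * \<epsilon> * ln N)\<close> is far below the number \<open>N powr (d / p)\<close> of grid cubes, up to logarithms.\<close>
  define \<epsilon> where "\<epsilon> = real ?d / (16 * p)"
  have \<epsilon>: "0 < \<epsilon>" "\<epsilon> \<le> 1" using d p by (auto simp: \<epsilon>_def)
  have L0: "L 0 > 0" using assms(2) by simp
  obtain c0 where c0: "0 < c0" "c0 \<le> 1" "c0 * (1 + 2 * real q) \<le> 1/2"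
    "\<And>c h v S. 0 < c \<Longrightarrow> c \<le> c0 \<Longrightarrow> 0 < h \<Longrightarrow> h \<le> 1 \<Longrightarrow> finite S \<Longrightarrow> separated h S \<Longrightarrow> \<bar>v\<bar> = L 0 / 2 \<Longrightarrow>
       tilted_field i0 q v (c * h powr \<beta>) h S \<in> smooth_class \<beta> L L\<beta>"
    by (rule field_in_smooth_class[OF assms(1-3) q_def, where ?i0.0 = i0]) blast
  obtain \<rho> where \<rho>: "0 < \<rho>" "\<rho> < 1" "\<And>u :: real ^ 'd. (\<And>i. \<bar>u $ i\<bar> \<le> \<rho>) \<Longrightarrow> slope i0 q u \<ge> 1/2"
    by (rule slope_ge_half[OF q, where ?i0.0 = i0]) blast
  define C1 where "C1 = 32 * Cnoise * real nmax * max 1 (Ccvr * (3 * real ?d) ^ ?d)"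
  have C1: "C1 \<ge> 0" using assms(4) by (simp add: C1_def)
  define c where "c = min c0 (\<epsilon> / (C1 + 1))"
  have c: "0 < c" "c \<le> c0" "C1 * c \<le> \<epsilon>"
  proof -
    show "0 < c" "c \<le> c0" using c0 C1 \<epsilon> by (auto simp: c_def)
    have "C1 * c \<le> C1 * (\<epsilon> / (C1 + 1))" using C1 by (intro mult_left_mono) (auto simp: c_def)
    also have "\<dots> \<le> (C1 + 1) * (\<epsilon> / (C1 + 1))" using C1 \<epsilon> by (intro mult_right_mono) auto
    finally show "C1 * c \<le> \<epsilon>" using C1 by simp
  qed
  have cq: "c * (1 + 2 * real q) \<le> 1/2" "c \<le> 1"
  proof -
    have "c * (1 + 2 * real q) \<le> c0 * (1 + 2 * real q)" using c by (intro mult_right_mono) auto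
    then show "c * (1 + 2 * real q) \<le> 1/2" using c0(3) by linarith
    show "c \<le> 1" using c c0 by simp
  qed
  obtain N0 where N0: "N0 \<ge> 1" "\<And>N. N \<ge> N0 \<Longrightarrow> ln N \<ge> 1"
    "\<And>N. N \<ge> N0 \<Longrightarrow> N powr (- (1 / p)) \<le> 1/16"
    "\<And>N. N \<ge> N0 \<Longrightarrow> (ln N / N) powr (1 / p) \<le> 1/16"
    "\<And>N. N \<ge> N0 \<Longrightarrow> 4 * exp (4 * (\<epsilon> * ln N + 1)) \<le> (1 / (16 * (ln N / N) powr (1 / p))) ^ ?d"
    unfolding \<epsilon>_def using large_sample[OF p d] by blast
  define v0 where "v0 = L 0 / 2"
  have v0: "v0 > 0" using L0 by (simp add: v0_def)
  \<comment> \<open>The constant from the integrated loss, the smallest of the three.\<close>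
  define \<kappa> where "\<kappa> = (\<rho> / 8) ^ ?d * ((v0 * c)\<^sup>2 * exp (- 8) / 256)"
  have \<kappa>: "\<kappa> > 0" "\<kappa> \<le> (v0 * c)\<^sup>2 * exp (- 8) / 256" "\<kappa> \<le> (v0 * c)\<^sup>2 / 128"
  proof -
    have e: "0 < (v0 * c)\<^sup>2 * exp (- 8) / 256" using v0 c by simp
    show "\<kappa> > 0" unfolding \<kappa>_def using e \<rho> by (intro mult_pos_pos) auto
    have "(\<rho> / 8) ^ ?d \<le> 1" using \<rho> by (intro power_le_one) auto
    then show 1: "\<kappa> \<le> (v0 * c)\<^sup>2 * exp (- 8) / 256"
      unfolding \<kappa>_def using e by (intro mult_left_le_one_le) (use \<rho> in auto)
    have "(v0 * c)\<^sup>2 * exp (- 8) \<le> (v0 * c)\<^sup>2 * 1" by (intro mult_left_mono) auto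
    then have "(v0 * c)\<^sup>2 * exp (- 8) / 256 \<le> (v0 * c)\<^sup>2 / 128"
      using zero_le_power2[of "v0 * c"] by linarith
    with 1 show "\<kappa> \<le> (v0 * c)\<^sup>2 / 128" by linarith
  qed
  \<comment> \<open>The three terms make the sample large, keep the total drift below \<open>1/2\<close>, and compensate \<open>\<kappa>\<close>.\<close>
  define C where "C = N0 + real nmax * L 0 + 1 / \<kappa>"
  have C: "C > 0" "C \<ge> 1" "C \<ge> N0" "C \<ge> real nmax * L 0" "C \<ge> 1 / \<kappa>"
  proof -
    have "real nmax * L 0 \<ge> 0" "1 / \<kappa> > 0" using L0 \<kappa>(1) by simp_all
    then show "C > 0" "C \<ge> 1" "C \<ge> N0" "C \<ge> real nmax * L 0" "C \<ge> 1 / \<kappa>"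
      using N0(1) unfolding C_def by linarith+
  qed
  have scale: "ennreal rate \<le> ennreal C * R" if "ennreal (K * rate) \<le> R" "\<kappa> \<le> K" "rate \<ge> 0" for rate K R
  proof -
    have "1 \<le> C * \<kappa>" using C(5) \<kappa>(1) by (simp add: pos_divide_le_eq)
    also have "\<dots> \<le> C * K" using that C by (intro mult_left_mono) auto
    finally have "rate \<le> C * (K * rate)" using that mult_right_mono[of 1 "C * K" rate] by (simp add: mult.assoc)
    then have "ennreal rate \<le> ennreal (C * (K * rate))" by (rule ennreal_leI)
    also have "\<dots> = ennreal C * ennreal (K * rate)" using C \<kappa> that by (intro ennreal_mult) auto
    also have "\<dots> \<le> ennreal C * R" using that by (intro mult_left_mono) auto
    finally show ?thesis .
  qed
  show ?thesis
  proof (rule exI[of _ C], intro conjI C(1) allI impI)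
    fix m :: nat and n :: "nat \<Rightarrow> nat" and T :: "nat \<Rightarrow> real" and t :: "nat \<Rightarrow> nat \<Rightarrow> real"
      and x :: "nat \<Rightarrow> real ^ 'd" and P :: "(real ^ 'd) measure" and \<Delta>t :: real and N :: nat
    assume m: "m \<ge> 1" and n1: "\<forall>j\<in>{1..m}. n j \<ge> 1" and nmax: "nmax = Max (n ` {1..m})"
      and N: "N = (\<Sum>j\<in>{1..m}. n j)" and times: "observation_times m n T t"
      and noise: "centered_noise P" "noise_condition Cnoise P" and cov: "cover Ccvr m x"
      and \<Delta>: "\<Delta>t > 0" and equi: "equidistant_time m n t \<Delta>t" and \<Delta>C: "\<Delta>t \<le> 1 / C" and N\<Delta>: "real N * \<Delta>t\<^sup>2 \<ge> C"
    have n: "n j \<le> nmax" if "j \<in> {1..m}" for j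
      unfolding nmax using that by (intro Max_ge) auto
    have mN: "m \<le> N"
    proof -
      have "(\<Sum>j\<in>{1..m}. 1) \<le> (\<Sum>j\<in>{1..m}. n j)" using n1 by (intro sum_mono) auto
      then show ?thesis using N by simp
    qed
    have t: "t j i = real i * \<Delta>t" if j: "j \<in> {1..m}" and "i \<le> n j" for j i
      using that(2)
    proof (induction i)
      case 0
      then show ?case using times j by (simp add: observation_times_def)
    next
      case (Suc i)
      have "t j (Suc i) - t j i = \<Delta>t" using equi j Suc.prems unfolding equidistant_time_def by (simp add: Suc_le_eq)
      then show ?case using Suc by (simp add: algebra_simps)
    qed
    have NC: "real N \<ge> C"
    proof -
      have "\<Delta>t \<le> 1" using \<Delta>C C(2) by (meson divide_le_eq_1_pos order.trans C(1))
      then have "\<Delta>t\<^sup>2 \<le> 1" using \<Delta> by (simp add: power_le_one)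
      then have "real N * \<Delta>t\<^sup>2 \<le> real N * 1" by (intro mult_left_mono) auto
      then show ?thesis using N\<Delta> by simp
    qed
    then have NN0: "real N \<ge> N0" using C by simp
    have N1: "real N \<ge> 1" using NN0 N0(1) by simp
    note N0N = N0(2-5)[OF NN0]
    have drift: "real i * \<Delta>t * v0 \<le> 1/2" "0 \<le> real i * \<Delta>t * v0" if "i \<le> nmax" for i
    proof -
      have "real i * \<Delta>t * v0 \<le> real nmax * (1 / C) * v0"
        using that \<Delta> \<Delta>C v0 C by (intro mult_mono) auto
      also have "\<dots> = real nmax * L 0 / (2 * C)" by (simp add: v0_def)
      also have "\<dots> \<le> C / (2 * C)" using C by (intro divide_right_mono) auto
      finally show "real i * \<Delta>t * v0 \<le> 1/2" using C by simp
      show "0 \<le> real i * \<Delta>t * v0" using \<Delta> v0 by simp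
    qed
    have law: "prob_space (obs_law m n t x P f)" "sets (obs_law m n t x P f) = sets (obs_space m n)" for f
      using noise(1) by (auto simp: centered_noise_def intro!: prob_space_obs_law)
    \<comment> \<open>The bandwidth for the pointwise and the integrated loss; \<open>h2\<close> is the one for the uniform loss.\<close>
    define h1 where "h1 = (1 / real N) powr (1 / p)"
    define h2 where "h2 = (ln (real N) / real N) powr (1 / p)"
    have Npos: "real N > 0" "1 / real N > 0" "ln (real N) > 0" "ln (real N) / real N > 0"
    proof -
      show "real N > 0" "ln (real N) > 0" using N1 N0N(1) by linarith+
      then show "1 / real N > 0" "ln (real N) / real N > 0" by (intro divide_pos_pos; simp)+
    qed
    have recip: "(1 / real N) powr s = real N powr (- s)" for s
      using powr_reciprocal[OF Npos(1) zero_less_one, of s] by (simp only: div_by_1)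
    have h1: "0 < h1" "h1 \<le> 1/16"
      unfolding h1_def recip using N0N(2) Npos(1) by (simp_all only: powr_gt_zero)
    have h2: "0 < h2" "h2 \<le> 1/16"
      unfolding h2_def using N0N(3) Npos(4) by (simp_all only: powr_gt_zero)
    have h1p: "real N * h1 powr p = 1"
      unfolding h1_def bandwidth(1)[OF Npos(2) p] using Npos by simp
    have h2p: "real N * h2 powr p = ln (real N)"
      unfolding h2_def bandwidth(1)[OF Npos(4) p] using Npos by simp
    have h12: "h1 \<le> h2"
      unfolding h1_def h2_def using N0N(1) Npos p by (intro powr_mono2 divide_right_mono) simp_all
    have Nh1: "real N * h1 ^ ?d \<ge> 1"
    proof -
      have "h1 ^ ?d \<ge> h1 powr p"
        using h1 d by (subst powr_realpow[symmetric]) (auto intro: powr_mono')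
      then have "real N * h1 ^ ?d \<ge> real N * h1 powr p" by (intro mult_left_mono) auto
      then show ?thesis by (simp only: h1p)
    qed
    have Nh2: "real N * h2 ^ ?d \<ge> 1"
    proof -
      have "h1 ^ ?d \<le> h2 ^ ?d" using h12 h1(1) by (intro power_mono) auto
      then have "real N * h1 ^ ?d \<le> real N * h2 ^ ?d" by (intro mult_left_mono) auto
      with Nh1 show ?thesis by linarith
    qed
    have r1: "(h1 powr \<beta>)\<^sup>2 = real N powr (- (2 * \<beta> / p))"
      unfolding h1_def bandwidth(2)[OF Npos(2) p] by (rule recip)
    have r2: "(h2 powr \<beta>)\<^sup>2 = (real N / ln (real N)) powr (- (2 * \<beta> / p))"
      unfolding h2_def bandwidth(2)[OF Npos(4) p] by (rule powr_reciprocal[OF Npos(1,3)])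
    have a: "0 \<le> c * h powr \<beta>" "c * h powr \<beta> * (1 + 2 * real q) \<le> 1/2" if "0 < h" "h \<le> 1/16" for h
    proof -
      have "h powr \<beta> \<le> 1" using that assms(1) by (intro powr_le1) auto
      then have "c * h powr \<beta> \<le> c" using c by (simp add: mult_left_le)
      then have "c * h powr \<beta> * (1 + 2 * real q) \<le> c * (1 + 2 * real q)" by (intro mult_right_mono) auto
      then show "c * h powr \<beta> * (1 + 2 * real q) \<le> 1/2" using cq(1) by linarith
    qed (use c in simp)
    have mem: "tilted_field i0 q v (c * h powr \<beta>) h S \<in> smooth_class \<beta> L L\<beta>"
      if "0 < h" "h \<le> 1/16" "finite S" "separated h S" "\<bar>v\<bar> = v0" for h S v
      using that by (intro c0(4) c) (auto simp: v0_def)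
    have close: "kl_close (\<epsilon> * (real N * h powr p)) (obs_law m n t x P (tilted_field i0 q v (c * h powr \<beta>) h (insert z S)))
        (obs_law m n t x P (tilted_field i0 q v (c * h powr \<beta>) h S))"
      if h: "0 < h" "h \<le> 1/16" "real N * h ^ ?d \<ge> 1" and S: "finite S" "separated h (insert z S)" "z \<notin> S"
        and z: "z \<in> unit_cube" "\<And>i. i \<le> nmax \<Longrightarrow> z - (real i * \<Delta>t * v) *\<^sub>R axis i0 1 \<in> unit_cube" for h z S v
    proof -
      have "h \<le> 1" using h by linarith
      show ?thesis
        unfolding p_def
        by (rule kl_close_field[OF q c(1) cq h(1) \<open>h \<le> 1\<close> assms(1) h(3) c(3)[unfolded C1_def] S m mN n t noise assms(4) cov assms(5) z])
    qed
    have nth: "(z - D *\<^sub>R axis i0 1) $ k = z $ k - (if k = i0 then D else 0)" for z :: "real ^ 'd" and D k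
      by (simp add: axis_def)
    have left: "z - (real i * \<Delta>t * (- v0)) *\<^sub>R axis i0 1 \<in> unit_cube"
      if z: "z \<in> unit_cube" "z $ i0 \<le> 1/2" and i: "i \<le> nmax" for z i
    proof -
      have z01: "0 \<le> z $ k" "z $ k \<le> 1" for k using z(1) by (simp_all add: unit_cube_def)
      have "0 \<le> z $ k - (if k = i0 then real i * \<Delta>t * (- v0) else 0) \<and> z $ k - (if k = i0 then real i * \<Delta>t * (- v0) else 0) \<le> 1" for k
      proof (cases "k = i0")
        case True
        have "0 \<le> z $ i0 - real i * \<Delta>t * (- v0)" "z $ i0 - real i * \<Delta>t * (- v0) \<le> 1"
          unfolding mult_minus_right using z01[of i0] z(2) drift[OF i] by linarith+
        then show ?thesis by (simp only: True if_True simp_thms)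
      next
        case False
        then show ?thesis by (simp only: False if_False diff_zero z01 simp_thms)
      qed
      then show ?thesis unfolding unit_cube_def mem_Collect_eq nth by blast
    qed
    have right: "z - (real i * \<Delta>t * v0) *\<^sub>R axis i0 1 \<in> unit_cube"
      if z: "z \<in> unit_cube" "z $ i0 \<ge> 1/2" and i: "i \<le> nmax" for z i
    proof -
      have z01: "0 \<le> z $ k" "z $ k \<le> 1" for k using z(1) by (simp_all add: unit_cube_def)
      have "0 \<le> z $ k - (if k = i0 then real i * \<Delta>t * v0 else 0) \<and> z $ k - (if k = i0 then real i * \<Delta>t * v0 else 0) \<le> 1" for k
      proof (cases "k = i0")
        case True
        have "0 \<le> z $ i0 - real i * \<Delta>t * v0" "z $ i0 - real i * \<Delta>t * v0 \<le> 1"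
          unfolding mult_minus_right using z01[of i0] z(2) drift[OF i] by linarith+
        then show ?thesis by (simp only: True if_True simp_thms)
      next
        case False
        then show ?thesis by (simp only: False if_False diff_zero z01 simp_thms)
      qed
      then show ?thesis unfolding unit_cube_def mem_Collect_eq nth by blast
    qed
    have empty_not_member: "z \<notin> {}" for z :: "real ^ 'd" by simp
    have sq: "(v * (c * H))\<^sup>2 = (v0 * c)\<^sup>2 * H\<^sup>2" if "\<bar>v\<bar> = v0" for v H :: real
      using that by (auto simp: power_mult_distrib)
    have shuffle: "X * R * E / K = X * E / K * R" "X * R / K = X / K * R" for X R E K :: real by simp_all
    have vm: "\<bar>- v0\<bar> = v0" using v0 by simp
    have one: "separated h {z}" for h and z :: "real ^ 'd" by (simp add: separated_def)
    have pointwise: "ennreal (real N powr (- (2 * \<beta> / p))) \<le> ennreal C *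
        minimax_risk (estimators m n) (smooth_class \<beta> L L\<beta>) (obs_law m n t x P) (\<lambda>g f. ennreal ((norm (g x0 - f x0))\<^sup>2))"
      if x0: "x0 \<in> unit_cube" for x0
    proof (rule scale[OF _ \<kappa>(2)])
      \<comment> \<open>The drift runs towards the nearer face, so that undoing it stays inside the cube.\<close>
      define v where "v = (if x0 $ i0 \<le> 1/2 then - v0 else v0)"
      have v: "\<bar>v\<bar> = v0" using v0 by (auto simp: v_def)
      have shift: "x0 - (real i * \<Delta>t * v) *\<^sub>R axis i0 1 \<in> unit_cube" if "i \<le> nmax" for i
        using left[OF x0 _ that] right[OF x0 _ that] by (auto simp: v_def)
      have cl: "kl_close 1 (obs_law m n t x P (tilted_field i0 q v (c * h1 powr \<beta>) h1 {x0})) (obs_law m n t x P (tilted_field i0 q v (c * h1 powr \<beta>) h1 {}))"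
        by (rule kl_close_mono[OF close[OF h1 Nh1 finite.emptyI one empty_not_member x0 shift]]) (simp_all only: h1p \<epsilon> mult_1_right)
      have m0: "tilted_field i0 q v (c * h1 powr \<beta>) h1 {} \<in> smooth_class \<beta> L L\<beta>"
        by (rule mem[OF h1 finite.emptyI _ v]) (simp add: separated_def)
      have m1: "tilted_field i0 q v (c * h1 powr \<beta>) h1 {x0} \<in> smooth_class \<beta> L L\<beta>"
        by (rule mem[OF h1 _ one v]) simp
      from cl have "ennreal ((v * (c * h1 powr \<beta>))\<^sup>2 * exp (- 8) / 256) \<le>
        minimax_risk (estimators m n) (smooth_class \<beta> L L\<beta>) (obs_law m n t x P) (\<lambda>g f. ennreal ((norm (g x0 - f x0))\<^sup>2))"
        by (rule pointwise_risk_bound[OF q a[OF h1] h1(1) m0 m1 law])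
      then show "ennreal ((v0 * c)\<^sup>2 * exp (- 8) / 256 * real N powr (- (2 * \<beta> / p))) \<le>
        minimax_risk (estimators m n) (smooth_class \<beta> L L\<beta>) (obs_law m n t x P) (\<lambda>g f. ennreal ((norm (g x0 - f x0))\<^sup>2))"
        unfolding sq[OF v] r1 shuffle(1) .
    qed simp
    have uniform: "ennreal ((real N / ln (real N)) powr (- (2 * \<beta> / p))) \<le> ennreal C *
        minimax_risk (estimators m n) (smooth_class \<beta> L L\<beta>) (obs_law m n t x P) (\<lambda>g f. SUP z\<in>unit_cube. ennreal ((norm (g z - f z))\<^sup>2))"
    proof (rule scale[OF _ \<kappa>(3)])
      obtain Z :: "(real ^ 'd) set" where Z: "finite Z" "separated h2 Z"
        "real (card Z) \<ge> (1 / (16 * h2)) ^ ?d" "\<And>z i. z \<in> Z \<Longrightarrow> h2 \<le> z $ i \<and> z $ i \<le> 1/2"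
        using grid_exists[OF h2] by metis
      have Zc: "z \<in> unit_cube" if "z \<in> Z" for z
      proof -
        have "0 \<le> z $ i \<and> z $ i \<le> 1" for i using Z(4)[OF that, of i] h2 by linarith
        then show ?thesis unfolding unit_cube_def by blast
      qed
      have Zleft: "z $ i0 \<le> 1/2" if "z \<in> Z" for z using Z(4)[OF that, of i0] by blast
      have "ennreal ((- v0 * (c * h2 powr \<beta>))\<^sup>2 / 128) \<le>
        minimax_risk (estimators m n) (smooth_class \<beta> L L\<beta>) (obs_law m n t x P) (\<lambda>g f. SUP z\<in>unit_cube. ennreal ((norm (g z - f z))\<^sup>2))"
      proof (rule uniform_risk_bound[OF q a[OF h2] h2(1) Z(1,2) _ _ law])
        show "Z \<subseteq> unit_cube" using Zc by blast
        show "tilted_field i0 q (- v0) (c * h2 powr \<beta>) h2 {z} \<in> smooth_class \<beta> L L\<beta>" for z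
          by (rule mem[OF h2 _ one vm]) simp
        show "kl_close (\<epsilon> * ln (real N)) (obs_law m n t x P (tilted_field i0 q (- v0) (c * h2 powr \<beta>) h2 {z}))
           (obs_law m n t x P (tilted_field i0 q (- v0) (c * h2 powr \<beta>) h2 {}))" if "z \<in> Z" for z
          by (rule close[OF h2 Nh2 finite.emptyI one empty_not_member Zc[OF that] left[OF Zc[OF that] Zleft[OF that]], unfolded h2p])
        show "0 \<le> \<epsilon> * ln (real N)" using \<epsilon> N0N(1) by simp
        show "4 * exp (4 * (\<epsilon> * ln (real N) + 1)) \<le> real (card Z)" using N0N(4) Z(3) unfolding h2_def by linarith
      qed
      then show "ennreal ((v0 * c)\<^sup>2 / 128 * (real N / ln (real N)) powr (- (2 * \<beta> / p))) \<le>
        minimax_risk (estimators m n) (smooth_class \<beta> L L\<beta>) (obs_law m n t x P) (\<lambda>g f. SUP z\<in>unit_cube. ennreal ((norm (g z - f z))\<^sup>2))"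
        unfolding sq[OF vm] r2 shuffle(2) .
    qed simp
    have integrated: "ennreal (real N powr (- (2 * \<beta> / p))) \<le> ennreal C *
        minimax_risk (joint_estimators m n) (smooth_class \<beta> L L\<beta>) (obs_law m n t x P) (\<lambda>g f. \<integral>\<^sup>+z\<in>unit_cube. ennreal ((norm (g z - f z))\<^sup>2) \<partial>lborel)"
    proof (rule scale[OF _ order.refl])
      obtain Z :: "(real ^ 'd) set" where Z: "finite Z" "separated h1 Z"
        "real (card Z) \<ge> (1 / (16 * h1)) ^ ?d" "\<And>z i. z \<in> Z \<Longrightarrow> h1 \<le> z $ i \<and> z $ i \<le> 1/2"
        using grid_exists[OF h1] by metis
      have Zc: "z \<in> unit_cube" if "z \<in> Z" for z
      proof -
        have "0 \<le> z $ i \<and> z $ i \<le> 1" for i using Z(4)[OF that, of i] h1 by linarith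
        then show ?thesis unfolding unit_cube_def by blast
      qed
      have Zleft: "z $ i0 \<le> 1/2" if "z \<in> Z" for z using Z(4)[OF that, of i0] by blast
      define A where "A = (- v0 * (c * h1 powr \<beta>))\<^sup>2 * exp (- 8) / 256"
      have A: "A \<ge> 0" "A = (v0 * c)\<^sup>2 * exp (- 8) / 256 * real N powr (- (2 * \<beta> / p))"
      proof -
        show "A \<ge> 0" unfolding A_def by (intro divide_nonneg_nonneg mult_nonneg_nonneg zero_le_power2) simp_all
        show "A = (v0 * c)\<^sup>2 * exp (- 8) / 256 * real N powr (- (2 * \<beta> / p))"
          unfolding A_def sq[OF vm] r1 by (rule shuffle(1))
      qed
      have "\<kappa> * real N powr (- (2 * \<beta> / p)) = (1 / (16 * h1)) ^ ?d * ((2 * (\<rho> * h1)) ^ ?d * A)"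
      proof -
        have "(1 / (16 * h1)) * (2 * (\<rho> * h1)) = \<rho> / 8" using h1(1) by simp
        then have "(1 / (16 * h1)) ^ ?d * (2 * (\<rho> * h1)) ^ ?d = (\<rho> / 8) ^ ?d"
          by (simp only: power_mult_distrib[symmetric])
        then show ?thesis unfolding A(2) \<kappa>_def by (simp only: mult.assoc[symmetric])
      qed
      also have "\<dots> \<le> real (card Z) * ((2 * (\<rho> * h1)) ^ ?d * A)"
        using \<rho>(1) h1(1) by (intro mult_right_mono Z(3) mult_nonneg_nonneg zero_le_power A(1)) simp_all
      finally have "ennreal (\<kappa> * real N powr (- (2 * \<beta> / p))) \<le> ennreal (real (card Z) * ((2 * (\<rho> * h1)) ^ ?d * A))"
        by (rule ennreal_leI)
      also have "(2 * (\<rho> * h1)) ^ ?d * A = (- v0 * (c * h1 powr \<beta>))\<^sup>2 * (2 * (\<rho> * h1)) ^ ?d * exp (- 8) / 256"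
        unfolding A_def by (simp only: mult_ac times_divide_eq_left times_divide_eq_right)
      also have "ennreal (real (card Z) * \<dots>) \<le>
        minimax_risk (joint_estimators m n) (smooth_class \<beta> L L\<beta>) (obs_law m n t x P) (\<lambda>g f. \<integral>\<^sup>+z\<in>unit_cube. ennreal ((norm (g z - f z))\<^sup>2) \<partial>lborel)"
      proof (rule integrated_risk_bound[OF q a[OF h1] h1(1) Z(1,2) \<rho> _ _ law])
        fix z u :: "real ^ 'd" assume z: "z \<in> Z" and u: "\<And>i. \<bar>u $ i - z $ i\<bar> \<le> \<rho> * h1"
        have "\<rho> * h1 \<le> h1" using \<rho> h1 by simp
        then have "0 \<le> u $ i \<and> u $ i \<le> 1" for i
          using u[of i] Z(4)[OF z, of i] h1 by linarith
        then show "u \<in> unit_cube" by (simp add: unit_cube_def)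
      next
        fix S assume S: "S \<subseteq> Z"
        show "tilted_field i0 q (- v0) (c * h1 powr \<beta>) h1 S \<in> smooth_class \<beta> L L\<beta>"
          by (rule mem[OF h1 finite_subset[OF S Z(1)] separated_subset[OF Z(2) S] vm])
      next
        fix z S assume z: "z \<in> Z" and S: "S \<subseteq> Z - {z}"
        have S': "S \<subseteq> Z" "insert z S \<subseteq> Z" "z \<notin> S" using S z by blast+
        have "kl_close (\<epsilon> * (real N * h1 powr p)) (obs_law m n t x P (tilted_field i0 q (- v0) (c * h1 powr \<beta>) h1 (insert z S)))
           (obs_law m n t x P (tilted_field i0 q (- v0) (c * h1 powr \<beta>) h1 S))"
          by (rule close[OF h1 Nh1 finite_subset[OF S'(1) Z(1)] separated_subset[OF Z(2) S'(2)] S'(3)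
                Zc[OF z] left[OF Zc[OF z] Zleft[OF z]]])
        then show "kl_close 1 (obs_law m n t x P (tilted_field i0 q (- v0) (c * h1 powr \<beta>) h1 (insert z S)))
           (obs_law m n t x P (tilted_field i0 q (- v0) (c * h1 powr \<beta>) h1 S))"
          by (rule kl_close_mono) (simp only: h1p \<epsilon> mult_1_right)
      qed
      finally show "ennreal (\<kappa> * real N powr (- (2 * \<beta> / p))) \<le>
        minimax_risk (joint_estimators m n) (smooth_class \<beta> L L\<beta>) (obs_law m n t x P) (\<lambda>g f. \<integral>\<^sup>+z\<in>unit_cube. ennreal ((norm (g z - f z))\<^sup>2) \<partial>lborel)" .
    qed simp
    show "(\<forall>x0\<in>unit_cube.
          ennreal C * minimax_risk (estimators m n) (smooth_class \<beta> L L\<beta>) (obs_law m n t x P)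
              (\<lambda>g f. ennreal ((norm (g x0 - f x0))\<^sup>2))
            \<ge> ennreal (real N powr (- (2 * \<beta> / (2 * (\<beta> + 1) + real CARD('d))))))"
      using pointwise unfolding p_def by blast
    show "ennreal C * minimax_risk (estimators m n) (smooth_class \<beta> L L\<beta>) (obs_law m n t x P)
            (\<lambda>g f. SUP z\<in>unit_cube. ennreal ((norm (g z - f z))\<^sup>2))
          \<ge> ennreal ((real N / ln (real N)) powr (- (2 * \<beta> / (2 * (\<beta> + 1) + real CARD('d)))))"
      using uniform unfolding p_def .
    show "ennreal C * minimax_risk (joint_estimators m n) (smooth_class \<beta> L L\<beta>) (obs_law m n t x P)
            (\<lambda>g f. \<integral>\<^sup>+z\<in>unit_cube. ennreal ((norm (g z - f z))\<^sup>2) \<partial>lborel)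
          \<ge> ennreal (real N powr (- (2 * \<beta> / (2 * (\<beta> + 1) + real CARD('d)))))"
      using integrated unfolding p_def .
  qed
qed

end
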